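(* Let $n\ge 6$. The sequence $\mathrm{RCL}(\mathcal{T}_n)$ can be generated by an RCL traversal of $\mathcal{T}_n$ that computes the children of each node on the fly (without storing the tree), in $O(1)$-amortized time per output bit (total time $O(L_n)$) using $O(n^2)$ space.
   Context: Binary strings are compared lexicographically with $0<1$ (a proper prefix is smaller). For $\alpha=a_1\cdots a_n$, $\alpha^R=a_n\cdots a_1$. $[\alpha]$ is the set of rotations; $\alpha$ is a necklace if lexicographically smallest in $[\alpha]$; a bracelet if lexicographically smallest in $[\alpha]\cup[\alpha^R]$; a necklace is symmetric if $\alpha^R\in[\alpha]$, else asymmetric. $\mathbf{A}(n)$: length-$n$ asymmetric bracelets. $\alpha$ is periodic if $\alpha=\gamma^j$ with $j>1$; $\mathrm{ap}(\alpha)$ is the shortest $\gamma$ with $\alpha=\gamma^t$, $t\ge1$; $L_n=\sum_{\alpha\in\mathbf{A}(n)}|\mathrm{ap}(\alpha)|$ (the length of $\mathrm{RCL}(\mathcal{T}_n)$). For $\alpha=a_1\cdots a_n$: $\mathrm{FirstOne}(\alpha)$ flips the first $1$ to $0$; $\mathrm{LastOne}(\alpha)$ is the necklace of $a_1\cdots a_{n-1}0$; $\mathrm{LastZero}(\alpha)$ flips the last $0$ to $1$. With $r_n=0^{n-4}1011$, $\mathrm{par}(\alpha)$ for $\alpha\in\mathbf{A}(n)\setminus\{r_n\}$ is $\mathrm{FirstOne}(\alpha)$ if this lies in $\mathbf{A}(n)$, else $\mathrm{LastOne}(\alpha)$ if this lies in $\mathbf{A}(n)$, else $\mathrm{LastZero}(\alpha)$.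 The concatenation tree $\mathcal{T}_n$: the root has label $r_n$ and change index $n$; a node with label $\alpha$ and change index $c$ has no children if $\alpha$ is periodic; otherwise, with $\beta$ the necklace of $[\alpha]$ and $\alpha_k$ the string $\alpha$ with bit $k$ complemented, its children are the nodes labeled $\alpha_k$ with change index $k$, for each $k\in\{1,\dots,n\}$ such that the necklace of $[\alpha_k]$ lies in $\mathbf{A}(n)$ and has $\mathrm{par}$ equal to $\beta$; children with $k>c$ are right-children, those with $k<c$ left-children, each ordered by increasing $k$. An RCL traversal visits, recursively, the right-children first to last, then the current node, then the left-children first to last; $\mathrm{RCL}(\mathcal{T}_n)$ is the concatenation of $\mathrm{ap}(\alpha)$ over the nodes $\alpha$ in RCL order starting from the root. *)

theory Defs
  imports Main "HOL-Library.List_Lexorder"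
begin

section \<open>Asymmetric bracelets\<close>

text \<open>Binary strings are of type \<^typ>\<open>bool list\<close>, with \<^const>\<open>False\<close> for \<open>0\<close> and
  \<^const>\<open>True\<close> for \<open>1\<close>; the order on them is the lexicographic one of
  \<^theory>\<open>HOL-Library.List_Lexorder\<close>.\<close>

definition rotations :: "bool list \<Rightarrow> bool list set" where
  "rotations \<alpha> = {rotate i \<alpha> | i. True}"

definition is_necklace :: "bool list \<Rightarrow> bool" where
  "is_necklace \<alpha> \<longleftrightarrow> (\<forall>\<beta>\<in>rotations \<alpha>. \<alpha> \<le> \<beta>)"

definition is_bracelet :: "bool list \<Rightarrow> bool" where
  "is_bracelet \<alpha> \<longleftrightarrow> (\<forall>\<beta>\<in>rotations \<alpha> \<union> rotations (rev \<alpha>). \<alpha> \<le> \<beta>)"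

definition symmetric :: "bool list \<Rightarrow> bool" where
  "symmetric \<alpha> \<longleftrightarrow> rev \<alpha> \<in> rotations \<alpha>"

definition asym_bracelets :: "nat \<Rightarrow> bool list set" where
  "asym_bracelets n = {\<alpha>. length \<alpha> = n \<and> is_bracelet \<alpha> \<and> \<not> symmetric \<alpha>}"

definition necklace_of :: "bool list \<Rightarrow> bool list" where
  "necklace_of \<alpha> = Min (rotations \<alpha>)"

definition str_pow :: "'a list \<Rightarrow> nat \<Rightarrow> 'a list" where
  "str_pow \<gamma> t = concat (replicate t \<gamma>)"

definition periodic :: "'a list \<Rightarrow> bool" where
  "periodic \<alpha> \<longleftrightarrow> (\<exists>\<gamma> j. j > 1 \<and> \<alpha> = str_pow \<gamma> j)"

definition ap :: "'a list \<Rightarrow> 'a list" where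
  "ap \<alpha> = (ARG_MIN length \<gamma>. \<exists>t\<ge>1. \<alpha> = str_pow \<gamma> t)"

definition Lsum :: "nat \<Rightarrow> nat" where
  "Lsum n = (\<Sum>\<alpha>\<in>asym_bracelets n. length (ap \<alpha>))"


section \<open>The parent rule and the concatenation tree\<close>

text \<open>A \<^const>\<open>list_update\<close> beyond the end of the list is void, so \<open>first_one\<close> and \<open>last_zero\<close>
  leave a string without \<open>1\<close> (respectively without \<open>0\<close>) unchanged; no such string is an
  asymmetric bracelet.\<close>

definition first_one :: "bool list \<Rightarrow> bool list" where
  "first_one \<alpha> = \<alpha>[length (takeWhile Not \<alpha>) := False]"

definition last_one :: "bool list \<Rightarrow> bool list" where
  "last_one \<alpha> = necklace_of (butlast \<alpha> @ [False])"

definition last_zero :: "bool list \<Rightarrow> bool list" where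
  "last_zero \<alpha> = rev ((rev \<alpha>)[length (takeWhile id (rev \<alpha>)) := True])"

definition root_label :: "nat \<Rightarrow> bool list" where
  "root_label n = replicate (n - 4) False @ [True, False, True, True]"

definition par :: "nat \<Rightarrow> bool list \<Rightarrow> bool list" where
  "par n \<alpha> =
     (if first_one \<alpha> \<in> asym_bracelets n then first_one \<alpha>
      else if last_one \<alpha> \<in> asym_bracelets n then last_one \<alpha>
      else last_zero \<alpha>)"

text \<open>Bit positions are counted from \<open>1\<close>.\<close>

definition flip :: "bool list \<Rightarrow> nat \<Rightarrow> bool list" where
  "flip \<alpha> k = \<alpha>[k - 1 := \<not> \<alpha> ! (k - 1)]"

definition child_indices :: "nat \<Rightarrow> bool list \<Rightarrow> nat list" where
  "child_indices n \<alpha> =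
     (if periodic \<alpha> then []
      else filter (\<lambda>k. necklace_of (flip \<alpha> k) \<in> asym_bracelets n - {root_label n} \<and>
                       par n (necklace_of (flip \<alpha> k)) = necklace_of \<alpha>) [1..<Suc n])"

text \<open>\<open>CNode \<alpha> c rs ls\<close>: label \<open>\<alpha>\<close>, change index \<open>c\<close>, right-children \<open>rs\<close>, left-children \<open>ls\<close>.\<close>

datatype ctree = CNode "bool list" nat "ctree list" "ctree list"

inductive subtree_at :: "nat \<Rightarrow> bool list \<Rightarrow> nat \<Rightarrow> ctree \<Rightarrow> bool" for n where
  "\<lbrakk>list_all2 (\<lambda>k t. subtree_at n (flip \<alpha> k) k t) (filter (\<lambda>k. k > c) (child_indices n \<alpha>)) rs;
    list_all2 (\<lambda>k t. subtree_at n (flip \<alpha> k) k t) (filter (\<lambda>k. k < c) (child_indices n \<alpha>)) ls\<rbrakk>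
   \<Longrightarrow> subtree_at n \<alpha> c (CNode \<alpha> c rs ls)"

text \<open>Existence and uniqueness of this tree is shown in \<open>ex1_conc_tree\<close> below.\<close>

definition conc_tree :: "nat \<Rightarrow> ctree" where
  "conc_tree n = (THE t. subtree_at n (root_label n) n t)"

fun rcl_order :: "ctree \<Rightarrow> bool list list" where
  "rcl_order (CNode \<alpha> c rs ls) =
     concat (map rcl_order rs) @ [\<alpha>] @ concat (map rcl_order ls)"

definition RCL :: "ctree \<Rightarrow> bool list" where
  "RCL t = concat (map ap (rcl_order t))"


section \<open>Events of an RCL traversal\<close>

datatype event = Enter "bool list" nat | Emit bool | Leave

fun rcl_walk :: "ctree \<Rightarrow> event list" where
  "rcl_walk (CNode \<alpha> c rs ls) =
     [Enter \<alpha> c] @ concat (map rcl_walk rs) @ map Emit (ap \<alpha>) @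
     concat (map rcl_walk ls) @ [Leave]"

definition output_bits :: "event list \<Rightarrow> bool list" where
  "output_bits es = concat (map (\<lambda>e. case e of Emit b \<Rightarrow> [b] | _ \<Rightarrow> []) es)"


section \<open>The random access machine\<close>

text \<open>A unit-cost RAM with structured control flow. The memory is a sequence of words. A program
  is a finite list of parameterless, possibly recursive procedures; execution starts with
  procedure \<open>0\<close>. All expressions of a program have constant size, so each step of the semantics
  is a constant number of elementary RAM operations.\<close>

type_synonym mem = "nat \<Rightarrow> nat"

datatype aexp =
    Const nat | Load aexp | Plus aexp aexp | Minus aexp aexp | Times aexp aexp
  | Less aexp aexp | Eq aexp aexp

fun eval :: "mem \<Rightarrow> aexp \<Rightarrow> nat" where
  "eval m (Const i) = i"
| "eval m (Load e) = m (eval m e)"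
| "eval m (Plus e f) = eval m e + eval m f"
| "eval m (Minus e f) = eval m e - eval m f"
| "eval m (Times e f) = eval m e * eval m f"
| "eval m (Less e f) = (if eval m e < eval m f then 1 else 0)"
| "eval m (Eq e f) = (if eval m e = eval m f then 1 else 0)"

text \<open>\<open>ENTER a l c\<close> and \<open>LEAVE\<close> are annotations: they report that the traversal now moves
  down to the node whose label is held in the \<open>l\<close> memory cells from address \<open>a\<close> on and whose change
  index is \<open>c\<close>, or back up to the parent. They influence neither the memory nor the control
  flow.\<close>

datatype cmd =
    SKIP
  | STORE aexp aexp
  | SEQ cmd cmd
  | IF aexp cmd cmd
  | WHILE aexp cmd
  | CALL nat
  | OUTPUT aexp
  | ENTER aexp aexp aexp
  | LEAVE

text \<open>A configuration consists of the control stack, the memory, and the events so far. The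
  entries of the control stack are subterms of the program, i.e. program addresses. The event list
  is write-only.\<close>

type_synonym config = "cmd list \<times> mem \<times> event list"

fun step :: "cmd list \<Rightarrow> config \<Rightarrow> config" where
  "step P ([], m, es) = ([], m, es)"
| "step P (SKIP # s, m, es) = (s, m, es)"
| "step P (STORE a e # s, m, es) = (s, m(eval m a := eval m e), es)"
| "step P (SEQ c d # s, m, es) = (c # d # s, m, es)"
| "step P (IF e c d # s, m, es) = ((if eval m e \<noteq> 0 then c else d) # s, m, es)"
| "step P (WHILE e c # s, m, es) = (if eval m e \<noteq> 0 then c # WHILE e c # s else s, m, es)"
| "step P (CALL p # s, m, es) = (if p < length P then P ! p # s else s, m, es)"
| "step P (OUTPUT e # s, m, es) = (s, m, es @ [Emit (eval m e \<noteq> 0)])"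
| "step P (ENTER a l c # s, m, es) =
     (s, m, es @ [Enter (map (\<lambda>i. m (eval m a + i) \<noteq> 0) [0..<eval m l]) (eval m c)])"
| "step P (LEAVE # s, m, es) = (s, m, es @ [Leave])"

text \<open>The input \<open>n\<close> is in cell \<open>0\<close>, all other cells are \<open>0\<close>.\<close>

definition config_at :: "cmd list \<Rightarrow> nat \<Rightarrow> nat \<Rightarrow> config" where
  "config_at P n t = (step P ^^ t) ([CALL 0], (\<lambda>_. 0)(0 := n), [])"

definition halts_within :: "cmd list \<Rightarrow> nat \<Rightarrow> nat \<Rightarrow> event list \<Rightarrow> bool" where
  "halts_within P n T es \<longleftrightarrow> (\<exists>m. config_at P n T = ([], m, es))"

text \<open>Space counts words: at any time, the control stack and the memory cells up to the last
  nonzero one. Events, being output, are not counted.\<close>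

definition space_within :: "cmd list \<Rightarrow> nat \<Rightarrow> nat \<Rightarrow> bool" where
  "space_within P n S \<longleftrightarrow>
     (\<forall>t s m es. config_at P n t = (s, m, es) \<longrightarrow>
        (\<exists>C. (\<forall>a\<ge>C. m a = 0) \<and> length s + C \<le> S))"

definition words_below :: "cmd list \<Rightarrow> nat \<Rightarrow> nat \<Rightarrow> bool" where
  "words_below P n W \<longleftrightarrow>
     (\<forall>t s m es. config_at P n t = (s, m, es) \<longrightarrow> (\<forall>a. m a < W))"


section \<open>Existence and uniqueness of the concatenation tree\<close>

lemma subtree_at_unique:
  assumes "subtree_at n \<alpha> c t" and "subtree_at n \<alpha> c t'"
  shows "t = t'"
  using assms
proof (induction arbitrary: t' rule: subtree_at.induct)
  case (1 \<alpha> c rs ls)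
  from 1(3) obtain rs' ls' where t': "t' = CNode \<alpha> c rs' ls'"
    and r: "list_all2 (\<lambda>k t. subtree_at n (flip \<alpha> k) k t) (filter (\<lambda>k. k > c) (child_indices n \<alpha>)) rs'"
    and l: "list_all2 (\<lambda>k t. subtree_at n (flip \<alpha> k) k t) (filter (\<lambda>k. k < c) (child_indices n \<alpha>)) ls'"
    by (cases rule: subtree_at.cases) auto
  have "rs = rs'" using 1(1) r by (auto simp: list_all2_conv_all_nth intro!: nth_equalityI)
  moreover have "ls = ls'" using 1(2) l by (auto simp: list_all2_conv_all_nth intro!: nth_equalityI)
  ultimately show ?case using t' by simp
qed

lemma finite_rotations: "finite (rotations \<alpha>)"
proof -
  have "rotations \<alpha> \<subseteq> {xs. set xs \<subseteq> set \<alpha> \<and> length xs = length \<alpha>}"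
    by (auto simp: rotations_def)
  then show ?thesis
    using finite_lists_length_eq[of "set \<alpha>" "length \<alpha>"] finite_subset by blast
qed

lemma self_in_rotations: "\<alpha> \<in> rotations \<alpha>"
  unfolding rotations_def by (auto intro: exI[of _ 0])

lemma necklace_of_in: "necklace_of \<alpha> \<in> rotations \<alpha>"
  unfolding necklace_of_def using finite_rotations self_in_rotations Min_in by blast

lemma length_necklace_of [simp]: "length (necklace_of \<alpha>) = length \<alpha>"
  using necklace_of_in[of \<alpha>] by (auto simp: rotations_def)

lemma length_flip [simp]: "length (flip \<alpha> k) = length \<alpha>"
  by (simp add: flip_def)

lemma list_less_nthI:
  fixes xs ys :: "bool list"
  assumes "i < length xs" "i < length ys" "take i xs = take i ys" "xs ! i < ys ! i"
  shows "xs < ys"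
  unfolding list_less_def lexord_take_index_conv using assms by (intro disjI2 exI[of _ i]) simp

lemma root_less_rotate:
  assumes n: "n \<ge> 6" and i: "0 < i" "i < n"
  shows "root_label n < rotate i (root_label n)"
proof -
  have len: "length (root_label n) = n" using n by (simp add: root_label_def)
  have rot: "rotate i (root_label n) ! j = root_label n ! ((i + j) mod n)" if "j < n" for j
    using that len by (simp add: nth_rotate)
  have r0: "root_label n ! j = False" if "j < n - 4" for j
    using that by (simp add: root_label_def nth_append)
  have r1: "root_label n ! (n - 4) = True" "root_label n ! (n - 3) = False"
    "root_label n ! (n - 2) = True" "root_label n ! (n - 1) = True"
  proof -
    have "n - 3 - (n - 4) = 1" "n - 2 - (n - 4) = 2" "n - 1 - (n - 4) = 3" using n by auto
    then show "root_label n ! (n - 4) = True" "root_label n ! (n - 3) = False"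
      "root_label n ! (n - 2) = True" "root_label n ! (n - 1) = True"
      using n by (auto simp: root_label_def nth_append)
  qed
  consider "i \<le> n - 4" | "i = n - 3" | "i = n - 2 \<or> i = n - 1" using i by linarith
  then show ?thesis
  proof cases
    case 1
    let ?j = "n - 4 - i"
    show ?thesis
    proof (rule list_less_nthI)
      show "?j < length (root_label n)" "?j < length (rotate i (root_label n))" using len n by auto
      show "take ?j (root_label n) = take ?j (rotate i (root_label n))"
      proof (rule nth_equalityI)
        fix k assume "k < length (take ?j (root_label n))"
        then have k: "k < ?j" using len by simp
        then show "take ?j (root_label n) ! k = take ?j (rotate i (root_label n)) ! k"
          using r0[of k] r0[of "i + k"] rot[of k] by simp
      qed (use len in simp)
      have "rotate i (root_label n) ! ?j = True" using rot[of ?j] 1 n r1 by simp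
      moreover have "root_label n ! ?j = False" using i 1 by (intro r0) linarith
      ultimately show "root_label n ! ?j < rotate i (root_label n) ! ?j" by simp
    qed
  next
    case 2
    show ?thesis
    proof (rule list_less_nthI[of 1])
      show "1 < length (root_label n)" "1 < length (rotate i (root_label n))" using len n by auto
      have "root_label n ! 0 = rotate i (root_label n) ! 0" using rot[of 0] r0[of 0] 2 n r1 i by simp
      then show "take 1 (root_label n) = take 1 (rotate i (root_label n))"
        using len n by (intro nth_equalityI) auto
      have "i + 1 = n - 2" using 2 n by simp
      then have "rotate i (root_label n) ! 1" using rot[of 1] n r1 by simp
      moreover have "\<not> root_label n ! 1" using r0[of 1] n by simp
      ultimately show "root_label n ! 1 < rotate i (root_label n) ! 1" by simp
    qed
  next
    case 3
    show ?thesis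
    proof (rule list_less_nthI[of 0])
      show "0 < length (root_label n)" "0 < length (rotate i (root_label n))" using len n by auto
      have "rotate i (root_label n) ! 0" using rot[of 0] 3 i r1 by auto
      moreover have "\<not> root_label n ! 0" using r0[of 0] n by simp
      ultimately show "root_label n ! 0 < rotate i (root_label n) ! 0" by simp
    qed simp
  qed
qed

lemma necklace_of_root:
  assumes "n \<ge> 6"
  shows "necklace_of (root_label n) = root_label n"
proof -
  have len: "length (root_label n) = n" using assms by (simp add: root_label_def)
  have "root_label n \<le> \<beta>" if "\<beta> \<in> rotations (root_label n)" for \<beta>
  proof -
    from that obtain i where "\<beta> = rotate i (root_label n)" by (auto simp: rotations_def)
    then have \<beta>: "\<beta> = rotate (i mod n) (root_label n)" using rotate_conv_mod[of i "root_label n"] len by simp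
    show ?thesis
    proof (cases "i mod n = 0")
      case False
      then show ?thesis using root_less_rotate[OF assms, of "i mod n"] assms \<beta> by simp
    qed (simp add: \<beta>)
  qed
  then show ?thesis
    unfolding necklace_of_def by (intro Min_eqI) (auto simp: finite_rotations self_in_rotations)
qed

inductive reach :: "nat \<Rightarrow> nat \<Rightarrow> bool list \<Rightarrow> bool" for n where
  "reach n 0 (root_label n)"
| "reach n d \<alpha> \<Longrightarrow> k \<in> set (child_indices n \<alpha>) \<Longrightarrow> reach n (Suc d) (flip \<alpha> k)"

lemma reach_par:
  assumes "reach n d \<alpha>" and "n \<ge> 6"
  shows "(par n ^^ d) (necklace_of \<alpha>) = root_label n"
    and "j < d \<Longrightarrow> (par n ^^ j) (necklace_of \<alpha>) \<noteq> root_label n"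
    and "j \<le> d \<Longrightarrow> length ((par n ^^ j) (necklace_of \<alpha>)) = n"
    and "length \<alpha> = n"
  using assms
proof (induction arbitrary: j rule: reach.induct)
  case 1
  { case 1 then show ?case by (simp add: necklace_of_root) }
  { case 2 then show ?case by simp }
  { case 3 then show ?case by (simp add: root_label_def) }
  { case 4 then show ?case by (simp add: root_label_def) }
next
  case (2 d \<alpha> k)
  have k: "necklace_of (flip \<alpha> k) \<noteq> root_label n" "par n (necklace_of (flip \<alpha> k)) = necklace_of \<alpha>"
    using 2(2) by (auto simp: child_indices_def split: if_splits)
  { case 1 then show ?case using 2 k by (simp add: funpow_swap1[symmetric] funpow_Suc_right del: funpow.simps) }
  { case 2 then show ?case using "2.IH"(2) k by (cases j) (auto simp: funpow_Suc_right simp del: funpow.simps(2)) }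
  { case 3 then show ?case using "2.IH"(3,4) k by (cases j) (auto simp: funpow_Suc_right simp del: funpow.simps(2)) }
  { case 4 then show ?case using "2.IH"(4) by simp }
qed

lemma reach_bound:
  assumes "reach n d \<alpha>" and "n \<ge> 6"
  shows "d < card {xs :: bool list. length xs = n}"
proof -
  let ?f = "\<lambda>j. (par n ^^ j) (necklace_of \<alpha>)"
  have neq: "?f i \<noteq> ?f j" if "i < j" "j \<le> d" for i j
  proof
    assume "?f i = ?f j"
    then have "(par n ^^ (d - j)) (?f i) = (par n ^^ (d - j)) (?f j)" by simp
    then have "?f (d - j + i) = ?f (d - j + j)" by (simp add: funpow_add)
    then have "?f (d - j + i) = root_label n" using reach_par(1)[OF assms] that by simp
    moreover have "d - j + i < d" using that by linarith
    ultimately show False using reach_par(2)[OF assms] by blast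
  qed
  have "inj_on ?f {..d}"
  proof (rule inj_onI)
    fix i j assume "i \<in> {..d}" "j \<in> {..d}" and e: "?f i = ?f j"
    then show "i = j" using neq[of i j] neq[of j i] by (cases i j rule: linorder_cases) auto
  qed
  moreover have "?f ` {..d} \<subseteq> {xs. length xs = n}" using reach_par(3)[OF assms] by auto
  moreover have "finite {xs :: bool list. length xs = n}"
    using finite_lists_length_eq[of "UNIV :: bool set" n] by simp
  ultimately have "card {..d} \<le> card {xs :: bool list. length xs = n}"
    by (intro card_inj_on_le)
  then show ?thesis by simp
qed

lemma reach_subtree_at:
  assumes "reach n d \<alpha>" and n: "n \<ge> 6"
  shows "\<exists>t. subtree_at n \<alpha> c t"
  using assms(1)
proof (induction "card {xs :: bool list. length xs = n} - d" arbitrary: d \<alpha> c rule: less_induct)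
  case less
  have ex: "\<exists>t. subtree_at n (flip \<alpha> k) k t" if "k \<in> set (child_indices n \<alpha>)" for k
  proof -
    have "reach n (Suc d) (flip \<alpha> k)" using less.prems that by (rule reach.intros)
    moreover from reach_bound[OF less.prems n]
    have "card {xs :: bool list. length xs = n} - Suc d < card {xs :: bool list. length xs = n} - d"
      by linarith
    ultimately show ?thesis using less.hyps by blast
  qed
  then obtain T where T: "\<And>k. k \<in> set (child_indices n \<alpha>) \<Longrightarrow> subtree_at n (flip \<alpha> k) k (T k)"
    by metis
  have "subtree_at n \<alpha> c (CNode \<alpha> c (map T (filter (\<lambda>k. k > c) (child_indices n \<alpha>)))
                                    (map T (filter (\<lambda>k. k < c) (child_indices n \<alpha>))))"
    by (rule subtree_at.intros)
       (auto simp: list_all2_map2 intro!: list.rel_refl_strong T)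
  then show ?case by blast
qed

lemma ex1_conc_tree:
  assumes "n \<ge> 6"
  shows "\<exists>!t. subtree_at n (root_label n) n t"
  using reach_subtree_at[OF reach.intros(1) assms] subtree_at_unique by blast

lemma conc_tree: "n \<ge> 6 \<Longrightarrow> subtree_at n (root_label n) n (conc_tree n)"
  unfolding conc_tree_def by (rule theI') (rule ex1_conc_tree)

lemma output_rcl_walk: "output_bits (rcl_walk t) = RCL t"
proof -
  have app: "output_bits (xs @ ys) = output_bits xs @ output_bits ys" for xs ys
    by (simp add: output_bits_def)
  have con: "output_bits (concat xss) = concat (map output_bits xss)" for xss
    by (induction xss) (simp_all add: app, simp add: output_bits_def)
  have cons: "output_bits (Enter \<beta> k # es) = output_bits es" "output_bits [Leave] = []" for \<beta> k es
    by (simp_all add: output_bits_def)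
  have emit: "output_bits (map Emit bs) = bs" for bs
    by (induction bs) (simp_all add: output_bits_def)
  have rcon: "concat (map ap (concat (map rcl_order ts))) = concat (map RCL ts)" for ts
    by (induction ts) (simp_all add: RCL_def)
  show ?thesis
  proof (induction t)
    case (CNode \<alpha> c rs ls)
    then have "map (output_bits \<circ> rcl_walk) rs = map RCL rs" "map (output_bits \<circ> rcl_walk) ls = map RCL ls"
      by auto
    then show ?case
      using rcon[of rs] rcon[of ls]
      by (simp add: app con cons emit RCL_def[of "CNode \<alpha> c rs ls"] comp_def cong: map_cong)
  qed
qed

end

theory Submission
  imports Defs
begin

text \<open>
  Write the necklace of a node as \<open>\<beta> = 0\<^sup>z y\<close>, where \<open>y\<close> starts and ends with \<open>1\<close>. A child of \<open>\<beta>\<close>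
  arises by setting a bit of the leading block \<open>0\<^sup>z\<close> (FirstOne, LastOne) or by clearing a bit of the trailing
  ones (LastZero). Comparing the outermost runs of zeros and ones of a child with those of its reversal
  confines the changed position to two intervals of the block and to three further positions, and the inner
  positions of the intervals always give aperiodic children, because there the child has a unique longest
  run of zeros. So at most eleven of the positions that have to be tested fail or give a periodic
  child, and a linear-time test of each of them is paid for by the output of the node and of its aperiodic
  children.

  If changing two different bits of an aperiodic \<open>\<beta>\<close> gave conjugate strings, then \<open>\<beta>\<close> would be
  constant on each residue class modulo some divisor of \<open>n\<close> except one, and a reflection would preserve \<open>\<beta>\<close>
  on that class; for the bits changed by the parent rule this contradicts asymmetry. Hence distinct nodes have distinct
  necklaces, which bounds the output by \<open>L\<^sub>n\<close>, and a label determines its change index. The traversal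
  can therefore recompute the change index on its way up and needs no stack.
\<close>

section \<open>A language of bit arrays and its compilation\<close>

text \<open>A child test recomputes a necklace and the parent rule and so takes linear time, while a
  node has \<open>n\<close> positions and outputs at most \<open>n\<close> bits. All but boundedly
  many failing tests must therefore be avoided by a constant-time filter, whose few parameters are
  computed once per visit. The filter has to accept every child, but it may err on a bounded number
  of positions. Periodic nodes are the second obstacle: they take linear time but may output few
  bits. They are leaves, and the positions at which they arise are exceptional as well, so an
  aperiodic node can pay for its periodic children. A periodic label does not determine its change
  index, as several rotation distances take it to its necklace. The recomputed index is used only on
  returning from a child, however, and a node with a child is aperiodic. The state of the traversal
  is thus little more than the current label, and the program is one main loop without calls, with a
  control stack of constant height. Up to a constant, time is bounded by \<open>n\<close> times the
  number of aperiodic nodes, which is at most \<open>L\<^sub>n\<close> and at most the length of the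
  output.\<close>

datatype hexp = Cst nat | Var nat | Bit nat hexp | Add hexp hexp | Sub hexp hexp | Mul hexp hexp | Lt hexp hexp | Equ hexp hexp

datatype hcmd = Nop | Asg nat hexp | Put nat hexp hexp | Seq hcmd hcmd (infixr ";;" 60) | Cond hexp hcmd hcmd
  | Loop hexp hcmd | Out hexp | Ent hexp | Lv

text \<open>Scalars and bit arrays. Scalar \<open>0\<close> holds \<open>n\<close>, the common
  length of the arrays, and no command changes it.\<close>

type_synonym hstate = "(nat \<Rightarrow> nat) \<times> (nat \<Rightarrow> nat \<Rightarrow> bool)"

fun eval_ex :: "hstate \<Rightarrow> hexp \<Rightarrow> nat" where
  "eval_ex \<sigma> (Cst i) = i"
| "eval_ex \<sigma> (Var x) = fst \<sigma> x"
| "eval_ex \<sigma> (Bit j e) = of_bool (eval_ex \<sigma> e < fst \<sigma> 0 \<and> snd \<sigma> j (eval_ex \<sigma> e))"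
| "eval_ex \<sigma> (Add e f) = eval_ex \<sigma> e + eval_ex \<sigma> f"
| "eval_ex \<sigma> (Sub e f) = eval_ex \<sigma> e - eval_ex \<sigma> f"
| "eval_ex \<sigma> (Mul e f) = eval_ex \<sigma> e * eval_ex \<sigma> f"
| "eval_ex \<sigma> (Lt e f) = of_bool (eval_ex \<sigma> e < eval_ex \<sigma> f)"
| "eval_ex \<sigma> (Equ e f) = of_bool (eval_ex \<sigma> e = eval_ex \<sigma> f)"

definition bits :: "hstate \<Rightarrow> nat \<Rightarrow> bool list" where
  "bits \<sigma> j = map (snd \<sigma> j) [0..<fst \<sigma> 0]"

text \<open>The clipping done by the compiled code is part of the source semantics, so that
  compilation is correct without side conditions. The factor \<open>8\<close> leaves ample room: the
  pointers of the least-rotation search stay within \<open>2 * n + 1\<close>.\<close>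

definition assign :: "nat \<Rightarrow> nat \<Rightarrow> hstate \<Rightarrow> hstate" where
  "assign x e \<sigma> = (if x = 0 then \<sigma> else ((fst \<sigma>)(x := if e < 8 * fst \<sigma> 0 then e else 0), snd \<sigma>))"

text \<open>An index out of range is redirected to cell \<open>0\<close> instead of being ignored,
  because the compiled store always writes somewhere.\<close>

definition put_bit :: "nat \<Rightarrow> nat \<Rightarrow> nat \<Rightarrow> hstate \<Rightarrow> hstate" where
  "put_bit j i e \<sigma> = (fst \<sigma>, (snd \<sigma>)(j := (snd \<sigma> j)((if i < fst \<sigma> 0 then i else 0) := (e \<noteq> 0))))"

text \<open>The number \<open>t\<close> is the exact number of machine steps of the compiled
  command: unfolding a sequence and evaluating a test cost one each.\<close>

inductive exec :: "hcmd \<Rightarrow> hstate \<Rightarrow> event list \<Rightarrow> nat \<Rightarrow> hstate \<Rightarrow> bool" where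
  exec_Nop: "exec Nop \<sigma> [] 1 \<sigma>"
| exec_Asg: "exec (Asg x e) \<sigma> [] 1 (assign x (eval_ex \<sigma> e) \<sigma>)"
| exec_Put: "exec (Put j i e) \<sigma> [] 1 (put_bit j (eval_ex \<sigma> i) (eval_ex \<sigma> e) \<sigma>)"
| exec_Seq: "exec c \<sigma> es t \<sigma>' \<Longrightarrow> exec d \<sigma>' es' t' \<sigma>'' \<Longrightarrow> exec (c ;; d) \<sigma> (es @ es') (Suc (t + t')) \<sigma>''"
| exec_Cond1: "eval_ex \<sigma> b \<noteq> 0 \<Longrightarrow> exec c \<sigma> es t \<sigma>' \<Longrightarrow> exec (Cond b c d) \<sigma> es (Suc t) \<sigma>'"
| exec_Cond2: "eval_ex \<sigma> b = 0 \<Longrightarrow> exec d \<sigma> es t \<sigma>' \<Longrightarrow> exec (Cond b c d) \<sigma> es (Suc t) \<sigma>'"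
| exec_Loop1: "eval_ex \<sigma> b \<noteq> 0 \<Longrightarrow> exec c \<sigma> es t \<sigma>' \<Longrightarrow> exec (Loop b c) \<sigma>' es' t' \<sigma>'' \<Longrightarrow>
     exec (Loop b c) \<sigma> (es @ es') (Suc (t + t')) \<sigma>''"
| exec_Loop2: "eval_ex \<sigma> b = 0 \<Longrightarrow> exec (Loop b c) \<sigma> [] 1 \<sigma>"
| exec_Out: "exec (Out e) \<sigma> [Emit (eval_ex \<sigma> e \<noteq> 0)] 1 \<sigma>"
| exec_Ent: "exec (Ent e) \<sigma> [Enter (bits \<sigma> 0) (eval_ex \<sigma> e)] 1 \<sigma>"
| exec_Lv: "exec Lv \<sigma> [Leave] 1 \<sigma>"

subsection \<open>Compilation to the random access machine\<close>

text \<open>Scalar \<open>x\<close> lives in cell \<open>x < 40\<close>, bit \<open>i\<close> of array \<open>j\<close> in cell \<open>40 + j * n + i\<close>. All stored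
  values and indices are clipped, so that the bounds on space and word size hold whatever the
  program does.\<close>

abbreviation sizeN :: aexp where "sizeN \<equiv> Load (Const 0)"

fun compile_ex :: "hexp \<Rightarrow> aexp" where
  "compile_ex (Cst i) = Const i"
| "compile_ex (Var x) = Load (Const x)"
| "compile_ex (Bit j e) = Times (Less (compile_ex e) sizeN)
     (Less (Const 0) (Load (Plus (Plus (Const 40) (Times (Const j) sizeN)) (compile_ex e))))"
| "compile_ex (Add e f) = Plus (compile_ex e) (compile_ex f)"
| "compile_ex (Sub e f) = Minus (compile_ex e) (compile_ex f)"
| "compile_ex (Mul e f) = Times (compile_ex e) (compile_ex f)"
| "compile_ex (Lt e f) = Less (compile_ex e) (compile_ex f)"
| "compile_ex (Equ e f) = Eq (compile_ex e) (compile_ex f)"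

fun compile :: "hcmd \<Rightarrow> cmd" where
  "compile Nop = SKIP"
| "compile (Asg x e) = (if x = 0 then SKIP
     else STORE (Const x) (Times (compile_ex e) (Less (compile_ex e) (Times (Const 8) sizeN))))"
| "compile (Put j i e) = STORE (Plus (Plus (Const 40) (Times (Const j) sizeN))
     (Times (compile_ex i) (Less (compile_ex i) sizeN))) (Less (Const 0) (compile_ex e))"
| "compile (c ;; d) = SEQ (compile c) (compile d)"
| "compile (Cond b c d) = IF (compile_ex b) (compile c) (compile d)"
| "compile (Loop b c) = WHILE (compile_ex b) (compile c)"
| "compile (Out e) = OUTPUT (compile_ex e)"
| "compile (Ent e) = ENTER (Const 40) sizeN (compile_ex e)"
| "compile Lv = LEAVE"

fun wf_ex :: "hexp \<Rightarrow> bool" where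
  "wf_ex (Cst i) = True"
| "wf_ex (Var x) = (x < 40)"
| "wf_ex (Bit j e) = (j < 12 \<and> wf_ex e)"
| "wf_ex (Add e f) = (wf_ex e \<and> wf_ex f)"
| "wf_ex (Sub e f) = (wf_ex e \<and> wf_ex f)"
| "wf_ex (Mul e f) = (wf_ex e \<and> wf_ex f)"
| "wf_ex (Lt e f) = (wf_ex e \<and> wf_ex f)"
| "wf_ex (Equ e f) = (wf_ex e \<and> wf_ex f)"

fun wf_cmd :: "hcmd \<Rightarrow> bool" where
  "wf_cmd (Asg x e) = (x < 40 \<and> wf_ex e)"
| "wf_cmd (Put j i e) = (j < 12 \<and> wf_ex i \<and> wf_ex e)"
| "wf_cmd (c ;; d) = (wf_cmd c \<and> wf_cmd d)"
| "wf_cmd (Cond b c d) = (wf_ex b \<and> wf_cmd c \<and> wf_cmd d)"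
| "wf_cmd (Loop b c) = (wf_ex b \<and> wf_cmd c)"
| "wf_cmd (Out e) = wf_ex e"
| "wf_cmd (Ent e) = wf_ex e"
| "wf_cmd _ = True"

text \<open>Arrays read as \<open>False\<close> outside their range, so equality of abstract states
  does not depend on memory beyond the arrays.\<close>

definition abstract_state :: "mem \<Rightarrow> hstate" where
  "abstract_state m = (\<lambda>x. if x < 40 then m x else 0, \<lambda>j i. j < 12 \<and> i < m 0 \<and> m (40 + j * m 0 + i) \<noteq> 0)"

lemma eval_compile_ex: "wf_ex e \<Longrightarrow> eval m (compile_ex e) = eval_ex (abstract_state m) e"
  by (induction e) (auto simp: abstract_state_def)

lemma address_inj:
  fixes i i' j j' n :: nat
  assumes "i < n" "i' < n"
  shows "40 + j * n + i = 40 + j' * n + i' \<longleftrightarrow> j = j' \<and> i = i'"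
proof
  assume "40 + j * n + i = 40 + j' * n + i'"
  then have e: "j * n + i = j' * n + i'" by simp
  have "j = (j * n + i) div n" "j' = (j' * n + i') div n" using assms by auto
  then show "j = j' \<and> i = i'" using e by simp
qed simp

lemma abstract_assign:
  assumes "0 < x" "x < 40" "m 0 > 0"
  shows "abstract_state (m(x := if e < 8 * m 0 then e else 0)) = assign x e (abstract_state m)"
  using assms by (auto simp: abstract_state_def assign_def fun_eq_iff)

lemma abstract_put_bit:
  assumes "j < 12" "m 0 > 0"
  shows "abstract_state (m(40 + j * m 0 + (if i < m 0 then i else 0) := of_bool (e \<noteq> 0))) = put_bit j i e (abstract_state m)"
proof -
  let ?i = "if i < m 0 then i else 0"
  have i: "?i < m 0" using assms by simp
  show ?thesis
    unfolding abstract_state_def put_bit_def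
    using address_inj[OF _ i] assms by (auto simp: fun_eq_iff)
qed

text \<open>Induction over the big-step run, generalised over the control stack \<open>s\<close>
  below the command and the events \<open>e0\<close> emitted before it; a loop needs both, as it
  runs its body on top of itself. With \<open>m 0 > 0\<close> the redirected address of a clipped
  index lies inside its array.\<close>

lemma exec_compile:
  assumes "exec c \<sigma> es t \<sigma>'" "\<sigma> = abstract_state m" "wf_cmd c" "m 0 > 0"
  shows "\<exists>m'. abstract_state m' = \<sigma>' \<and> m' 0 = m 0 \<and> (step P ^^ t) (compile c # s, m, e0) = (s, m', e0 @ es)"
  using assms
proof (induction arbitrary: m s e0 rule: exec.induct)
  case (exec_Asg x e \<sigma>)
  show ?case
  proof (cases "x = 0")
    case False
    have "step P (compile (Asg x e) # s, m, e0) = (s, m(x := if eval_ex \<sigma> e < 8 * m 0 then eval_ex \<sigma> e else 0), e0)"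
      using exec_Asg False by (simp add: eval_compile_ex)
    moreover have "abstract_state (m(x := if eval_ex \<sigma> e < 8 * m 0 then eval_ex \<sigma> e else 0)) = assign x (eval_ex \<sigma> e) \<sigma>"
      using abstract_assign[of x m "eval_ex \<sigma> e"] exec_Asg False by simp
    ultimately show ?thesis using False
      by (intro exI[of _ "m(x := if eval_ex \<sigma> e < 8 * m 0 then eval_ex \<sigma> e else 0)"])
        (simp del: compile.simps fun_upd_apply, simp)
  qed (use exec_Asg in \<open>auto simp: assign_def\<close>)
next
  case (exec_Put j i e \<sigma>)
  let ?a = "40 + j * m 0 + (if eval_ex \<sigma> i < m 0 then eval_ex \<sigma> i else 0)"
  have "step P (compile (Put j i e) # s, m, e0) = (s, m(?a := of_bool (eval_ex \<sigma> e \<noteq> 0)), e0)"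
    using exec_Put by (simp add: eval_compile_ex)
  moreover have "?a \<noteq> 0" by simp
  moreover have "abstract_state (m(?a := of_bool (eval_ex \<sigma> e \<noteq> 0))) = put_bit j (eval_ex \<sigma> i) (eval_ex \<sigma> e) \<sigma>"
    using abstract_put_bit[of j m "eval_ex \<sigma> i" "eval_ex \<sigma> e"] exec_Put by simp
  ultimately show ?case
    by (intro exI[of _ "m(?a := of_bool (eval_ex \<sigma> e \<noteq> 0))"]) (simp del: compile.simps fun_upd_apply, simp)
next
  case (exec_Seq c \<sigma> es t \<sigma>' d es' t' \<sigma>'')
  from exec_Seq.IH(1)[of m "compile d # s" e0] exec_Seq.prems obtain m1 where m1: "abstract_state m1 = \<sigma>'" "m1 0 = m 0"
    "(step P ^^ t) (compile c # compile d # s, m, e0) = (compile d # s, m1, e0 @ es)" by auto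
  from exec_Seq.IH(2)[of m1 s "e0 @ es"] exec_Seq.prems m1 obtain m2 where m2: "abstract_state m2 = \<sigma>''" "m2 0 = m1 0"
    "(step P ^^ t') (compile d # s, m1, e0 @ es) = (s, m2, (e0 @ es) @ es')" by auto
  have "(step P ^^ Suc (t + t')) (compile (c ;; d) # s, m, e0) = (step P ^^ (t' + t)) (compile c # compile d # s, m, e0)"
    by (simp add: funpow_Suc_right add.commute del: funpow.simps)
  then show ?case using m1 m2 by (intro exI[of _ m2]) (simp add: funpow_add)
next
  case (exec_Cond1 \<sigma> b c es t \<sigma>' d)
  have "(step P ^^ Suc t) (compile (Cond b c d) # s, m, e0) = (step P ^^ t) (compile c # s, m, e0)"
    using exec_Cond1 by (simp add: funpow_Suc_right eval_compile_ex del: funpow.simps)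
  then show ?case using exec_Cond1 by auto
next
  case (exec_Cond2 \<sigma> b d es t \<sigma>' c)
  have "(step P ^^ Suc t) (compile (Cond b c d) # s, m, e0) = (step P ^^ t) (compile d # s, m, e0)"
    using exec_Cond2 by (simp add: funpow_Suc_right eval_compile_ex del: funpow.simps)
  then show ?case using exec_Cond2 by auto
next
  case (exec_Loop1 \<sigma> b c es t \<sigma>' es' t' \<sigma>'')
  from exec_Loop1.IH(1)[of m "compile (Loop b c) # s" e0] exec_Loop1.prems obtain m1 where m1: "abstract_state m1 = \<sigma>'" "m1 0 = m 0"
    "(step P ^^ t) (compile c # compile (Loop b c) # s, m, e0) = (compile (Loop b c) # s, m1, e0 @ es)" by auto
  from exec_Loop1.IH(2)[of m1 s "e0 @ es"] exec_Loop1.prems m1 obtain m2 where m2: "abstract_state m2 = \<sigma>''" "m2 0 = m1 0"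
    "(step P ^^ t') (compile (Loop b c) # s, m1, e0 @ es) = (s, m2, (e0 @ es) @ es')" by auto
  have "(step P ^^ Suc (t + t')) (compile (Loop b c) # s, m, e0)
      = (step P ^^ (t' + t)) (compile c # compile (Loop b c) # s, m, e0)"
    using exec_Loop1 by (simp add: funpow_Suc_right eval_compile_ex add.commute del: funpow.simps)
  then show ?case using m1 m2 by (intro exI[of _ m2]) (simp add: funpow_add)
next
  case (exec_Ent e \<sigma>)
  then show ?case by (auto simp: eval_compile_ex bits_def abstract_state_def)
qed (auto simp: eval_compile_ex)

subsection \<open>Space and word size\<close>

fun safe :: "cmd \<Rightarrow> bool" where
  "safe (STORE a e) =
     ((\<exists>x f. a = Const x \<and> 0 < x \<and> x < 40 \<and> e = Times f (Less f (Times (Const 8) sizeN))) \<or>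
      (\<exists>j f g. j < 12 \<and> a = Plus (Plus (Const 40) (Times (Const j) sizeN)) (Times f (Less f sizeN)) \<and>
         e = Less (Const 0) g))"
| "safe (SEQ c d) = (safe c \<and> safe d)"
| "safe (IF e c d) = (safe c \<and> safe d)"
| "safe (WHILE e c) = safe c"
| "safe (CALL p) = False"
| "safe _ = True"

lemma safe_compile: "wf_cmd c \<Longrightarrow> safe (compile c)"
  by (induction c) auto

text \<open>A bound on the number of stack entries that executing a command creates, its own
  included: the head of a sequence runs above its tail, the body of a loop above the loop.\<close>

fun height :: "cmd \<Rightarrow> nat" where
  "height (SEQ c d) = max (Suc (height c)) (height d)"
| "height (IF e c d) = max (height c) (height d)"
| "height (WHILE e c) = Suc (height c)"
| "height _ = 1"

text \<open>Each entry is charged together with the entries below it. Unfolding an entry replaces it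
  by pieces for which this sum does not exceed the old one, so the bound is invariant.\<close>

fun stack_ok :: "nat \<Rightarrow> cmd list \<Rightarrow> bool" where
  "stack_ok D [] = True"
| "stack_ok D (c # s) = (safe c \<and> height c + length s \<le> D \<and> stack_ok D s)"

definition mem_ok :: "nat \<Rightarrow> mem \<Rightarrow> bool" where
  "mem_ok n m \<longleftrightarrow> m 0 = n \<and> (\<forall>a. m a < 8 * n) \<and> (\<forall>a \<ge> 40 + 12 * n. m a = 0)"

lemma height_pos: "height c \<ge> 1"
  by (induction c) auto

lemma stack_ok_length: "stack_ok D s \<Longrightarrow> length s \<le> D"
proof (cases s)
  case (Cons c s')
  then show "stack_ok D s \<Longrightarrow> length s \<le> D" using height_pos[of c] by simp
qed simp

lemma mem_ok_store:
  assumes "safe (STORE a e)" "mem_ok n m" "n > 0"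
  shows "mem_ok n (m(eval m a := eval m e))"
proof -
  from assms(1) consider
      (1) x f where "a = Const x" "0 < x" "x < 40" "e = Times f (Less f (Times (Const 8) sizeN))"
    | (2) j f g where "j < 12" "a = Plus (Plus (Const 40) (Times (Const j) sizeN)) (Times f (Less f sizeN))"
        "e = Less (Const 0) g"
    by auto
  then show ?thesis
  proof cases
    case 1
    then show ?thesis using assms by (auto simp: mem_ok_def)
  next
    case 2
    have "j * n + eval m f < 12 * n" if "eval m f < n"
    proof -
      have "j * n \<le> 11 * n" using 2 by (intro mult_le_mono1) simp
      then show ?thesis using that by linarith
    qed
    moreover have "j * n < 12 * n" using 2 assms by simp
    ultimately show ?thesis using assms 2 by (auto simp: mem_ok_def)
  qed
qed

lemma step_ok:
  assumes "stack_ok D s" "mem_ok n m" "n > 0" "step P (s, m, es) = (s', m', es')"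
  shows "stack_ok D s' \<and> mem_ok n m'"
proof (cases s)
  case (Cons c s2)
  show ?thesis
  proof (cases c)
    case (STORE a e)
    then have "safe (STORE a e)" "s' = s2" "m' = m(eval m a := eval m e)" "stack_ok D s2"
      using assms Cons by (auto simp del: safe.simps)
    then show ?thesis using mem_ok_store[OF _ assms(2,3)] by simp
  qed (use assms Cons in \<open>auto split: if_splits\<close>)
qed (use assms in auto)

text \<open>The initial call is the only command met that is not \<open>safe\<close>; the last
  disjunct covers it.\<close>

lemma config_ok:
  assumes "safe c" "n > 0" "config_at [c] n t = (s, m, es)"
  shows "stack_ok (height c) s \<and> mem_ok n m \<or> t = 0 \<and> s = [CALL 0] \<and> mem_ok n m"
  using assms(3)
proof (induction t arbitrary: s m es)
  case 0
  then show ?case using assms by (auto simp: config_at_def mem_ok_def)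
next
  case (Suc t)
  obtain s1 m1 es1 where c1: "config_at [c] n t = (s1, m1, es1)" by (metis prod_cases3)
  then have hstate: "step [c] (s1, m1, es1) = (s, m, es)" using Suc.prems by (simp add: config_at_def)
  from Suc.IH[OF c1] show ?case
  proof
    assume "stack_ok (height c) s1 \<and> mem_ok n m1"
    then show ?thesis using step_ok[OF _ _ assms(2) hstate] by blast
  next
    assume "t = 0 \<and> s1 = [CALL 0] \<and> mem_ok n m1"
    then show ?thesis using hstate assms by auto
  qed
qed

text \<open>Stack and memory are together linear in \<open>n\<close>, namely \<open>40\<close>
  scalar cells and \<open>12\<close> arrays plus a constant, and every word is below
  \<open>8 * n\<close>, which is at most \<open>n ^ 3\<close>.\<close>

lemma space_words:
  assumes "safe c" "n \<ge> 6" "K \<ge> height c + 60"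
  shows "space_within [c] n (K * n ^ 2)" "words_below [c] n (n ^ K)"
proof -
  have n2: "n \<le> n ^ 2" by (simp add: power2_eq_square)
  have "height c + 1 + (40 + 12 * n) \<le> K * n ^ 2"
  proof -
    have "height c + 1 + (40 + 12 * n) \<le> (height c + 60) * n"
      using assms(2) mult_le_mono2[of 1 n "height c + 48"] by (simp add: algebra_simps)
    also have "\<dots> \<le> K * n ^ 2" using assms(3) n2 by (rule mult_le_mono)
    finally show ?thesis .
  qed
  note b = this
  show "space_within [c] n (K * n ^ 2)"
    unfolding space_within_def
  proof (intro allI impI)
    fix t s m es assume "config_at [c] n t = (s, m, es)"
    from config_ok[OF assms(1) _ this] assms(2)
    have "mem_ok n m \<and> length s \<le> height c + 1" using stack_ok_length by fastforce
    then show "\<exists>C. (\<forall>a\<ge>C. m a = 0) \<and> length s + C \<le> K * n ^ 2"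
      using b by (intro exI[of _ "40 + 12 * n"]) (auto simp: mem_ok_def)
  qed
  have "8 * n \<le> n ^ 2 * n" using assms(2) mult_le_mono[of 6 n 6 n]
    by (intro mult_le_mono1) (simp add: power2_eq_square)
  also have "\<dots> = n ^ 3" by (simp add: power2_eq_square power3_eq_cube)
  also have "\<dots> \<le> n ^ K" using assms by (intro power_increasing) auto
  finally have b2: "8 * n \<le> n ^ K" .
  show "words_below [c] n (n ^ K)"
    unfolding words_below_def
  proof (intro allI impI)
    fix t s m es a assume "config_at [c] n t = (s, m, es)"
    from config_ok[OF assms(1) _ this] assms(2)
    have "mem_ok n m" by auto
    then show "m a < n ^ K" using b2 by (auto simp: mem_ok_def intro: less_le_trans)
  qed
qed

subsection \<open>A calculus of linear-time programs\<close>

fun mod_vars :: "hcmd \<Rightarrow> nat set" where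
  "mod_vars (Asg x e) = {x}"
| "mod_vars (c ;; d) = mod_vars c \<union> mod_vars d"
| "mod_vars (Cond b c d) = mod_vars c \<union> mod_vars d"
| "mod_vars (Loop b c) = mod_vars c"
| "mod_vars _ = {}"

fun mod_arrays :: "hcmd \<Rightarrow> nat set" where
  "mod_arrays (Put j i e) = {j}"
| "mod_arrays (c ;; d) = mod_arrays c \<union> mod_arrays d"
| "mod_arrays (Cond b c d) = mod_arrays c \<union> mod_arrays d"
| "mod_arrays (Loop b c) = mod_arrays c"
| "mod_arrays _ = {}"

text \<open>Specifications below only state what a command computes; whatever it leaves alone
  follows from its syntactic footprint.\<close>

definition frame :: "hcmd \<Rightarrow> hstate \<Rightarrow> hstate \<Rightarrow> bool" where
  "frame c \<sigma> \<sigma>' \<longleftrightarrow> fst \<sigma>' 0 = fst \<sigma> 0 \<and> (\<forall>x. x \<notin> mod_vars c \<longrightarrow> fst \<sigma>' x = fst \<sigma> x) \<and>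
     (\<forall>j. j \<notin> mod_arrays c \<longrightarrow> snd \<sigma>' j = snd \<sigma> j)"

lemma frame_refl: "frame c \<sigma> \<sigma>" by (simp add: frame_def)

lemma frame_trans: "frame c \<sigma> \<sigma>' \<Longrightarrow> frame c \<sigma>' \<sigma>'' \<Longrightarrow> frame c \<sigma> \<sigma>''" by (simp add: frame_def)

lemma exec_frame: "exec c \<sigma> es t \<sigma>' \<Longrightarrow> frame c \<sigma> \<sigma>'"
proof (induction rule: exec.induct)
  case (exec_Seq c \<sigma> es t \<sigma>' d es' t' \<sigma>'')
  then show ?case by (auto simp: frame_def)
next
  case (exec_Loop1 \<sigma> b c es t \<sigma>' es' t' \<sigma>'')
  then show ?case by (auto simp: frame_def)
qed (auto simp: frame_def assign_def put_bit_def)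

text \<open>Commands with events are excluded as well, so such a command is silent and takes
  constant time.\<close>

fun loop_free :: "hcmd \<Rightarrow> bool" where
  "loop_free Nop = True"
| "loop_free (Asg x e) = True"
| "loop_free (Put j i e) = True"
| "loop_free (c ;; d) = (loop_free c \<and> loop_free d)"
| "loop_free (Cond b c d) = (loop_free c \<and> loop_free d)"
| "loop_free _ = False"

fun run_straight :: "hcmd \<Rightarrow> hstate \<Rightarrow> hstate" where
  "run_straight (Asg x e) \<sigma> = assign x (eval_ex \<sigma> e) \<sigma>"
| "run_straight (Put j i e) \<sigma> = put_bit j (eval_ex \<sigma> i) (eval_ex \<sigma> e) \<sigma>"
| "run_straight (c ;; d) \<sigma> = run_straight d (run_straight c \<sigma>)"
| "run_straight (Cond b c d) \<sigma> = (if eval_ex \<sigma> b \<noteq> 0 then run_straight c \<sigma> else run_straight d \<sigma>)"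
| "run_straight _ \<sigma> = \<sigma>"

text \<open>For a loop, the factor \<open>4\<close> stands for a bound \<open>4 * n\<close> on the number of iterations, so that
  \<open>time_coeff c * n\<close> bounds the running time of a program without nested loops.\<close>

fun time_coeff :: "hcmd \<Rightarrow> nat" where
  "time_coeff (c ;; d) = time_coeff c + time_coeff d + 1"
| "time_coeff (Cond b c d) = time_coeff c + time_coeff d + 1"
| "time_coeff (Loop b c) = (time_coeff c + 1) * 4 + 1"
| "time_coeff _ = 1"

lemma exec_straight: "loop_free c \<Longrightarrow> \<exists>t. exec c \<sigma> [] t (run_straight c \<sigma>) \<and> t \<le> time_coeff c"
proof (induction c arbitrary: \<sigma>)
  case (Seq c d)
  from Seq.IH(1)[of \<sigma>] Seq.prems obtain t where t: "exec c \<sigma> [] t (run_straight c \<sigma>)" "t \<le> time_coeff c" by auto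
  from Seq.IH(2)[of "run_straight c \<sigma>"] Seq.prems obtain t' where
    t': "exec d (run_straight c \<sigma>) [] t' (run_straight d (run_straight c \<sigma>))" "t' \<le> time_coeff d" by auto
  show ?case by (rule exI[of _ "Suc (t + t')"]) (use exec_Seq[OF t(1) t'(1)] t t' in auto)
next
  case (Cond b c d)
  from Cond.IH(1)[of \<sigma>] Cond.prems obtain t where t: "exec c \<sigma> [] t (run_straight c \<sigma>)" "t \<le> time_coeff c" by auto
  from Cond.IH(2)[of \<sigma>] Cond.prems obtain t' where t': "exec d \<sigma> [] t' (run_straight d \<sigma>)" "t' \<le> time_coeff d" by auto
  show ?case
  proof (cases "eval_ex \<sigma> b = 0")
    case True
    show ?thesis by (rule exI[of _ "Suc t'"]) (use exec_Cond2[OF True t'(1)] t' True in auto)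
  next
    case False
    show ?thesis by (rule exI[of _ "Suc t"]) (use exec_Cond1[OF False t(1)] t False in auto)
  qed
next
  case Nop
  then show ?case using exec_Nop by fastforce
next
  case (Asg x e)
  then show ?case using exec_Asg by fastforce
next
  case (Put j i e)
  then show ?case using exec_Put by fastforce
qed auto

text \<open>Combines termination, silence, a linear time bound and a postcondition. For
  \<open>n = 0\<close> it holds vacuously, so that \<open>0 < n\<close> is available in every proof
  without being a premise of the rules.\<close>

definition wp :: "hcmd \<Rightarrow> (hstate \<Rightarrow> bool) \<Rightarrow> hstate \<Rightarrow> bool" where
  "wp c Q \<sigma> \<longleftrightarrow> (0 < fst \<sigma> 0 \<longrightarrow> (\<exists>t \<sigma>'. exec c \<sigma> [] t \<sigma>' \<and> t \<le> time_coeff c * fst \<sigma> 0 \<and> Q \<sigma>'))"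

lemma wpD: "wp c Q \<sigma> \<Longrightarrow> 0 < fst \<sigma> 0 \<Longrightarrow> \<exists>t \<sigma>'. exec c \<sigma> [] t \<sigma>' \<and> t \<le> time_coeff c * fst \<sigma> 0 \<and> Q \<sigma>'"
  by (simp add: wp_def)

lemma wp_frame: "wp c Q' \<sigma> \<Longrightarrow> (\<And>\<sigma>'. Q' \<sigma>' \<Longrightarrow> frame c \<sigma> \<sigma>' \<Longrightarrow> Q \<sigma>') \<Longrightarrow> wp c Q \<sigma>"
  unfolding wp_def using exec_frame by blast

lemma wp_straight: "loop_free c \<Longrightarrow> Q (run_straight c \<sigma>) \<Longrightarrow> wp c Q \<sigma>"
proof -
  assume "loop_free c" and Q: "Q (run_straight c \<sigma>)"
  then obtain t where t: "exec c \<sigma> [] t (run_straight c \<sigma>)" "t \<le> time_coeff c" using exec_straight by blast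
  show ?thesis unfolding wp_def
  proof
    assume "0 < fst \<sigma> 0"
    then have "time_coeff c * 1 \<le> time_coeff c * fst \<sigma> 0" by (intro mult_le_mono2) simp
    with t(2) have "t \<le> time_coeff c * fst \<sigma> 0" by linarith
    then show "\<exists>t \<sigma>'. exec c \<sigma> [] t \<sigma>' \<and> t \<le> time_coeff c * fst \<sigma> 0 \<and> Q \<sigma>'" using t Q by blast
  qed
qed

lemma wp_Nop: "Q \<sigma> \<Longrightarrow> wp Nop Q \<sigma>"
  by (rule wp_straight) auto

lemma wp_Asg: "Q (assign x (eval_ex \<sigma> e) \<sigma>) \<Longrightarrow> wp (Asg x e) Q \<sigma>"
  by (rule wp_straight) auto

lemma wp_Put: "Q (put_bit j (eval_ex \<sigma> i) (eval_ex \<sigma> e) \<sigma>) \<Longrightarrow> wp (Put j i e) Q \<sigma>"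
  by (rule wp_straight) auto

lemma wp_Seq: assumes "wp c (wp d Q) \<sigma>" shows "wp (c ;; d) Q \<sigma>"
  unfolding wp_def
proof
  assume n: "0 < fst \<sigma> 0"
  with assms obtain t \<sigma>1 where 1: "exec c \<sigma> [] t \<sigma>1" "t \<le> time_coeff c * fst \<sigma> 0" "wp d Q \<sigma>1"
    using wpD by blast
  from exec_frame[OF 1(1)] have e: "fst \<sigma>1 0 = fst \<sigma> 0" by (simp add: frame_def)
  with 1(3) n obtain t' \<sigma>2 where 2: "exec d \<sigma>1 [] t' \<sigma>2" "t' \<le> time_coeff d * fst \<sigma> 0" "Q \<sigma>2"
    unfolding wp_def by auto
  have "Suc (t + t') \<le> time_coeff (c ;; d) * fst \<sigma> 0" using 1 2 n by (simp add: algebra_simps)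
  then show "\<exists>t \<sigma>'. exec (c ;; d) \<sigma> [] t \<sigma>' \<and> t \<le> time_coeff (c ;; d) * fst \<sigma> 0 \<and> Q \<sigma>'"
    using exec_Seq[OF 1(1) 2(1)] 2(3) by (intro exI[of _ "Suc (t + t')"] exI[of _ \<sigma>2]) simp
qed

lemma wp_Cond:
  assumes "eval_ex \<sigma> b \<noteq> 0 \<Longrightarrow> wp c Q \<sigma>" "eval_ex \<sigma> b = 0 \<Longrightarrow> wp d Q \<sigma>"
  shows "wp (Cond b c d) Q \<sigma>"
  unfolding wp_def
proof
  assume n: "0 < fst \<sigma> 0"
  show "\<exists>t \<sigma>'. exec (Cond b c d) \<sigma> [] t \<sigma>' \<and> t \<le> time_coeff (Cond b c d) * fst \<sigma> 0 \<and> Q \<sigma>'"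
  proof (cases "eval_ex \<sigma> b = 0")
    case True
    with assms n obtain t \<sigma>1 where 1: "exec d \<sigma> [] t \<sigma>1" "t \<le> time_coeff d * fst \<sigma> 0" "Q \<sigma>1"
      unfolding wp_def by blast
    moreover have "Suc t \<le> time_coeff (Cond b c d) * fst \<sigma> 0" using 1 n by (simp add: algebra_simps)
    ultimately show ?thesis using exec_Cond2[OF True 1(1)] by blast
  next
    case False
    with assms n obtain t \<sigma>1 where 1: "exec c \<sigma> [] t \<sigma>1" "t \<le> time_coeff c * fst \<sigma> 0" "Q \<sigma>1"
      unfolding wp_def by blast
    moreover have "Suc t \<le> time_coeff (Cond b c d) * fst \<sigma> 0" using 1 n by (simp add: algebra_simps)
    ultimately show ?thesis using exec_Cond1[OF False 1(1)] by blast
  qed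
qed

text \<open>The body is loop-free, hence of constant time, so a measure of at most
  \<open>4 * n\<close> gives linear time. The premises may use the frame from the start of the loop,
  which keeps invariants down to what changes.\<close>

lemma wp_Loop:
  fixes \<mu> :: "hstate \<Rightarrow> nat"
  assumes "loop_free c" "Inv \<sigma>" "\<mu> \<sigma> \<le> 4 * fst \<sigma> 0"
    and step: "\<And>\<sigma>'. frame c \<sigma> \<sigma>' \<Longrightarrow> Inv \<sigma>' \<Longrightarrow> eval_ex \<sigma>' b \<noteq> 0 \<Longrightarrow> Inv (run_straight c \<sigma>') \<and> \<mu> (run_straight c \<sigma>') < \<mu> \<sigma>'"
    and exit: "\<And>\<sigma>'. frame c \<sigma> \<sigma>' \<Longrightarrow> Inv \<sigma>' \<Longrightarrow> eval_ex \<sigma>' b = 0 \<Longrightarrow> Q \<sigma>'"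
  shows "wp (Loop b c) Q \<sigma>"
proof -
  have "\<exists>t \<sigma>''. exec (Loop b c) \<sigma>' [] t \<sigma>'' \<and> t \<le> (time_coeff c + 1) * \<mu> \<sigma>' + 1 \<and> Q \<sigma>''"
    if "frame c \<sigma> \<sigma>'" "Inv \<sigma>'" for \<sigma>'
    using that
  proof (induction "\<mu> \<sigma>'" arbitrary: \<sigma>' rule: less_induct)
    case less
    show ?case
    proof (cases "eval_ex \<sigma>' b = 0")
      case True
      then show ?thesis using exec_Loop2[OF True] exit[OF less.prems]
        by (intro exI[of _ 1] exI[of _ \<sigma>']) simp
    next
      case False
      obtain t where t: "exec c \<sigma>' [] t (run_straight c \<sigma>')" "t \<le> time_coeff c" using exec_straight assms(1) by blast
      have i: "Inv (run_straight c \<sigma>')" "\<mu> (run_straight c \<sigma>') < \<mu> \<sigma>'" using step[OF less.prems False] by auto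
      have "frame c \<sigma> (run_straight c \<sigma>')" using frame_trans[OF less.prems(1) exec_frame[OF t(1)]] .
      from less.hyps[OF i(2) this i(1)] obtain t' \<sigma>'' where
        2: "exec (Loop b c) (run_straight c \<sigma>') [] t' \<sigma>''" "t' \<le> (time_coeff c + 1) * \<mu> (run_straight c \<sigma>') + 1" "Q \<sigma>''"
        by blast
      have "(time_coeff c + 1) * Suc (\<mu> (run_straight c \<sigma>')) \<le> (time_coeff c + 1) * \<mu> \<sigma>'" using i by (intro mult_le_mono2) simp
      then have "Suc (t + t') \<le> (time_coeff c + 1) * \<mu> \<sigma>' + 1" using t 2 by simp
      then show ?thesis using exec_Loop1[OF False t(1) 2(1)] 2(3)
        by (intro exI[of _ "Suc (t + t')"] exI[of _ \<sigma>'']) simp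
    qed
  qed
  from this[OF frame_refl assms(2)] obtain t \<sigma>'' where
    1: "exec (Loop b c) \<sigma> [] t \<sigma>''" "t \<le> (time_coeff c + 1) * \<mu> \<sigma> + 1" "Q \<sigma>''" by blast
  show ?thesis unfolding wp_def
  proof
    assume "0 < fst \<sigma> 0"
    moreover have "(time_coeff c + 1) * \<mu> \<sigma> \<le> (time_coeff c + 1) * (4 * fst \<sigma> 0)"
      using assms(3) by (rule mult_le_mono2)
    ultimately have "t \<le> time_coeff (Loop b c) * fst \<sigma> 0" using 1(2) by (simp add: algebra_simps)
    then show "\<exists>t \<sigma>'. exec (Loop b c) \<sigma> [] t \<sigma>' \<and> t \<le> time_coeff (Loop b c) * fst \<sigma> 0 \<and> Q \<sigma>'"
      using 1 by blast
  qed
qed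

section \<open>Necklaces and children\<close>

subsection \<open>Rotations\<close>

lemma rotate_in_rotations: "rotate i \<alpha> \<in> rotations \<alpha>"
  by (auto simp: rotations_def)

text \<open>Both rotations together move by a multiple of the length.\<close>

lemma rotate_back: "rotate (length \<alpha> * i - i) (rotate i \<alpha>) = \<alpha>"
proof (cases "\<alpha> = []")
  case False
  then have "length \<alpha> * i - i + i = length \<alpha> * i" by (simp add: Suc_leI)
  then show ?thesis using rotate_conv_mod[of "length \<alpha> * i" \<alpha>] by (simp add: rotate_rotate)
qed simp

lemma rotations_rotate [simp]: "rotations (rotate i \<alpha>) = rotations \<alpha>"
proof -
  have "rotations (rotate i \<beta>) \<subseteq> rotations \<beta>" for i \<beta>
    by (auto simp: rotations_def rotate_rotate)
  from this[of i \<alpha>] this[of "length \<alpha> * i - i" "rotate i \<alpha>"] show ?thesis by (simp add: rotate_back)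
qed

lemma rotations_eq_iff: "rotations \<alpha> = rotations \<beta> \<longleftrightarrow> \<alpha> \<in> rotations \<beta>"
proof
  assume "\<alpha> \<in> rotations \<beta>"
  then obtain i where "\<alpha> = rotate i \<beta>" by (auto simp: rotations_def)
  then show "rotations \<alpha> = rotations \<beta>" by simp
qed (use self_in_rotations in blast)

lemma rotations_sym: "\<alpha> \<in> rotations \<beta> \<Longrightarrow> \<beta> \<in> rotations \<alpha>"
  by (metis rotations_eq_iff)

lemma rotationsE:
  assumes "\<beta> \<in> rotations \<alpha>" "\<alpha> \<noteq> []"
  obtains d where "d < length \<alpha>" "\<beta> = rotate d \<alpha>"
proof -
  from assms obtain i where "\<beta> = rotate i \<alpha>" by (auto simp: rotations_def)
  then show thesis using that[of "i mod length \<alpha>"] assms(2) rotate_conv_mod[of i \<alpha>] by simp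
qed

lemma necklace_of_le: "\<beta> \<in> rotations \<alpha> \<Longrightarrow> necklace_of \<alpha> \<le> \<beta>"
  by (simp add: necklace_of_def finite_rotations)

lemma necklace_of_eqI:
  "\<delta> \<in> rotations \<alpha> \<Longrightarrow> (\<And>\<beta>. \<beta> \<in> rotations \<alpha> \<Longrightarrow> \<delta> \<le> \<beta>) \<Longrightarrow> necklace_of \<alpha> = \<delta>"
  unfolding necklace_of_def by (intro Min_eqI) (auto simp: finite_rotations)

lemma necklace_of_rotate [simp]: "necklace_of (rotate i \<alpha>) = necklace_of \<alpha>"
  by (simp add: necklace_of_def)

lemma necklace_of_eq_iff: "necklace_of \<alpha> = necklace_of \<beta> \<longleftrightarrow> \<alpha> \<in> rotations \<beta>"
proof
  assume "necklace_of \<alpha> = necklace_of \<beta>"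
  then have "necklace_of \<alpha> \<in> rotations \<alpha>" "necklace_of \<alpha> \<in> rotations \<beta>"
    using necklace_of_in[of \<alpha>] necklace_of_in[of \<beta>] by auto
  then show "\<alpha> \<in> rotations \<beta>" by (metis rotations_eq_iff)
next
  assume "\<alpha> \<in> rotations \<beta>"
  then show "necklace_of \<alpha> = necklace_of \<beta>" by (auto simp: rotations_def)
qed

lemma necklace_of_idem [simp]: "necklace_of (necklace_of \<alpha>) = necklace_of \<alpha>"
  by (simp add: necklace_of_eq_iff necklace_of_in)

lemma nth_rotate': "i < length \<alpha> \<Longrightarrow> rotate d \<alpha> ! i = \<alpha> ! ((d + i) mod length \<alpha>)"
  by (simp add: nth_rotate)

text \<open>Reduces membership to two least rotations and two comparisons, which is how the program
  decides it. The strictness accounts for asymmetry: the necklaces of \<open>s\<close> and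
  \<open>rev s\<close> coincide only if one is a rotation of the other.\<close>

lemma asym_bracelets_iff:
  "s \<in> asym_bracelets n \<longleftrightarrow> length s = n \<and> necklace_of s = s \<and> s < necklace_of (rev s)"
proof
  assume s: "s \<in> asym_bracelets n"
  have "necklace_of s = s"
    using s by (intro necklace_of_eqI) (auto simp: asym_bracelets_def is_bracelet_def self_in_rotations)
  moreover have "s \<le> necklace_of (rev s)"
    using s necklace_of_in[of "rev s"] by (auto simp: asym_bracelets_def is_bracelet_def)
  moreover have "s \<noteq> necklace_of (rev s)"
    using s necklace_of_in[of "rev s"] by (auto simp: asym_bracelets_def symmetric_def dest: rotations_sym)
  ultimately show "length s = n \<and> necklace_of s = s \<and> s < necklace_of (rev s)"
    using s by (auto simp: asym_bracelets_def)
next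
  assume s: "length s = n \<and> necklace_of s = s \<and> s < necklace_of (rev s)"
  have "is_bracelet s" unfolding is_bracelet_def
  proof
    fix \<beta> assume "\<beta> \<in> rotations s \<union> rotations (rev s)"
    then show "s \<le> \<beta>" using s necklace_of_le[of \<beta> s] necklace_of_le[of \<beta> "rev s"] by auto
  qed
  moreover have "\<not> symmetric s"
    using s necklace_of_eq_iff[of "rev s" s] by (auto simp: symmetric_def)
  ultimately show "s \<in> asym_bracelets n" using s by (auto simp: asym_bracelets_def)
qed

lemma asym_bracelets_le_rev:
  assumes "s \<in> asym_bracelets n" "\<beta> \<in> rotations (rev s)"
  shows "s < \<beta>"
  using assms necklace_of_le[OF assms(2)] by (auto simp: asym_bracelets_iff)

subsection \<open>Lexicographic order\<close>

lemma append_less_append [simp]: "u @ x < u @ (y :: bool list) \<longleftrightarrow> x < y"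
  by (induction u) auto

lemma zeros_less: "b < a \<Longrightarrow> replicate a False @ u < replicate b False @ True # v"
proof (induction b arbitrary: a)
  case 0
  then show ?case by (cases a) auto
next
  case (Suc b)
  then show ?case by (cases a) auto
qed

lemma ones_less: "a < b \<Longrightarrow> replicate a True @ False # u < replicate b True @ v"
proof (induction a arbitrary: b)
  case 0
  then show ?case by (cases b) auto
next
  case (Suc a)
  then show ?case by (cases b) auto
qed

text \<open>The strings differ for the first time at the first \<open>1\<close> of
  \<open>s'\<close>.\<close>

lemma less_zero_prefix:
  assumes "\<And>i. i < z \<Longrightarrow> \<not> s ! i" "j < z" "s' ! j" "z \<le> length s" "length s' = length s"
  shows "s < s'"
proof -
  define i where "i = (LEAST i. s' ! i)"
  have i: "s' ! i" "i \<le> j" unfolding i_def using assms(3) by (auto intro: LeastI Least_le)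
  have m: "\<not> s' ! l" if "l < i" for l using that not_less_Least unfolding i_def by blast
  show ?thesis
  proof (rule list_less_nthI[of i])
    show "take i s = take i s'"
      using assms i m by (intro nth_equalityI) auto
    show "s ! i < s' ! i" using assms(1)[of i] i assms(2) by simp
  qed (use i assms in auto)
qed

text \<open>Two rotations that agree on \<open>k\<close> letters and are then decided keep their
  order when up to \<open>k\<close> common letters are dropped. One comparison thus settles
  \<open>k + 1\<close> pairs of starting positions, which makes the searches for the least rotation
  and the least period linear.\<close>

lemma rotate_less_skip:
  assumes "length \<alpha> = n" "k < n" "\<And>l. l < k \<Longrightarrow> \<alpha> ! ((a + l) mod n) = \<alpha> ! ((b + l) mod n)"
    "\<not> \<alpha> ! ((a + k) mod n)" "\<alpha> ! ((b + k) mod n)" "l \<le> k"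
  shows "rotate (a + l) \<alpha> < rotate (b + l) \<alpha>"
proof (rule list_less_nthI[of "k - l"])
  show "take (k - l) (rotate (a + l) \<alpha>) = take (k - l) (rotate (b + l) \<alpha>)"
  proof (rule nth_equalityI)
    fix i assume "i < length (take (k - l) (rotate (a + l) \<alpha>))"
    then have "i < k - l" by simp
    then show "take (k - l) (rotate (a + l) \<alpha>) ! i = take (k - l) (rotate (b + l) \<alpha>) ! i"
      using assms(1,2) assms(3)[of "l + i"] by (simp add: nth_rotate' add.assoc)
  qed simp
  show "rotate (a + l) \<alpha> ! (k - l) < rotate (b + l) \<alpha> ! (k - l)"
    using assms by (simp add: nth_rotate' add.assoc)
qed (use assms in auto)

subsection \<open>Strings with a unique longest run_straight of zeros\<close>

text \<open>\<open>x\<close> is delimited by ones and has no run of \<open>z\<close> zeros, so in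
  the cyclic string \<open>replicate z False @ x\<close> the block is the only run of
  \<open>z\<close> zeros, and the longest run.\<close>

definition zero_block :: "nat \<Rightarrow> bool list \<Rightarrow> bool" where
  "zero_block z x \<longleftrightarrow> 0 < z \<and> x \<noteq> [] \<and> hd x \<and> last x \<and> (\<forall>a. a + z \<le> length x \<longrightarrow> (\<exists>j<z. x ! (a + j)))"

lemma zero_block_rev: assumes "zero_block z x" shows "zero_block z (rev x)"
  unfolding zero_block_def
proof (intro conjI allI impI)
  fix a assume a: "a + z \<le> length (rev x)"
  have "length x - (a + z) + z \<le> length x" using a by simp
  with assms obtain j where j: "j < z" "x ! (length x - (a + z) + j)" unfolding zero_block_def by blast
  have "rev x ! (a + (z - 1 - j)) = x ! (length x - (a + z) + j)"
    using a j by (subst rev_nth) (auto intro!: arg_cong[of _ _ "(!) x"])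
  then show "\<exists>j<z. rev x ! (a + j)" using j by (intro exI[of _ "z - 1 - j"]) auto
qed (use assms in \<open>auto simp: zero_block_def hd_rev last_rev\<close>)

text \<open>Every proper rotation has a \<open>1\<close> among its first \<open>z\<close> letters:
  it starts inside the block and meets the head of \<open>x\<close>, or its first \<open>z\<close>
  letters lie in \<open>x\<close>, or it starts so late that it meets the last letter of
  \<open>x\<close>.\<close>

lemma zero_block_less_rotate:
  assumes b: "zero_block z x" and d: "0 < d" "d < z + length x"
  shows "replicate z False @ x < rotate d (replicate z False @ x)"
proof -
  let ?s = "replicate z False @ x"
  have x: "x \<noteq> []" "x ! 0" "x ! (length x - 1)" "0 < z" using b by (auto simp: zero_block_def hd_conv_nth last_conv_nth)
  have "\<exists>j<z. rotate d ?s ! j"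
  proof -
    consider "d \<le> z" | "d > z" "d + z \<le> z + length x" | "d > z" "d > length x" using d by linarith
    then show ?thesis
    proof cases
      case 1
      then show ?thesis using x d by (intro exI[of _ "z - d"]) (auto simp: nth_rotate' nth_append)
    next
      case 2
      then have "d - z + z \<le> length x" by simp
      with b obtain j where "j < z" "x ! (d - z + j)" unfolding zero_block_def by blast
      then show ?thesis using 2 by (intro exI[of _ j]) (auto simp: nth_rotate' nth_append)
    next
      case 3
      let ?j = "z + length x - 1 - d"
      have j: "?j < z" "(d + ?j) mod (z + length x) = z + length x - 1" using 3 d by auto
      obtain m where m: "length x = Suc m" using x by (cases x) auto
      have "rotate d ?s ! ?j = x ! (length x - 1)"
        using j 3 d m by (simp add: nth_rotate' nth_append)
      then show ?thesis using x j by blast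
    qed
  qed
  then obtain j where "j < z" "rotate d ?s ! j" by blast
  then show ?thesis by (intro less_zero_prefix[of z _ j]) (auto simp: nth_append)
qed

lemma zero_block_necklace:
  assumes "zero_block z x" shows "necklace_of (replicate z False @ x) = replicate z False @ x"
proof (rule necklace_of_eqI)
  fix \<beta> assume "\<beta> \<in> rotations (replicate z False @ x)"
  moreover have "x \<noteq> []" using assms by (simp add: zero_block_def)
  ultimately obtain d where "d < z + length x" "\<beta> = rotate d (replicate z False @ x)"
    by (auto elim!: rotationsE)
  then show "replicate z False @ x \<le> \<beta>" using zero_block_less_rotate[OF assms, of d] by (cases "d = 0") auto
qed (rule self_in_rotations)

text \<open>Rotating the reversal brings its block to the front, and \<open>rev x\<close> again
  satisfies \<open>zero_block\<close>; the two necklaces share the block, and only \<open>x\<close>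
  and \<open>rev x\<close> are left to compare.\<close>

lemma zero_block_asym:
  assumes "zero_block z x" "n = z + length x"
  shows "replicate z False @ x \<in> asym_bracelets n \<longleftrightarrow> x < rev x"
proof -
  have "rotate (length x) (rev (replicate z False @ x)) = replicate z False @ rev x"
    using rotate_append[of "rev x" "replicate z False"] by simp
  then have "necklace_of (rev (replicate z False @ x)) = replicate z False @ rev x"
    using necklace_of_rotate[of "length x" "rev (replicate z False @ x)"] zero_block_necklace[OF zero_block_rev[OF assms(1)]]
    by simp
  then show ?thesis using zero_block_necklace[OF assms(1)] assms(2) by (simp add: asym_bracelets_iff)
qed

subsection \<open>Periods\<close>

lemma rotate_add_period: "rotate d \<alpha> = \<alpha> \<Longrightarrow> rotate (d * m + i) \<alpha> = rotate i \<alpha>"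
proof (induction m)
  case (Suc m)
  have "rotate (d * Suc m + i) \<alpha> = rotate (d * m + i) (rotate d \<alpha>)" by (simp add: rotate_rotate algebra_simps)
  then show ?case using Suc by simp
qed simp

lemma length_str_pow [simp]: "length (str_pow \<gamma> t) = t * length \<gamma>"
  by (induction t) (auto simp: str_pow_def)

lemma nth_str_pow: "i < t * length \<gamma> \<Longrightarrow> str_pow \<gamma> t ! i = \<gamma> ! (i mod length \<gamma>)"
proof (induction t arbitrary: i)
  case (Suc t)
  show ?case
  proof (cases "i < length \<gamma>")
    case False
    then have "str_pow \<gamma> (Suc t) ! i = str_pow \<gamma> t ! (i - length \<gamma>)"
      by (simp add: str_pow_def nth_append)
    then show ?thesis using Suc False by (simp add: le_mod_geq)
  qed (simp add: str_pow_def nth_append)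
qed simp

lemma rotate_str_pow: "rotate (length \<gamma>) (str_pow \<gamma> t) = str_pow \<gamma> t"
proof (cases t)
  case (Suc t')
  have "str_pow \<gamma> (Suc t') = \<gamma> @ str_pow \<gamma> t'" by (simp add: str_pow_def)
  moreover have "str_pow \<gamma> (Suc t') = str_pow \<gamma> t' @ \<gamma>"
    by (induction t') (auto simp: str_pow_def)
  ultimately show ?thesis using Suc rotate_append[of \<gamma> "str_pow \<gamma> t'"] by simp
qed (simp add: str_pow_def)

lemma str_pow_of_rotate:
  assumes "rotate d \<alpha> = \<alpha>" "0 < d" "d dvd length \<alpha>" "\<alpha> \<noteq> []"
  shows "\<alpha> = str_pow (take d \<alpha>) (length \<alpha> div d)"
proof (rule nth_equalityI)
  have dn: "d \<le> length \<alpha>" using assms by (simp add: dvd_imp_le)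
  then show "length \<alpha> = length (str_pow (take d \<alpha>) (length \<alpha> div d))" using assms by simp
  fix i assume i: "i < length \<alpha>"
  have "\<alpha> ! i = rotate i \<alpha> ! 0" using i assms by (simp add: nth_rotate')
  also have "\<dots> = rotate (i mod d) \<alpha> ! 0"
    using rotate_add_period[OF assms(1), of "i div d" "i mod d"] by simp
  also have "\<dots> = \<alpha> ! (i mod d)"
    using i assms by (simp add: nth_rotate' le_less_trans[OF mod_less_eq_dividend])
  finally show "\<alpha> ! i = str_pow (take d \<alpha>) (length \<alpha> div d) ! i"
    using i dn assms by (simp add: nth_str_pow min_absorb2)
qed

text \<open>The remainder of the length modulo \<open>p\<close> also gives a rotation that fixes
  \<alpha>, so it is zero by minimality. Any decomposition of \<alpha> as a power gives a period, so
  no base is shorter than \<open>p\<close>.\<close>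

lemma least_period:
  assumes "0 < p" "rotate p \<alpha> = \<alpha>" "\<And>q. 0 < q \<Longrightarrow> q < p \<Longrightarrow> rotate q \<alpha> \<noteq> \<alpha>" "\<alpha> \<noteq> []"
  shows "p dvd length \<alpha>" "ap \<alpha> = take p \<alpha>" "periodic \<alpha> \<longleftrightarrow> p < length \<alpha>"
proof -
  let ?n = "length \<alpha>"
  have "rotate (?n mod p) \<alpha> = rotate ?n \<alpha>"
    using rotate_add_period[OF assms(2), of "?n div p" "?n mod p"] by simp
  also have "\<dots> = \<alpha>" by (simp add: rotate_conv_mod)
  finally show dv: "p dvd ?n"
    using assms(1) assms(3)[of "?n mod p"] by (metis dvd_eq_mod_eq_0 mod_less_divisor not_gr_zero)
  then have pn: "p \<le> ?n" using assms(4) by (simp add: dvd_imp_le)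
  have pw: "\<alpha> = str_pow (take p \<alpha>) (?n div p)" by (rule str_pow_of_rotate) (use assms dv in auto)
  have t1: "?n div p \<ge> 1" using pn assms(1) by (simp add: div_greater_zero_iff Suc_leI)
  have min: "p \<le> length \<gamma> \<and> (length \<gamma> \<le> p \<longrightarrow> \<gamma> = take p \<alpha>)" if "\<alpha> = str_pow \<gamma> t" for \<gamma> t
  proof -
    have "length \<alpha> = t * length \<gamma>" by (subst that) simp
    moreover have "length \<alpha> > 0" using assms(4) by simp
    ultimately have g: "length \<gamma> > 0" by (cases "length \<gamma> = 0") auto
    have "rotate (length \<gamma>) \<alpha> = \<alpha>" unfolding that by (rule rotate_str_pow)
    then have 1: "p \<le> length \<gamma>" using assms(3)[of "length \<gamma>"] g by linarith
    have "t \<noteq> 0" using that assms(4) by (auto simp: str_pow_def)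
    then obtain t' where "t = Suc t'" by (cases t) auto
    then have "\<alpha> = \<gamma> @ str_pow \<gamma> t'" using that by (simp add: str_pow_def)
    then have "\<gamma> = take (length \<gamma>) \<alpha>" by simp
    with 1 show ?thesis by auto
  qed
  let ?P = "\<lambda>\<gamma>. \<exists>t\<ge>1. \<alpha> = str_pow \<gamma> t"
  have "?P (take p \<alpha>)" using pw t1 by blast
  from arg_min_nat_lemma[of ?P, OF this, of length]
  have a: "?P (ap \<alpha>)" and l: "length (ap \<alpha>) \<le> length (take p \<alpha>)" using pw t1 unfolding ap_def by auto
  from a obtain t where "\<alpha> = str_pow (ap \<alpha>) t" by blast
  note m = min[OF this]
  have "length (ap \<alpha>) \<le> p" using l pn by simp
  with m show "ap \<alpha> = take p \<alpha>" by blast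
  show "periodic \<alpha> \<longleftrightarrow> p < length \<alpha>"
  proof
    assume "periodic \<alpha>"
    then obtain \<gamma> j where "j > 1" "\<alpha> = str_pow \<gamma> j" by (auto simp: periodic_def)
    moreover from this have "length \<alpha> = j * length \<gamma>" using length_str_pow[of \<gamma> j] by (metis (lifting))
    moreover have "length \<alpha> > 0" using assms(4) by simp
    ultimately have "length \<gamma> < length \<alpha>" by (cases "length \<gamma> = 0") auto
    moreover have "p \<le> length \<gamma>" using min[OF \<open>\<alpha> = str_pow \<gamma> j\<close>] by simp
    ultimately show "p < length \<alpha>" by simp
  next
    assume "p < length \<alpha>"
    then have "?n div p > 1" using dv assms(1) by (auto elim!: dvdE)
    then show "periodic \<alpha>" using pw unfolding periodic_def by blast
  qed
qed

lemma least_period_ex: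
  assumes "\<alpha> \<noteq> []"
  obtains p where "0 < p" "rotate p \<alpha> = \<alpha>" "\<And>q. 0 < q \<Longrightarrow> q < p \<Longrightarrow> rotate q \<alpha> \<noteq> \<alpha>"
proof -
  let ?P = "\<lambda>p. 0 < p \<and> rotate p \<alpha> = \<alpha>"
  have "?P (length \<alpha>)" using assms by (simp add: rotate_conv_mod)
  then have "?P (LEAST p. ?P p)" by (rule LeastI)
  then show thesis using that[of "LEAST p. ?P p"] not_less_Least[of _ ?P] by blast
qed

lemma periodic_iff_rotate:
  assumes "\<alpha> \<noteq> []"
  shows "periodic \<alpha> \<longleftrightarrow> (\<exists>d. 0 < d \<and> d < length \<alpha> \<and> rotate d \<alpha> = \<alpha>)"
proof -
  obtain p where p: "0 < p" "rotate p \<alpha> = \<alpha>" "\<And>q. 0 < q \<Longrightarrow> q < p \<Longrightarrow> rotate q \<alpha> \<noteq> \<alpha>"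
    using least_period_ex assms by blast
  from least_period(3)[OF p assms] p show ?thesis by (meson le_less_trans linorder_not_less)
qed

lemma periodic_rotate: "periodic (rotate i \<alpha>) \<longleftrightarrow> periodic \<alpha>"
proof -
  have *: "periodic (rotate i \<beta>)" if "periodic \<beta>" for i \<beta>
  proof (cases "\<beta> = []")
    case False
    with that obtain d where d: "0 < d" "d < length \<beta>" "rotate d \<beta> = \<beta>" by (auto simp: periodic_iff_rotate)
    then have "rotate d (rotate i \<beta>) = rotate i \<beta>" by (metis rotate_rotate add.commute)
    then show ?thesis using d False by (auto simp: periodic_iff_rotate)
  qed (use that in auto)
  from *[of \<alpha> i] *[of "rotate i \<alpha>" "length \<alpha> * i - i"] show ?thesis by (auto simp: rotate_back)
qed

lemma periodic_necklace_of: "periodic (necklace_of \<alpha>) \<longleftrightarrow> periodic \<alpha>"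
  using necklace_of_in[of \<alpha>] by (auto simp: rotations_def periodic_rotate)

lemma ap_aperiodic:
  assumes "\<not> periodic \<alpha>" "\<alpha> \<noteq> []"
  shows "ap \<alpha> = \<alpha>"
proof -
  obtain p where p: "0 < p" "rotate p \<alpha> = \<alpha>" "\<And>q. 0 < q \<Longrightarrow> q < p \<Longrightarrow> rotate q \<alpha> \<noteq> \<alpha>"
    using least_period_ex assms(2) by blast
  from least_period[OF p assms(2)] assms show ?thesis by auto
qed

lemma zero_block_aperiodic: "zero_block z x \<Longrightarrow> \<not> periodic (replicate z False @ x)"
proof
  assume b: "zero_block z x" and "periodic (replicate z False @ x)"
  moreover from b have "x \<noteq> []" by (simp add: zero_block_def)
  ultimately obtain d where d: "0 < d" "d < z + length x" "rotate d (replicate z False @ x) = replicate z False @ x"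
    by (auto simp: periodic_iff_rotate)
  then show False using zero_block_less_rotate[OF b d(1,2)] by simp
qed

subsection \<open>Conjugate single-bit changes\<close>

text \<open>Integer positions modulo the length turn rotations and reflections into arithmetic on
  divisibility.\<close>

definition cyclic_nth :: "bool list \<Rightarrow> int \<Rightarrow> bool" where
  "cyclic_nth \<beta> i = \<beta> ! nat (i mod int (length \<beta>))"

lemma cyclic_nth_nth: "i < length \<beta> \<Longrightarrow> cyclic_nth \<beta> (int i) = \<beta> ! i"
  by (simp add: cyclic_nth_def)

lemma cyclic_nth_cong: "int (length \<beta>) dvd i - j \<Longrightarrow> cyclic_nth \<beta> i = cyclic_nth \<beta> j"
  using mod_eq_dvd_iff[of i "int (length \<beta>)" j] by (simp add: cyclic_nth_def)

lemma cyclic_nth_flip: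
  assumes "x < length \<beta>"
  shows "cyclic_nth (flip \<beta> (Suc x)) i = (cyclic_nth \<beta> i \<noteq> (int (length \<beta>) dvd i - int x))"
proof -
  let ?N = "int (length \<beta>)"
  have N: "?N > 0" using assms by linarith
  have "nat (i mod ?N) = x \<longleftrightarrow> i mod ?N = int x" using N by (auto simp: nat_eq_iff)
  also have "\<dots> \<longleftrightarrow> i mod ?N = int x mod ?N" using assms by simp
  also have "\<dots> \<longleftrightarrow> ?N dvd i - int x" by (rule mod_eq_dvd_iff)
  finally have e: "nat (i mod ?N) = x \<longleftrightarrow> ?N dvd i - int x" .
  have "nat (i mod ?N) < length \<beta>" using N by (simp add: nat_less_iff)
  then show ?thesis using e by (auto simp: cyclic_nth_def flip_def nth_list_update)
qed

lemma cyclic_nth_rotate: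
  assumes "\<beta> \<noteq> []"
  shows "cyclic_nth (rotate d \<beta>) i = cyclic_nth \<beta> (i + int d)"
proof -
  let ?N = "int (length \<beta>)"
  have N: "?N > 0" using assms by simp
  then have "nat (i mod ?N) < length \<beta>" by (simp add: nat_less_iff)
  moreover have "(d + nat (i mod ?N)) mod length \<beta> = nat ((i + int d) mod ?N)"
  proof -
    have "int ((d + nat (i mod ?N)) mod length \<beta>) = (int d + i mod ?N) mod ?N"
      using N by (simp add: zmod_int)
    then show ?thesis by (simp add: mod_simps add.commute)
  qed
  ultimately show ?thesis by (simp add: cyclic_nth_def nth_rotate')
qed

lemma cyclic_nth_inject:
  assumes "length \<alpha> = length \<beta>" "\<And>i. cyclic_nth \<alpha> i = cyclic_nth \<beta> i"
  shows "\<alpha> = \<beta>"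
  using assms by (intro nth_equalityI) (metis cyclic_nth_nth)+

text \<open>Let rotation by \<open>d\<close> relate the two changed strings. Along steps by
  \<open>d\<close> the letter of \<beta> changes only on leaving \<open>x\<close> and on entering
  \<open>q\<close>. The orbits of this step are the residue classes modulo
  \<open>g = gcd d n\<close>, and those without \<open>x\<close> and \<open>q\<close> are constant.
  The remaining one carries \<open>\<not> b\<close> strictly between \<open>x\<close> and
  \<open>q\<close> and \<open>b\<close> on the way from \<open>q\<close> back to \<open>x\<close>, a
  pattern preserved by the reflection that exchanges \<open>x\<close> and \<open>q\<close>.\<close>

lemma flip_conjugate_orbit:
  assumes len: "length \<beta> = n" and x: "x < n" and q: "q < n" and xq: "x \<noteq> q"
    and bx: "\<beta> ! x = b" and bq: "\<beta> ! q = b"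
    and rot: "flip \<beta> (Suc x) \<in> rotations (flip \<beta> (Suc q))" and per: "\<not> periodic \<beta>"
  obtains g where "0 < g" "g dvd int n" "g dvd int x - int q"
    "\<And>i j. \<not> g dvd i - int q \<Longrightarrow> g dvd i - j \<Longrightarrow> cyclic_nth \<beta> i = cyclic_nth \<beta> j"
    "\<And>i. g dvd i - int q \<Longrightarrow> cyclic_nth \<beta> (int x + int q - i) = cyclic_nth \<beta> i"
proof -
  let ?N = "int n" and ?f = "cyclic_nth \<beta>" and ?x = "int x" and ?q = "int q"
  have ne: "\<beta> \<noteq> []" using len x by auto
  have "flip \<beta> (Suc q) \<noteq> []" using ne by (metis length_flip length_0_conv)
  then obtain d0 where d0: "d0 < n" "flip \<beta> (Suc x) = rotate d0 (flip \<beta> (Suc q))"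
    using rotationsE[OF rot] len by (metis length_flip)
  define d where "d = int d0"
  have H: "(?f i \<noteq> (?N dvd i - ?x)) = (?f (i + d) \<noteq> (?N dvd i + d - ?q))" for i
  proof -
    have "cyclic_nth (flip \<beta> (Suc x)) i = cyclic_nth (flip \<beta> (Suc q)) (i + d)"
      unfolding d0(2) d_def by (rule cyclic_nth_rotate) fact
    then show ?thesis using cyclic_nth_flip[of x \<beta> i] cyclic_nth_flip[of q \<beta> "i + d"] len x q by simp
  qed
  have fcong: "?N dvd i - j \<Longrightarrow> ?f i = ?f j" for i j using cyclic_nth_cong[of \<beta> i j] len by simp
  have fx: "?f ?x = b" and fq: "?f ?q = b" using cyclic_nth_nth[of x \<beta>] cyclic_nth_nth[of q \<beta>] bx bq len x q by auto
  have xq': "\<not> ?N dvd ?x - ?q"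
  proof
    assume "?N dvd ?x - ?q"
    then have "?x mod ?N = ?q mod ?N" by (simp add: mod_eq_dvd_iff)
    then show False using x q xq by simp
  qed
  \<comment> \<open>If one step led from \<open>x\<close> to \<open>q\<close>, the two changes would
    cancel and rotation by \<open>d0\<close> would fix \<beta>.\<close>
  have xd: "\<not> ?N dvd ?x + d - ?q"
  proof
    assume a: "?N dvd ?x + d - ?q"
    have "?f i = ?f (i + d)" for i
    proof -
      have "(?N dvd i - ?x) = (?N dvd i + d - ?q)"
        using a dvd_add_right_iff[OF a, of "i - ?x"] by (simp add: algebra_simps)
      then show ?thesis using H[of i] by auto
    qed
    then have "rotate d0 \<beta> = \<beta>" using ne by (intro cyclic_nth_inject) (auto simp: cyclic_nth_rotate d_def)
    moreover have "d0 \<noteq> 0"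
    proof
      assume "d0 = 0"
      then show False using a xq' by (simp add: d_def)
    qed
    ultimately show False using per ne d0(1) len by (auto simp: periodic_iff_rotate)
  qed
  have B: "?f (?x + d) = (\<not> b)" using H[of ?x] xd fx by simp
  have C: "?f (i + d) = ?f i" if "\<not> ?N dvd i - ?x" "\<not> ?N dvd i + d - ?q" for i
    using H[of i] that by simp
  define P where "P j \<longleftrightarrow> 0 < j \<and> ?N dvd ?x + int j * d - ?q" for j :: nat
  define Z where "Z j \<longleftrightarrow> 0 < j \<and> ?N dvd int j * d" for j :: nat
  have D1: "?f (?x + int j * d) = (\<not> b)" if "0 < j" "\<And>i. i \<le> j \<Longrightarrow> \<not> P i" for j
    using that
  proof (induction j)
    case (Suc j)
    show ?case
    proof (cases "j = 0")
      case False
      then have f: "?f (?x + int j * d) = (\<not> b)" using Suc by simp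
      have "\<not> ?N dvd (?x + int j * d) - ?x" using fcong[of "?x + int j * d" ?x] f fx by auto
      moreover have "\<not> ?N dvd (?x + int j * d) + d - ?q"
        using Suc.prems(2)[of "Suc j"] by (auto simp: P_def algebra_simps)
      ultimately show ?thesis using C[of "?x + int j * d"] f by (simp add: algebra_simps)
    qed (use B in simp)
  qed simp
  \<comment> \<open>Otherwise the letter would still be \<open>\<not> b\<close> after
    \<open>n\<close> steps, back at \<open>x\<close>.\<close>
  have "\<exists>j. P j"
  proof (rule ccontr)
    assume "\<nexists>j. P j"
    then have "?f (?x + int n * d) = (\<not> b)" using D1[of n] x by simp
    then show False using fcong[of "?x + int n * d" ?x] fx by simp
  qed
  \<comment> \<open>\<open>e\<close> steps lead from \<open>x\<close> to \<open>q\<close>;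
    \<open>m\<close>, defined below, is the length of the orbit.\<close>
  define e where "e = (LEAST j. P j)"
  have e: "P e" unfolding e_def using \<open>\<exists>j. P j\<close> by (rule LeastI_ex)
  have emin: "j < e \<Longrightarrow> \<not> P j" for j unfolding e_def using not_less_Least by blast
  have "Z n" using x by (simp add: Z_def)
  define m where "m = (LEAST j. Z j)"
  have m: "Z m" unfolding m_def using \<open>Z n\<close> by (rule LeastI)
  have mmin: "j < m \<Longrightarrow> \<not> Z j" for j unfolding m_def using not_less_Least by blast
  have mZ: "?N dvd (int m * d) * k" for k using m by (simp add: Z_def)
  have em: "e < m"
  proof -
    have "int e * d = (int m * d) * int (e div m) + int (e mod m) * d"
      by (metis (no_types, opaque_lifting) div_mult_mod_eq distrib_right mult.assoc mult.commute of_nat_add of_nat_mult)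
    then have "?x + int (e mod m) * d - ?q = (?x + int e * d - ?q) - (int m * d) * int (e div m)" by simp
    then have 1: "?N dvd ?x + int (e mod m) * d - ?q"
      using e mZ[of "int (e div m)"] dvd_diff unfolding P_def by metis
    then have "e mod m \<noteq> 0" using xq' by (metis add_0_right mult_zero_left of_nat_0)
    then have "P (e mod m)" using 1 by (simp add: P_def)
    then have "e \<le> e mod m" using emin by (meson not_le)
    then show ?thesis using m by (metis Z_def le_less_trans mod_less_divisor)
  qed
  have D2: "?f (?x + int j * d) = b" if "e \<le> j" "j \<le> m" for j
    using that
  proof (induction j rule: dec_induct)
    case base
    then show ?case using fcong[of "?x + int e * d" ?q] e fq by (simp add: P_def)
  next
    case (step j)
    then have f: "?f (?x + int j * d) = b" by simp
    have "0 < j" using step e by (auto simp: P_def)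
    then have nx: "\<not> ?N dvd (?x + int j * d) - ?x" using mmin[of j] step by (simp add: Z_def)
    show ?case
    proof (cases "?N dvd (?x + int j * d) + d - ?q")
      case True
      then show ?thesis using fcong[of "?x + int j * d + d" ?q] fq by (simp add: algebra_simps)
    next
      case False
      then show ?thesis using C[OF nx] f by (simp add: algebra_simps)
    qed
  qed
  define g where "g = gcd d ?N"
  obtain u v where uv: "u * d + v * ?N = g" unfolding g_def using bezout_int by blast
  have gd: "g dvd d" "g dvd ?N" "0 < g" using x by (auto simp: g_def)
  have gxq: "g dvd ?x - ?q"
  proof -
    have "g dvd ?x + int e * d - ?q" using e gd dvd_trans by (auto simp: P_def)
    moreover have "g dvd int e * d" using gd by simp
    ultimately have "g dvd (?x + int e * d - ?q) - int e * d" by (rule dvd_diff)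
    then show ?thesis by (simp add: algebra_simps)
  qed
  have steps: "\<exists>k. ?N dvd (i + k * d) - j" if g: "g dvd j - i" for i j
  proof -
    from g obtain l where "j - i = g * l" by blast
    then have "j = i + u * l * d + v * l * ?N" unfolding uv[symmetric] by (simp add: algebra_simps)
    then show ?thesis by (intro exI[of _ "u * l"]) (simp add: algebra_simps)
  qed
  show thesis
  proof (rule that[of g])
    fix i j assume i: "\<not> g dvd i - ?q" and ij: "g dvd i - j"
    have "?f (i + int k * d) = ?f i" for k
    proof (induction k)
      case (Suc k)
      let ?i = "i + int k * d"
      have ni: "\<not> g dvd ?i - ?q" using dvd_add_left_iff[of g "int k * d" "i - ?q"] i gd
        by (simp add: algebra_simps)
      have "\<not> ?N dvd ?i - ?x"
      proof
        assume "?N dvd ?i - ?x"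
        then have "g dvd (?i - ?x) + (?x - ?q)" using gd gxq dvd_trans dvd_add by blast
        then show False using ni by (simp add: algebra_simps)
      qed
      moreover have "\<not> ?N dvd ?i + d - ?q"
      proof
        assume "?N dvd ?i + d - ?q"
        then have "g dvd (?i + d - ?q) - d" using gd dvd_trans dvd_diff by blast
        then show False using ni by (simp add: algebra_simps)
      qed
      ultimately show ?case using C[of ?i] Suc by (simp add: algebra_simps)
    qed simp
    note 1 = this
    from ij have "g dvd j - i" by (simp add: dvd_diff_commute)
    from steps[OF this] obtain k where k: "?N dvd (i + k * d) - j" by blast
    have "?N dvd (i + (k mod ?N) * d) - j"
    proof -
      have "(i + (k mod ?N) * d) - j = ((i + k * d) - j) - ?N * (k div ?N * d)"
        by (simp add: algebra_simps minus_div_mult_eq_mod[symmetric])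
      then show ?thesis using k by (metis dvd_diff dvd_triv_left)
    qed
    moreover have "k mod ?N = int (nat (k mod ?N))" using x by simp
    ultimately have "?N dvd (i + int (nat (k mod ?N)) * d) - j" by simp
    then show "?f i = ?f j" using fcong 1 by blast
  next
    fix i assume "g dvd i - ?q"
    then have "g dvd (i - ?q) - (?x - ?q)" using gxq by (rule dvd_diff)
    then have "g dvd i - ?x" by simp
    from steps[OF this] obtain k where k: "?N dvd (?x + k * d) - i" by blast
    have mp: "0 < m" using m by (simp add: Z_def)
    \<comment> \<open>\<open>j\<close> ranges over \<open>1..m\<close>, not \<open>0..m-1\<close>:
      the position \<open>x\<close> counts as the end of the arc that starts at \<open>q\<close>,
      where \<open>D2\<close> applies.\<close>
    define j where "j = (if k mod int m = 0 then m else nat (k mod int m))"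
    have kk: "k = int m * (k div int m) + k mod int m" by simp
    have j: "0 < j" "j \<le> m" "\<exists>c. k = int j + int m * c"
    proof -
      have r: "0 \<le> k mod int m" "k mod int m < int m" using mp by auto
      show "0 < j" unfolding j_def using r mp by (auto simp: le_less)
      show "j \<le> m" unfolding j_def using r by (cases "k mod int m = 0") (simp_all add: nat_le_iff)
      show "\<exists>c. k = int j + int m * c"
      proof (cases "k mod int m = 0")
        case True
        then show ?thesis unfolding j_def using kk by (intro exI[of _ "k div int m - 1"]) (simp add: algebra_simps)
      next
        case False
        then show ?thesis unfolding j_def using kk r by (intro exI[of _ "k div int m"]) simp
      qed
    qed
    then obtain c where c: "k = int j + int m * c" by blast
    have "?N dvd (?x + int j * d) - i"
    proof -
      have "(?x + int j * d) - i = ((?x + k * d) - i) - (int m * d) * c" using c by (simp add: algebra_simps)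
      then show ?thesis using k mZ[of c] by (metis dvd_diff)
    qed
    note J = this
    have I: "?f i = ?f (?x + int j * d)" using fcong[OF J] by simp
    have q: "?N dvd ?x + int e * d - ?q" using e by (simp add: P_def)
    \<comment> \<open>The reflection takes step \<open>j\<close> to step \<open>e - j\<close> on the
      arc before \<open>q\<close>, and to step \<open>m + e - j\<close> on the arc from
      \<open>q\<close> to \<open>x\<close>.\<close>
    show "?f (?x + ?q - i) = ?f i"
    proof (cases "j < e")
      case True
      have "?N dvd (?x + int (e - j) * d) - (?x + ?q - i)"
      proof -
        have "(?x + int (e - j) * d) - (?x + ?q - i) = (?x + int e * d - ?q) - ((?x + int j * d) - i)"
          using True by (simp add: algebra_simps of_nat_diff)
        then show ?thesis using q J by (metis dvd_diff)
      qed
      from fcong[OF this] have "?f (?x + ?q - i) = ?f (?x + int (e - j) * d)" by simp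
      also have "\<dots> = (\<not> b)" using True j emin by (intro D1) auto
      also have "\<dots> = ?f (?x + int j * d)" using True j emin D1[of j] by auto
      finally show ?thesis using I by simp
    next
      case False
      have "?N dvd (?x + int (m + e - j) * d) - (?x + ?q - i)"
      proof -
        have "(?x + int (m + e - j) * d) - (?x + ?q - i)
          = (?x + int e * d - ?q) - ((?x + int j * d) - i) + (int m * d) * 1"
          using j by (simp add: algebra_simps of_nat_diff)
        then show ?thesis using q J mZ[of 1] by (metis dvd_diff dvd_add)
      qed
      from fcong[OF this] have "?f (?x + ?q - i) = ?f (?x + int (m + e - j) * d)" by simp
      also have "\<dots> = b" using False j by (intro D2) auto
      also have "\<dots> = ?f (?x + int j * d)" using False j D2[of j] by auto
      finally show ?thesis using I by simp
    qed
  qed (use gd gxq in auto)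
qed

text \<open>The reflection turns reading backwards into a rotation, by \<open>r + 1\<close>; the
  extra one comes from positions starting at zero.\<close>

lemma symmetric_if_reflection:
  assumes "\<beta> \<noteq> []" "\<And>i. cyclic_nth \<beta> (int r - i) = cyclic_nth \<beta> i"
  shows "symmetric \<beta>"
proof -
  have "rev \<beta> = rotate (r + 1) \<beta>"
  proof (rule nth_equalityI)
    fix i assume i: "i < length (rev \<beta>)"
    have "rev \<beta> ! i = cyclic_nth \<beta> (int (length \<beta> - 1 - i))"
      using i cyclic_nth_nth[of "length \<beta> - 1 - i" \<beta>] by (simp add: rev_nth)
    also have "\<dots> = cyclic_nth \<beta> (int r - int (length \<beta> - 1 - i))" using assms(2) by simp
    also have "\<dots> = cyclic_nth \<beta> (int i + int (r + 1))"
      using i by (intro cyclic_nth_cong) (simp add: of_nat_diff)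
    also have "\<dots> = cyclic_nth (rotate (r + 1) \<beta>) (int i)" using assms(1) by (simp add: cyclic_nth_rotate del: rotate_Suc)
    also have "\<dots> = rotate (r + 1) \<beta> ! i" using i cyclic_nth_nth[of i "rotate (r + 1) \<beta>"] by simp
    finally show "rev \<beta> ! i = rotate (r + 1) \<beta> ! i" .
  qed simp
  then show ?thesis unfolding symmetric_def using rotate_in_rotations by metis
qed

text \<open>As \<open>g\<close> divides the nonzero distance of \<open>x\<close> and
  \<open>q\<close>, the window contains a position of every residue class. All classes but that of
  \<open>q\<close> are therefore constantly \<open>b\<close>, and the reflection of that class
  preserves the whole of \<beta>, contrary to asymmetry.\<close>

lemma flip_unique_window:
  assumes len: "length \<beta> = n" and x: "x < n" and q: "q < n"
    and rot: "flip \<beta> (Suc x) \<in> rotations (flip \<beta> (Suc q))"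
    and per: "\<not> periodic \<beta>" and sym: "\<not> symmetric \<beta>"
    and win: "\<And>i. min x q \<le> i \<Longrightarrow> i \<le> max x q \<Longrightarrow> \<beta> ! i = b"
  shows "x = q"
proof (rule ccontr)
  assume xq: "x \<noteq> q"
  have ne: "\<beta> \<noteq> []" using len x by auto
  from xq win[of x] win[of q] obtain g where g: "0 < g" "g dvd int n" "g dvd int x - int q"
    "\<And>i j. \<not> g dvd i - int q \<Longrightarrow> g dvd i - j \<Longrightarrow> cyclic_nth \<beta> i = cyclic_nth \<beta> j"
    "\<And>i. g dvd i - int q \<Longrightarrow> cyclic_nth \<beta> (int x + int q - i) = cyclic_nth \<beta> i"
    using flip_conjugate_orbit[OF len x q xq, of b] rot per by (metis linear max.cobounded1 max.cobounded2 min.cobounded1 min.cobounded2)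
  let ?a = "int (min x q)" and ?c = "int (max x q)"
  have "g dvd ?c - ?a" using g(3) by (cases "x \<le> q") (auto simp: dvd_diff_commute)
  moreover have "?c - ?a > 0" using xq by auto
  ultimately have ga: "?a + g \<le> ?c" using zdvd_imp_le by fastforce
  have off: "cyclic_nth \<beta> i = b" if "\<not> g dvd i - int q" for i
  proof -
    let ?j = "?a + (i - ?a) mod g"
    have j: "?a \<le> ?j" "?j \<le> ?c" using g(1) ga pos_mod_bound[of g "i - ?a"] pos_mod_sign[of g "i - ?a"] by linarith+
    have "i - ?j = g * ((i - ?a) div g)" by (simp add: algebra_simps minus_div_mult_eq_mod[symmetric])
    then have "g dvd i - ?j" by simp
    then have "cyclic_nth \<beta> i = cyclic_nth \<beta> ?j" using g(4) that by blast
    also have "\<dots> = \<beta> ! nat ?j" using cyclic_nth_nth[of "nat ?j" \<beta>] j x q len by simp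
    also have "\<dots> = b" using j by (intro win) linarith+
    finally show ?thesis .
  qed
  have "symmetric \<beta>"
  proof (rule symmetric_if_reflection[OF ne])
    fix i
    show "cyclic_nth \<beta> (int (x + q) - i) = cyclic_nth \<beta> i"
    proof (cases "g dvd i - int q")
      case False
      have "\<not> g dvd (int (x + q) - i) - int q"
      proof
        assume "g dvd (int (x + q) - i) - int q"
        then have "g dvd (int x - int q) - ((int (x + q) - i) - int q)" using g(3) dvd_diff by blast
        then show False using False by (simp add: algebra_simps)
      qed
      then show ?thesis using off False by simp
    qed (use g(5) in simp)
  qed
  then show False using sym by blast
qed

text \<open>Here the letters between \<open>x\<close> and \<open>q\<close> are unknown. If the final
  ones cover all residue classes modulo \<open>g\<close>, the reflection argument applies again.
  Otherwise \<open>q\<close> is the last position of its class, and \<gamma> is compared with its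
  shift by \<open>g\<close>: they agree off the class of \<open>q\<close>, and the first
  \<open>1\<close> of \<gamma> in this class would make the shift smaller. So \<gamma> vanishes on
  the class, although it has a \<open>1\<close> at \<open>x\<close>.\<close>

lemma flip_unique_last_zero:
  assumes len: "length \<beta> = n" and x: "x < n" and q: "q < n"
    and rot: "flip \<beta> (Suc x) \<in> rotations (flip \<beta> (Suc q))"
    and per: "\<not> periodic \<beta>" and sym: "\<not> symmetric \<beta>"
    and neck: "necklace_of (flip \<beta> (Suc q)) = flip \<beta> (Suc q)"
    and ones: "\<And>i. q \<le> i \<Longrightarrow> i < n \<Longrightarrow> \<beta> ! i" and bx: "\<beta> ! x"
  shows "x = q"
proof (rule ccontr)
  assume xq: "x \<noteq> q"
  have ne: "\<beta> \<noteq> []" using len x by auto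
  have bq: "\<beta> ! q" using ones q by simp
  from bq bx obtain g where g: "0 < g" "g dvd int n" "g dvd int x - int q"
    "\<And>i j. \<not> g dvd i - int q \<Longrightarrow> g dvd i - j \<Longrightarrow> cyclic_nth \<beta> i = cyclic_nth \<beta> j"
    "\<And>i. g dvd i - int q \<Longrightarrow> cyclic_nth \<beta> (int x + int q - i) = cyclic_nth \<beta> i"
    using flip_conjugate_orbit[OF len x q xq, of True] rot per by metis
  let ?N = "int n"
  show False
  proof (cases "int q + g \<le> ?N")
    case True
    have off: "cyclic_nth \<beta> i" if "\<not> g dvd i - int q" for i
    proof -
      let ?j = "int q + (i - int q) mod g"
      have j: "int q \<le> ?j" "?j < ?N" using g(1) True pos_mod_bound[of g "i - int q"] pos_mod_sign[of g "i - int q"] by linarith+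
      have "i - ?j = g * ((i - int q) div g)" by (simp add: algebra_simps minus_div_mult_eq_mod[symmetric])
      then have "g dvd i - ?j" by simp
      then have "cyclic_nth \<beta> i = cyclic_nth \<beta> ?j" using g(4) that by blast
      also have "\<dots> = \<beta> ! nat ?j" using cyclic_nth_nth[of "nat ?j" \<beta>] j x q len by simp
      also have "\<dots>" using j by (intro ones) linarith+
      finally show ?thesis .
    qed
    have "symmetric \<beta>"
    proof (rule symmetric_if_reflection[OF ne])
      fix i
      show "cyclic_nth \<beta> (int (x + q) - i) = cyclic_nth \<beta> i"
      proof (cases "g dvd i - int q")
        case False
        have "\<not> g dvd (int (x + q) - i) - int q"
        proof
          assume "g dvd (int (x + q) - i) - int q"
          then have "g dvd (int x - int q) - ((int (x + q) - i) - int q)" using g(3) dvd_diff by blast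
          then show False using False by (simp add: algebra_simps)
        qed
        then show ?thesis using off False by simp
      qed (use g(5) in simp)
    qed
    then show False using sym by blast
  next
    case False
    define \<gamma> where "\<gamma> = flip \<beta> (Suc q)"
    have lg: "length \<gamma> = n" using len by (simp add: \<gamma>_def)
    have gN: "g \<le> ?N" using g(1,2) x by (simp add: zdvd_imp_le)
    \<comment> \<open>Rotation by \<open>n - g\<close> moves every letter up by
      \<open>g\<close>.\<close>
    define \<gamma>' where "\<gamma>' = rotate (nat (?N - g)) \<gamma>"
    have le: "\<gamma> \<le> \<gamma>'" using neck necklace_of_le[OF rotate_in_rotations] by (metis \<gamma>_def \<gamma>'_def)
    have cg: "cyclic_nth \<gamma> i = (cyclic_nth \<beta> i \<noteq> (?N dvd i - int q))" for i
      using cyclic_nth_flip[of q \<beta> i] len q by (simp add: \<gamma>_def)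
    have cg': "cyclic_nth \<gamma>' i = cyclic_nth \<gamma> (i - g)" for i
    proof -
      have "cyclic_nth \<gamma>' i = cyclic_nth \<gamma> (i + (?N - g))"
        unfolding \<gamma>'_def using lg x gN by (subst cyclic_nth_rotate) auto
      also have "\<dots> = cyclic_nth \<gamma> (i - g)" using lg by (intro cyclic_nth_cong) simp
      finally show ?thesis .
    qed
    have offc: "cyclic_nth \<gamma> i = cyclic_nth \<gamma> (i - g)" if "\<not> g dvd i - int q" for i
    proof -
      have "\<not> ?N dvd i - int q" using that g(2) dvd_trans by blast
      moreover have "\<not> g dvd (i - g) - int q" using that dvd_diff[of g "i - int q" g]
        by (metis diff_right_commute dvd_add_right_iff dvd_refl diff_add_cancel add.commute)
      then have "\<not> ?N dvd (i - g) - int q" using g(2) dvd_trans by blast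
      moreover have "cyclic_nth \<beta> i = cyclic_nth \<beta> (i - g)" using g(4)[OF that] by simp
      ultimately show ?thesis using cg by simp
    qed
    \<comment> \<open>The predecessor of the least position of the class wraps around to
      \<open>q\<close>, where \<gamma> is \<open>0\<close>.\<close>
    have prev: "\<not> cyclic_nth \<gamma> (int i - g)"
      if i: "i < n" "g dvd int i - int q" and l: "\<And>l. l < i \<Longrightarrow> g dvd int l - int q \<Longrightarrow> \<not> \<gamma> ! l" for i
    proof (cases "int i < g")
      case True
      have "g dvd (int i - int q) - g + ?N" using i(2) g(2) by simp
      then have d: "g dvd (int i - g + ?N) - int q" by (simp add: algebra_simps)
      have "\<bar>(int i - g + ?N) - int q\<bar> < g" using True False q gN by auto
      then have "(int i - g + ?N) - int q = 0" using d zdvd_not_zless[of "\<bar>(int i - g + ?N) - int q\<bar>" g]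
        by (metis abs_0_eq abs_ge_zero dvd_abs_iff order_le_less)
      then have "(int i - g) - int q = - ?N" by simp
      then have N: "?N dvd (int i - g) - int q" by simp
      then have "cyclic_nth \<beta> (int i - g) = cyclic_nth \<beta> (int q)" using len by (intro cyclic_nth_cong) simp
      then have "cyclic_nth \<beta> (int i - g)" using bq cyclic_nth_nth[of q \<beta>] q len by simp
      then show ?thesis using cg N by simp
    next
      case False
      let ?j = "nat (int i - g)"
      have j: "?j < i" "int ?j = int i - g" using False g(1) by auto
      have "g dvd (int i - int q) - g" using i(2) by simp
      then have "g dvd int ?j - int q" unfolding j(2) by (simp add: algebra_simps)
      then have "\<not> \<gamma> ! ?j" using l j by blast
      then show ?thesis using cyclic_nth_nth[of ?j \<gamma>] lg j i by simp
    qed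
    have all: "\<not> \<gamma> ! i" if "i < n" "g dvd int i - int q" for i
      using that
    proof (induction i rule: less_induct)
      case (less i)
      have IH: "\<not> \<gamma> ! l" if "l < i" "g dvd int l - int q" for l using less that by auto
      have li: "i < length \<gamma>" "i < length \<gamma>'" using less.prems lg by (auto simp: \<gamma>'_def)
      have g'i: "\<not> \<gamma>' ! i" using prev[OF less.prems IH] cg'[of "int i"] cyclic_nth_nth[OF li(2)] by simp
      have tk: "take i \<gamma>' = take i \<gamma>"
      proof (rule nth_equalityI)
        fix j assume "j < length (take i \<gamma>')"
        then have j: "j < i" by simp
        then have lj: "j < length \<gamma>" "j < length \<gamma>'" using li by auto
        have "\<gamma>' ! j = \<gamma> ! j"
        proof (cases "g dvd int j - int q")
          case True
          have "\<not> cyclic_nth \<gamma> (int j - g)" using True j less.prems IH by (intro prev) auto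
          moreover have "\<not> \<gamma> ! j" using less j True by auto
          ultimately show ?thesis using cg'[of "int j"] cyclic_nth_nth[OF lj(2)] by simp
        next
          case False
          then show ?thesis using offc[OF False] cg'[of "int j"] cyclic_nth_nth[OF lj(1)] cyclic_nth_nth[OF lj(2)] by simp
        qed
        then show "take i \<gamma>' ! j = take i \<gamma> ! j" using j by simp
      qed (use lg in \<open>simp add: \<gamma>'_def\<close>)
      show "\<not> \<gamma> ! i"
      proof
        assume "\<gamma> ! i"
        then have "\<gamma>' < \<gamma>" using li tk g'i by (intro list_less_nthI[of i]) auto
        then show False using le by simp
      qed
    qed
    have "\<gamma> ! x" using bx xq len x by (simp add: \<gamma>_def flip_def)
    then show False using all[of x] x g(3) by blast
  qed
qed

subsection \<open>The shape of asymmetric bracelets\<close>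

lemma zeros_unique:
  "replicate a False @ True # u = replicate b False @ True # v \<longleftrightarrow> a = b \<and> u = v"
proof (induction a arbitrary: b)
  case 0
  then show ?case by (cases b) auto
next
  case (Suc a)
  then show ?case by (cases b) auto
qed

lemma ones_unique:
  "replicate a True @ False # u = replicate b True @ False # v \<longleftrightarrow> a = b \<and> u = v"
proof (induction a arbitrary: b)
  case 0
  then show ?case by (cases b) auto
next
  case (Suc a)
  then show ?case by (cases b) auto
qed

lemma split_zeros: "True \<in> set l \<Longrightarrow> \<exists>k u. l = replicate k False @ True # u"
proof (induction l)
  case (Cons b l)
  show ?case
  proof (cases b)
    case True
    then show ?thesis by (intro exI[of _ 0] exI[of _ l]) simp
  next
    case False
    then obtain k u where "l = replicate k False @ True # u" using Cons by auto
    then show ?thesis using False by (intro exI[of _ "Suc k"] exI[of _ u]) simp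
  qed
qed simp

lemma split_ones: "False \<in> set l \<Longrightarrow> \<exists>k u. l = replicate k True @ False # u"
proof (induction l)
  case (Cons b l)
  show ?case
  proof (cases b)
    case False
    then show ?thesis by (intro exI[of _ 0] exI[of _ l]) simp
  next
    case True
    then obtain k u where "l = replicate k True @ False # u" using Cons by auto
    then show ?thesis using True by (intro exI[of _ "Suc k"] exI[of _ u]) simp
  qed
qed simp

lemma all_zeros: "True \<notin> set l \<Longrightarrow> l = replicate (length l) False"
  by (intro replicate_eqI) (auto intro: ccontr)

lemma all_ones: "False \<notin> set l \<Longrightarrow> l = replicate (length l) True"
  by (intro replicate_eqI) (auto intro: ccontr)

lemma palindrome_symmetric:
  assumes "rev y = y" shows "symmetric (replicate z b @ y)"
proof -
  have "rev (replicate z b @ y) = rotate z (replicate z b @ y)"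
    using assms rotate_append[of "replicate z b" y] by simp
  then show ?thesis unfolding symmetric_def using rotate_in_rotations by metis
qed

lemma asym_braceletsD: "s \<in> asym_bracelets n \<Longrightarrow> length s = n \<and> \<not> symmetric s \<and> necklace_of s = s"
  using asym_bracelets_iff[of s n] by (simp add: asym_bracelets_def)

text \<open>A rotation starting with \<open>i + 1\<close> zeros would be smaller than
  \<gamma>.\<close>

lemma necklace_zeros:
  assumes "necklace_of \<gamma> = \<gamma>" "\<gamma> = replicate i False @ True # v"
  shows "\<exists>j\<le>i. rotate d \<gamma> ! j"
proof (rule ccontr)
  assume "\<not> (\<exists>j\<le>i. rotate d \<gamma> ! j)"
  then have "rotate d \<gamma> < \<gamma>"
    using assms(2) by (intro less_zero_prefix[of "Suc i" _ i]) (auto simp: nth_append less_Suc_eq_le)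
  moreover have "\<gamma> \<le> rotate d \<gamma>" using necklace_of_le[OF rotate_in_rotations[of d \<gamma>]] assms(1) by simp
  ultimately show False by simp
qed

lemma necklace_run:
  assumes "necklace_of \<gamma> = \<gamma>" "\<gamma> = replicate i False @ True # v" "\<gamma> = p @ replicate m False @ s"
  shows "m \<le> i"
proof (rule ccontr)
  assume "\<not> m \<le> i"
  then have m: "i < m" by simp
  obtain j where j: "j \<le> i" "rotate (length p) \<gamma> ! j" using necklace_zeros[OF assms(1,2)] by blast
  have "rotate (length p) \<gamma> = replicate m False @ s @ p" using assms(3) rotate_append[of p "replicate m False @ s"] by simp
  then show False using j m by (simp add: nth_append)
qed

lemma run_split:
  assumes "b + m \<le> length y" "\<forall>j<m. \<not> y ! (b + j)"
  obtains p s where "y = p @ replicate m False @ s"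
proof -
  have "take m (drop b y) = replicate m False"
    using assms by (intro nth_equalityI) auto
  then have "y = take b y @ replicate m False @ drop m (drop b y)"
    by (metis append_take_drop_id)
  then show thesis using that by blast
qed

text \<open>In a necklace with \<open>i\<close> leading zeros no run of zeros is longer than
  \<open>i\<close>, so any factor delimited by ones qualifies for every
  \<open>z > i\<close>.\<close>

lemma zero_block_of_necklace:
  assumes "necklace_of \<gamma> = \<gamma>" "\<gamma> = replicate i False @ True # v" "\<gamma> = p @ x @ s"
    "x \<noteq> []" "hd x" "last x" "i < z"
  shows "zero_block z x"
  unfolding zero_block_def
proof (intro conjI allI impI)
  fix a assume a: "a + z \<le> length x"
  show "\<exists>j<z. x ! (a + j)"
  proof (rule ccontr)
    assume "\<not> (\<exists>j<z. x ! (a + j))"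
    then obtain p' s' where "x = p' @ replicate z False @ s'" using run_split[OF a] by metis
    then have "z \<le> i" using necklace_run[OF assms(1,2), of "p @ p'" z "s' @ s"] assms(3) by simp
    then show False using assms(7) by simp
  qed
qed (use assms in auto)

text \<open>With fewer than three ones, or with no zero after the leading block, the part after the
  block is a palindrome and the string symmetric. A final \<open>0\<close> could be rotated to the
  front, lengthening the block.\<close>

lemma asym_shape:
  assumes "\<gamma> \<in> asym_bracelets n" "0 < n"
  obtains i s r u where "\<gamma> = replicate i False @ True # replicate s False @ True # replicate r False @ True # u"
    "last \<gamma>" "False \<in> set (replicate s False @ True # replicate r False @ True # u)"
proof -
  from asym_braceletsD[OF assms(1)] have A: "length \<gamma> = n" "\<not> symmetric \<gamma>" "necklace_of \<gamma> = \<gamma>" by auto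
  have ne: "\<gamma> \<noteq> []" using A assms by auto
  have pal: "\<gamma> \<noteq> replicate z b @ y" if "rev y = y" for z b y using A(2) palindrome_symmetric[OF that] by metis
  have "True \<in> set \<gamma>"
  proof (rule ccontr)
    assume "True \<notin> set \<gamma>"
    from all_zeros[OF this] show False using pal[of "[]"] by (metis append_Nil2 rev.simps(1))
  qed
  then obtain i v where v: "\<gamma> = replicate i False @ True # v" using split_zeros by blast
  have last: "last \<gamma>"
  proof (rule ccontr)
    assume "\<not> last \<gamma>"
    then have e: "\<gamma> = butlast \<gamma> @ [False]" using ne by (metis append_butlast_last_id)
    have "rotate (length (butlast \<gamma>)) \<gamma> = [False] @ butlast \<gamma>" by (subst e) (rule rotate_append)
    moreover have "v \<noteq> []" using v \<open>\<not> last \<gamma>\<close> by auto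
    then have "butlast \<gamma> = replicate i False @ True # butlast v" using v by (simp add: butlast_append)
    moreover obtain j where "j \<le> i" "rotate (length (butlast \<gamma>)) \<gamma> ! j" using necklace_zeros[OF A(3) v] by blast
    ultimately show False by (cases j) (auto simp: nth_append)
  qed
  have "v \<noteq> []" using pal[of "[True]" i False] v by auto
  then have lv: "last v" using last v by simp
  then have "True \<in> set v" using \<open>v \<noteq> []\<close> by (metis (full_types) last_in_set)
  then obtain s w where w: "v = replicate s False @ True # w" using split_zeros by blast
  have "w \<noteq> []" using pal[of "True # replicate s False @ [True]" i False] v w by auto
  then have "True \<in> set w" using lv w by (metis (full_types) last_ConsR last_appendR last_in_set list.distinct(1))
  then obtain r u where u: "w = replicate r False @ True # u" using split_zeros by blast
  have "False \<in> set v"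
  proof (rule ccontr)
    assume "False \<notin> set v"
    from all_ones[OF this] have "rev (True # v) = True # v"
      by (metis rev_replicate replicate_Suc)
    then show False using pal v by blast
  qed
  then show thesis using that[of i s r u] v w u last by blast
qed

lemma first_one_eq: "first_one (replicate i False @ True # v) = replicate i False @ False # v"
  by (simp add: first_one_def takeWhile_append takeWhile_replicate list_update_append)

lemma last_zero_eq: "last_zero (v @ False # replicate j True) = v @ True # replicate j True"
  by (simp add: last_zero_def takeWhile_append takeWhile_replicate list_update_append)

lemma rotate_zeros_front: "necklace_of (x @ replicate z b) = necklace_of (replicate z b @ x)"
  using necklace_of_rotate[of "length x" "x @ replicate z b"] rotate_append[of x "replicate z b"] by simp

text \<open>A window of length \<open>i\<close> that is not inside \<open>y\<close> contains the
  last letter of \<open>y\<close> or, as \<open>t < i\<close>, is the whole appended part.\<close>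

lemma zero_block_append:
  assumes "zero_block i y" "t < i" shows "zero_block i (y @ replicate t False @ [True])"
  unfolding zero_block_def
proof (intro conjI allI impI)
  fix a assume a: "a + i \<le> length (y @ replicate t False @ [True])"
  have y: "y \<noteq> []" "y ! (length y - 1)" using assms by (auto simp: zero_block_def last_conv_nth)
  consider "a + i \<le> length y" | "a < length y" "length y < a + i" | "length y \<le> a" by linarith
  then show "\<exists>j<i. (y @ replicate t False @ [True]) ! (a + j)"
  proof cases
    case 1
    then obtain j where "j < i" "y ! (a + j)" using assms unfolding zero_block_def by blast
    then show ?thesis using 1 by (intro exI[of _ j]) (auto simp: nth_append)
  next
    case 2
    then show ?thesis using y by (intro exI[of _ "length y - 1 - a"]) (auto simp: nth_append)
  next
    case 3
    then have "a = length y" "i = t + 1" using a assms by auto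
    then show ?thesis by (intro exI[of _ t]) (auto simp: nth_append)
  qed
qed (use assms in \<open>auto simp: zero_block_def\<close>)

lemma zero_block_cons: assumes "zero_block i y" "t < i" shows "zero_block i (True # replicate t False @ y)"
  using zero_block_rev[OF zero_block_append[OF zero_block_rev[OF assms(1)] assms(2)]] by simp

lemma zero_block_suffix:
  assumes "zero_block i (p @ x)" "x \<noteq> []" "hd x" "i \<le> k" shows "zero_block k x"
  unfolding zero_block_def
proof (intro conjI allI impI)
  fix a assume "a + k \<le> length x"
  then have "length p + a + i \<le> length (p @ x)" using assms by simp
  then obtain j where "j < i" "(p @ x) ! (length p + a + j)" using assms unfolding zero_block_def by blast
  then show "\<exists>j<k. x ! (a + j)" using assms by (intro exI[of _ j]) (auto simp: nth_append add.assoc)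
qed (use assms in \<open>auto simp: zero_block_def\<close>)

subsection \<open>Candidates for children\<close>

definition max_run :: "bool list \<Rightarrow> nat \<Rightarrow> bool" where
  "max_run y M \<longleftrightarrow> (\<forall>b m. b + m \<le> length y \<longrightarrow> (\<forall>j<m. \<not> y ! (b + j)) \<longrightarrow> m \<le> M) \<and>
     (\<exists>b. b + M \<le> length y \<and> (\<forall>j<M. \<not> y ! (b + j)))"

definition shape :: "bool list \<Rightarrow> nat \<Rightarrow> nat \<Rightarrow> nat \<Rightarrow> nat \<Rightarrow> nat \<Rightarrow> nat \<Rightarrow> bool" where
  "shape \<beta> z M r s h a \<longleftrightarrow> (\<exists>y u u' u''. \<beta> = replicate z False @ y \<and>
     y = True # replicate s False @ True # replicate r False @ True # u \<and>
     rev y = True # replicate h False @ True # u' \<and>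
     y = replicate a True @ False # u'' \<and> max_run y M)"

text \<open>In \<open>shape\<close>, \<open>y = 1 0\<^sup>s 1 0\<^sup>r 1 \<dots>\<close> ends with \<open>1 0\<^sup>h 1\<close> and starts with exactly \<open>a\<close> ones; \<open>M\<close> is its longest run of
  zeros. The disjuncts of \<open>candidate\<close> belong to FirstOne, LastOne and (the last three) LastZero.\<close>

definition candidate :: "nat \<Rightarrow> nat \<Rightarrow> nat \<Rightarrow> nat \<Rightarrow> nat \<Rightarrow> nat \<Rightarrow> nat \<Rightarrow> nat \<Rightarrow> bool" where
  "candidate n z M r s h a x \<longleftrightarrow>
     x < z \<and> M \<le> x \<and> z - 1 - x \<le> x \<and> h \<le> z - 1 - x \<or>
     x < z \<and> M \<le> z - 1 - x \<and> x \<le> z - 1 - x \<and> r \<le> x \<and> x \<le> s \<or>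
     x = n - 2 \<or> x = n - 1 - a \<or> x = n - 2 - a"

text \<open>The first six entries are the boundary cases of the inequalities in
  \<open>candidate\<close>, the next three the positions belonging to LastZero, and the last two the
  positions where a child could be the root label, whose leading block has length
  \<open>n - 4\<close>.\<close>

definition special :: "nat \<Rightarrow> nat \<Rightarrow> nat \<Rightarrow> nat \<Rightarrow> nat \<Rightarrow> nat \<Rightarrow> nat \<Rightarrow> nat set" where
  "special n z M r s h a = {M, (z - 1) div 2, z - 1 - h, r, s, z - 1 - M, n - 2, n - 1 - a, n - 2 - a,
     n - 4, z - 1 - (n - 4)}"

lemma card_special: "card (special n z M r s h a) \<le> 11"
proof -
  have "card (set [M, (z - 1) div 2, z - 1 - h, r, s, z - 1 - M, n - 2, n - 1 - a, n - 2 - a,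
     n - 4, z - 1 - (n - 4)]) \<le> 11" by (rule le_trans[OF card_length]) simp
  then show ?thesis by (simp add: special_def)
qed

lemma max_run_zero_block: "max_run y M \<Longrightarrow> M < i \<Longrightarrow> y \<noteq> [] \<Longrightarrow> hd y \<Longrightarrow> last y \<Longrightarrow> zero_block i y"
  unfolding zero_block_def max_run_def by (metis gr_implies_not0 linorder_not_less gr0I)

lemma root_label_zeros: "root_label n = replicate (n - 4) False @ True # [False, True, True]"
  by (simp add: root_label_def)

text \<open>Off the boundary, the longer part of the split block of zeros is longer than every other
  run of the child. So \<open>zero_block_asym\<close> decides membership by a comparison of outer
  runs, and aperiodicity follows as well.\<close>

lemma candidate_child:
  assumes B: "\<beta> \<in> asym_bracelets n" and sh: "shape \<beta> z M r s h a"
    and c: "candidate n z M r s h a x" and nb: "x \<notin> special n z M r s h a"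
  shows "necklace_of (flip \<beta> (Suc x)) \<in> asym_bracelets n - {root_label n} \<and>
         par n (necklace_of (flip \<beta> (Suc x))) = \<beta> \<and> \<not> periodic (flip \<beta> (Suc x))"
proof -
  from sh obtain y u u' u'' where y: "\<beta> = replicate z False @ y"
     "y = True # replicate s False @ True # replicate r False @ True # u"
     "rev y = True # replicate h False @ True # u'" "max_run y M" unfolding shape_def by blast
  have n: "n = z + length y" using asym_braceletsD[OF B] y(1) by simp
  have "hd (rev y)" unfolding y(3) by simp
  then have yl: "last y" by (simp add: hd_rev)
  have yh: "y \<noteq> []" "hd y" unfolding y(2) by auto
  note yne = yh yl
  note [simp del] = replicate_Suc
  \<comment> \<open>Outside \<open>special\<close> the inequalities of \<open>candidate\<close> are
    strict.\<close>
  from c nb consider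
      (F) "x < z" "M < x" "z - 1 - x < x" "h < z - 1 - x" "x \<noteq> n - 4"
    | (L) "x < z" "M < z - 1 - x" "x < z - 1 - x" "r < x" "x < s" "z - 1 - x \<noteq> n - 4"
  proof -
    have "x \<noteq> (z - 1) div 2" using nb by (simp add: special_def)
    then have 1: "x \<noteq> z - 1 - x" by presburger
    have s: "x \<noteq> z - 1 - h" "x \<noteq> z - 1 - M" "x \<noteq> z - 1 - (n - 4)" using nb by (simp_all add: special_def)
    have 2: "h \<noteq> z - 1 - x" if "x < z" using s(1) that by linarith
    have 3: "M \<noteq> z - 1 - x" if "x < z" using s(2) that by linarith
    have 4: "z - 1 - x \<noteq> n - 4" if "x < z" using s(3) that by linarith
    have 5: "x \<noteq> M" "x \<noteq> r" "x \<noteq> s" "x \<noteq> n - 4" "x \<noteq> n - 2" "x \<noteq> n - 1 - a" "x \<noteq> n - 2 - a"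
      using nb by (simp_all add: special_def)
    show ?thesis using c 1 2 3 4 5 F L unfolding candidate_def by (metis le_neq_implies_less)
  qed
  then show ?thesis
  proof cases
    case F
    \<comment> \<open>Setting bit \<open>x\<close> splits the block into \<open>x\<close> and
      \<open>t < x\<close> zeros. FirstOne undoes the change, and \<open>h < t\<close> puts the
      child before its reversal.\<close>
    define t where "t = z - 1 - x"
    have z: "z = x + Suc t" using F by (simp add: t_def)
    define X where "X = True # replicate t False @ y"
    define \<gamma> where "\<gamma> = replicate x False @ X"
    have be: "\<beta> = replicate x False @ False # replicate t False @ y"
      unfolding y(1) z replicate_add by (simp add: replicate_Suc)
    have fl: "flip \<beta> (Suc x) = \<gamma>" unfolding be \<gamma>_def X_def by (simp add: flip_def list_update_append nth_append)
    have bl: "zero_block x X" unfolding X_def using max_run_zero_block[OF y(4) F(2) yne] F by (intro zero_block_cons) (auto simp: t_def)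
    have "X < rev X" unfolding X_def using y(3) F zeros_less[of h t] by (simp add: t_def)
    then have A: "\<gamma> \<in> asym_bracelets n" using zero_block_asym[OF bl, of n] n z unfolding \<gamma>_def X_def by simp
    have nk: "necklace_of \<gamma> = \<gamma>" using asym_braceletsD[OF A] by blast
    have "first_one \<gamma> = \<beta>" unfolding \<gamma>_def X_def be by (rule first_one_eq)
    then have "par n \<gamma> = \<beta>" using B by (simp add: par_def)
    moreover have "\<gamma> \<noteq> root_label n"
      unfolding \<gamma>_def X_def root_label_zeros zeros_unique using F by blast
    ultimately show ?thesis using A nk fl zero_block_aperiodic[OF bl] by (simp add: \<gamma>_def)
  next
    case L
    \<comment> \<open>Now the rear part, of \<open>i\<close> zeros, is the longer one, and rotating
      the front part to the end gives the necklace. \<open>x < s\<close> puts it before its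
      reversal; \<open>r < x\<close> makes FirstOne fail, so that LastOne undoes the change.\<close>
    define i where "i = z - 1 - x"
    have z: "z = x + Suc i" using L by (simp add: i_def)
    define X where "X = y @ replicate x False @ [True]"
    define \<gamma> where "\<gamma> = replicate i False @ X"
    have be: "\<beta> = replicate x False @ False # replicate i False @ y"
      unfolding y(1) z replicate_add by (simp add: replicate_Suc)
    have fl: "flip \<beta> (Suc x) = replicate x False @ True # replicate i False @ y"
      unfolding be by (simp add: flip_def list_update_append nth_append)
    have "rotate (Suc x) (flip \<beta> (Suc x)) = \<gamma>"
      using rotate_append[of "replicate x False @ [True]" "replicate i False @ y"]
      unfolding fl \<gamma>_def X_def by simp
    then have ro: "necklace_of (flip \<beta> (Suc x)) = necklace_of \<gamma>" "periodic (flip \<beta> (Suc x)) = periodic \<gamma>"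
      using necklace_of_rotate[of "Suc x" "flip \<beta> (Suc x)"] periodic_rotate[of "Suc x" "flip \<beta> (Suc x)"] by auto
    have bl: "zero_block i X" unfolding X_def using max_run_zero_block[OF y(4) _ yne] L by (intro zero_block_append) (auto simp: i_def)
    have ry: "rev X = True # replicate x False @ True # replicate h False @ True # u'" unfolding X_def using y(3) by simp
    have "X < rev X" unfolding ry unfolding X_def y(2) using L zeros_less[of x s] by simp
    then have A: "\<gamma> \<in> asym_bracelets n" using zero_block_asym[OF bl, of n] n z unfolding \<gamma>_def X_def by simp
    have nk: "necklace_of \<gamma> = \<gamma>" using asym_braceletsD[OF A] by blast
    define v where "v = True # replicate r False @ True # u"
    define X' where "X' = v @ replicate x False @ [True]"
    have X: "X = (True # replicate s False) @ X'" unfolding X_def X'_def v_def y(2) by simp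
    have bl': "zero_block (i + Suc s) X'"
      by (rule zero_block_suffix[of i "True # replicate s False"]) (use bl X in \<open>auto simp: X'_def v_def\<close>)
    have fo: "first_one \<gamma> = replicate (i + Suc s) False @ X'"
      unfolding \<gamma>_def X by (simp add: first_one_eq replicate_add replicate_Suc replicate_append_same replicate_app_Cons_same)
    have "last v" using yne y(2) unfolding v_def by simp
    then obtain v' where "rev v = True # v'" unfolding v_def
      by (metis (full_types) hd_rev list.exhaust_sel list.distinct(1) rev_is_Nil_conv)
    then have "rev X' < X'" unfolding X'_def using L zeros_less[of r x] by (simp add: v_def)
    then have "first_one \<gamma> \<notin> asym_bracelets n"
      unfolding fo using zero_block_asym[OF bl', of n] n z unfolding X'_def v_def y(2) by auto
    moreover have "last_one \<gamma> = \<beta>"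
    proof -
      have "butlast \<gamma> @ [False] = (replicate i False @ y) @ replicate (Suc x) False"
        unfolding \<gamma>_def X_def by (simp add: butlast_append replicate_append_same[symmetric] replicate_Suc)
      then have "last_one \<gamma> = necklace_of (replicate (Suc x) False @ replicate i False @ y)"
        unfolding last_one_def using rotate_zeros_front by metis
      also have "replicate (Suc x) False @ replicate i False @ y = \<beta>"
        unfolding y(1) z by (simp add: replicate_add[symmetric])
      finally show ?thesis using asym_braceletsD[OF B] by simp
    qed
    ultimately have "par n \<gamma> = \<beta>" using B by (simp add: par_def)
    moreover have "\<gamma> \<noteq> root_label n"
      unfolding \<gamma>_def X y(1) root_label_zeros using L by (simp add: zeros_unique i_def)
    ultimately show ?thesis using A nk ro zero_block_aperiodic[OF bl] by (simp add: \<gamma>_def)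
  qed
qed

section \<open>Every child is a candidate, and its position is unique\<close>

lemma count_rotations: "\<beta> \<in> rotations \<alpha> \<Longrightarrow> count_list \<beta> b = count_list \<alpha> b"
proof -
  assume "\<beta> \<in> rotations \<alpha>"
  then obtain d where "\<beta> = rotate d \<alpha>" by (auto simp: rotations_def)
  then have "count_list \<beta> b = count_list (drop (d mod length \<alpha>) \<alpha>) b + count_list (take (d mod length \<alpha>) \<alpha>) b"
    by (simp add: rotate_drop_take)
  also have "\<dots> = count_list (take (d mod length \<alpha>) \<alpha> @ drop (d mod length \<alpha>) \<alpha>) b"
    unfolding count_list_append by simp
  finally show ?thesis by simp
qed

lemma count_flip:
  assumes "x < length \<beta>"
  shows "count_list (flip \<beta> (Suc x)) True = (if \<beta> ! x then count_list \<beta> True - 1 else count_list \<beta> True + 1)"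
    "\<beta> ! x \<Longrightarrow> count_list \<beta> True > 0"
proof -
  have "\<beta> = take x \<beta> @ \<beta> ! x # drop (Suc x) \<beta>" using assms by (rule id_take_nth_drop)
  have e: "count_list \<beta> True = count_list (take x \<beta>) True + (if \<beta> ! x then 1 else 0) + count_list (drop (Suc x) \<beta>) True"
    by (subst \<open>\<beta> = take x \<beta> @ \<beta> ! x # drop (Suc x) \<beta>\<close>) (simp add: count_list_append)
  have "flip \<beta> (Suc x) = take x \<beta> @ (\<not> \<beta> ! x) # drop (Suc x) \<beta>"
    using assms by (simp add: flip_def upd_conv_take_nth_drop)
  then show "count_list (flip \<beta> (Suc x)) True = (if \<beta> ! x then count_list \<beta> True - 1 else count_list \<beta> True + 1)"
    "\<beta> ! x \<Longrightarrow> count_list \<beta> True > 0"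
    using e by auto
qed

text \<open>For each branch of \<open>par\<close> that may lead back to \<beta>, an explicit
  position is found whose change gives \<gamma>; it is the only one by the results on conjugate
  changes. The inequalities hold because \<gamma> is a necklace (bounds on runs of zeros), precedes
  its reversal (bounds on outer runs) and failed the earlier branches of the rule.\<close>

lemma child_kinds:
  assumes B: "\<beta> \<in> asym_bracelets n" and n0: "0 < n" and ap: "\<not> periodic \<beta>" and x: "x < n"
    and G: "\<gamma> = necklace_of (flip \<beta> (Suc x))" "\<gamma> \<in> asym_bracelets n" and P: "par n \<gamma> = \<beta>"
    and sh: "shape \<beta> z M r s h a"
  shows "candidate n z M r s h a x" and "x' < n \<Longrightarrow> necklace_of (flip \<beta> (Suc x')) = \<gamma> \<Longrightarrow> x' = x"
proof -
  from sh obtain y u u' u'' where y: "\<beta> = replicate z False @ y"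
     "y = True # replicate s False @ True # replicate r False @ True # u"
     "rev y = True # replicate h False @ True # u'" "y = replicate a True @ False # u''"
     "max_run y M" unfolding shape_def by blast
  note [simp del] = replicate_Suc
  from asym_braceletsD[OF G(2)] have gA: "length \<gamma> = n" "\<not> symmetric \<gamma>" "necklace_of \<gamma> = \<gamma>" by auto
  from asym_braceletsD[OF B] have bA: "length \<beta> = n" "\<not> symmetric \<beta>" by auto
  obtain i gs gr gu where g: "\<gamma> = replicate i False @ True # replicate gs False @ True # replicate gr False @ True # gu"
    "last \<gamma>" using asym_shape[OF G(2) n0] by metis
  define v where "v = replicate gs False @ True # replicate gr False @ True # gu"
  have gv: "\<gamma> = replicate i False @ True # v" using g by (simp add: v_def)
  have lv: "v \<noteq> []" "last v" using g(2) unfolding gv v_def by auto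
  have revle: "\<not> rev X < X" if "\<gamma> = replicate i False @ X" for X
  proof -
    have "rotate (length X) (rev \<gamma>) = replicate i False @ rev X"
      unfolding that using rotate_append[of "rev X" "replicate i False"] by simp
    then have "\<gamma> < replicate i False @ rev X" using asym_bracelets_le_rev[OF G(2)] rotate_in_rotations by metis
    then show ?thesis unfolding that by auto
  qed
  have Mi: "M \<le> i" if "\<gamma> = p @ y @ q" for p q
  proof -
    from y(5) obtain b where "b + M \<le> length y" "\<forall>j<M. \<not> y ! (b + j)" by (auto simp: max_run_def)
    then obtain p' q' where "y = p' @ replicate M False @ q'" by (rule run_split)
    then show ?thesis using necklace_run[OF gA(3) gv, of "p @ p'" M "q' @ q"] that by simp
  qed
  \<comment> \<open>A change outside the leading block leaves \<open>z\<close> zeros in a row, more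
    than the \<open>i\<close> zeros that a conjugate of \<gamma> can have.\<close>
  have xz: "x' < z" if "i < z" "x' < n" "necklace_of (flip \<beta> (Suc x')) = \<gamma>" for x'
  proof (rule ccontr)
    assume "\<not> x' < z"
    then have "flip \<beta> (Suc x') = replicate z False @ y[x' - z := \<not> y ! (x' - z)]"
      unfolding y(1) by (simp add: flip_def list_update_append nth_append)
    moreover have "flip \<beta> (Suc x') \<in> rotations \<gamma>" using that(3) necklace_of_in rotations_sym by metis
    then obtain d where "flip \<beta> (Suc x') = rotate d \<gamma>" by (auto simp: rotations_def)
    moreover obtain j where "j \<le> i" "rotate d \<gamma> ! j" using necklace_zeros[OF gA(3) gv] by blast
    ultimately show False using that(1) by (simp add: nth_append)
  qed
  have uniq: "x' = q" if "i < z" "q < z" "x' < n" "necklace_of (flip \<beta> (Suc x')) = \<gamma>"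
    "necklace_of (flip \<beta> (Suc q)) = \<gamma>" for x' q
  proof (rule flip_unique_window[OF bA(1) that(3) _ _ ap bA(2), of _ False])
    have "z \<le> n" using y(1) bA by auto
    then show "q < n" using that by simp
    show "flip \<beta> (Suc x') \<in> rotations (flip \<beta> (Suc q))" using that necklace_of_eq_iff by metis
    fix l assume "l \<le> max x' q"
    then show "\<beta> ! l = False" using xz[OF that(1,3,4)] that(2) unfolding y(1) by (auto simp: nth_append)
  qed
  have red: "candidate n z M r s h a x \<and> (\<forall>x'<n. necklace_of (flip \<beta> (Suc x')) = \<gamma> \<longrightarrow> x' = x)"
  proof -
    consider (F) "first_one \<gamma> = \<beta>"
      | (L) "first_one \<gamma> \<notin> asym_bracelets n" "last_one \<gamma> = \<beta>"
      | (Z) "first_one \<gamma> \<notin> asym_bracelets n" "last_one \<gamma> \<notin> asym_bracelets n" "last_zero \<gamma> = \<beta>"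
      using P B unfolding par_def by (auto split: if_splits)
    then show ?thesis
    proof cases
      case F
      have be: "\<beta> = replicate i False @ False # v" using F unfolding gv first_one_eq by simp
      have "True \<in> set v" by (simp add: v_def)
      then obtain t w where w: "v = replicate t False @ True # w" using split_zeros by blast
      have "\<beta> = replicate (i + Suc t) False @ True # w"
        unfolding be w by (simp add: replicate_add replicate_Suc replicate_append_same replicate_app_Cons_same)
      then have z: "z = i + Suc t" "y = True # w" using y(1,2) zeros_unique by metis+
      define X where "X = True # replicate t False @ y"
      have gX: "\<gamma> = replicate i False @ X" unfolding gv w X_def z by simp
      have fl: "flip \<beta> (Suc i) = \<gamma>" unfolding be gv by (simp add: flip_def list_update_append nth_append)
      have nk: "necklace_of (flip \<beta> (Suc i)) = \<gamma>" using fl gA by simp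
      have iz: "i < z" using z by simp
      have u: "\<forall>x'<n. necklace_of (flip \<beta> (Suc x')) = \<gamma> \<longrightarrow> x' = i" using uniq[OF iz iz _ _ nk] by blast
      have xi: "x = i" using u x G(1) by simp
      have "M \<le> i" by (rule Mi[of "replicate i False @ True # replicate t False" "[]"]) (simp add: gX X_def)
      moreover have "t \<le> i"
        by (rule necklace_run[OF gA(3) gv, of "replicate i False @ [True]" t y]) (simp add: gX X_def)
      moreover have "h \<le> t"
      proof (rule ccontr)
        assume "\<not> h \<le> t"
        then have "rev X < X" unfolding X_def z(2) using y(3) zeros_less[of t h] by (simp add: z(2))
        then show False using revle[OF gX] by simp
      qed
      ultimately show ?thesis using u xi z by (simp add: candidate_def)
    next
      case L
      obtain v' where v': "v = v' @ [True]" using lv by (metis (full_types) append_butlast_last_id)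
      have "True \<in> set (rev (True # v'))" by simp
      then obtain t w where w: "rev (True # v') = replicate t False @ True # w" using split_zeros by blast
      define y' where "y' = rev w @ [True]"
      have vt: "True # v' = y' @ replicate t False" using arg_cong[OF w, of rev] by (simp add: y'_def)
      have y': "y' \<noteq> []" "last y'" "hd y'"
        using vt by (auto simp: y'_def) (cases w; metis append_Nil hd_append2 list.sel(1) rev_is_Nil_conv append_is_Nil_conv not_Cons_self2 hd_append)
      define X where "X = y' @ replicate t False @ [True]"
      have gX: "\<gamma> = replicate i False @ X" unfolding gv v' X_def using vt by simp
      have "butlast \<gamma> @ [False] = (replicate i False @ y') @ replicate (Suc t) False"
        unfolding gX X_def by (simp add: butlast_append replicate_append_same[symmetric] replicate_Suc)
      then have "\<beta> = necklace_of (replicate (Suc t) False @ replicate i False @ y')"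
        using L(2) unfolding last_one_def using rotate_zeros_front by metis
      also have "\<dots> = necklace_of (replicate (i + Suc t) False @ y')"
        using replicate_add[of "Suc t" i False] by (simp add: add.commute)
      \<comment> \<open>The merged block is longer than every run of zeros in the necklace \<gamma>,
        so the string that begins with it is already a necklace.\<close>
      also have "\<dots> = replicate (i + Suc t) False @ y'"
        by (rule zero_block_necklace, rule zero_block_of_necklace[OF gA(3) gv, of "replicate i False" y' "replicate t False @ [True]"])
          (use y' in \<open>auto simp: gX X_def\<close>)
      finally have be: "\<beta> = replicate (i + Suc t) False @ y'" .
      obtain w' where "y' = True # w'" using y' by (cases y') auto
      then have z: "z = i + Suc t" "y' = y" using be y(1,2) zeros_unique by metis+
      have be2: "\<beta> = replicate t False @ False # replicate i False @ y"
        using replicate_add[of t "Suc i" False] unfolding be z by (simp add: add.commute replicate_Suc)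
      have fl: "flip \<beta> (Suc t) = replicate t False @ True # replicate i False @ y"
        unfolding be2 by (simp add: flip_def list_update_append nth_append)
      have "rotate (Suc t) (flip \<beta> (Suc t)) = \<gamma>"
        using rotate_append[of "replicate t False @ [True]" "replicate i False @ y"]
        unfolding fl gX X_def z by simp
      then have nk: "necklace_of (flip \<beta> (Suc t)) = \<gamma>"
        using necklace_of_rotate[of "Suc t" "flip \<beta> (Suc t)"] gA(3) by simp
      have iz: "i < z" "t < z" using z by auto
      have u: "\<forall>x'<n. necklace_of (flip \<beta> (Suc x')) = \<gamma> \<longrightarrow> x' = t" using uniq[OF iz _ _ nk] by blast
      have xi: "x = t" using u x G(1) by simp
      have "M \<le> i" by (rule Mi[of "replicate i False" "replicate t False @ [True]"]) (simp add: gX X_def z)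
      moreover have "t \<le> i"
        by (rule necklace_run[OF gA(3) gv, of "replicate i False @ y" t "[True]"]) (simp add: gX X_def z)
      moreover have "t \<le> s"
      proof (rule ccontr)
        assume "\<not> t \<le> s"
        then have "rev X < X" unfolding X_def z(2) using y(3) zeros_less[of s t] by (simp add: y(2))
        then show False using revle[OF gX] by simp
      qed
      moreover have "r \<le> t"
      proof (rule ccontr)
        \<comment> \<open>Then FirstOne would give an asymmetric bracelet, and LastOne would not
          have been reached.\<close>
        assume nt: "\<not> r \<le> t"
        define w where "w = True # replicate r False @ True # u"
        define X' where "X' = w @ replicate t False @ [True]"
        have X: "X = (True # replicate s False) @ X'" unfolding X_def X'_def w_def z(2) y(2) by simp
        have bl': "zero_block (i + Suc s) X'"
          by (rule zero_block_of_necklace[OF gA(3) gv, of "replicate i False @ True # replicate s False" X' "[]"])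
            (use gX X in \<open>auto simp: X'_def w_def\<close>)
        have fo: "first_one \<gamma> = replicate (i + Suc s) False @ X'"
          unfolding gX X by (simp add: first_one_eq replicate_add replicate_Suc replicate_append_same replicate_app_Cons_same)
        have "last w" using y'(2) z(2) y(2) unfolding w_def by simp
        then obtain w' where "rev w = True # w'" unfolding w_def
          by (metis (full_types) hd_rev list.exhaust_sel list.distinct(1) rev_is_Nil_conv)
        then have "X' < rev X'" unfolding X'_def using nt zeros_less[of t r] by (simp add: w_def)
        then have "first_one \<gamma> \<in> asym_bracelets n"
          unfolding fo using zero_block_asym[OF bl', of n] gA(1) X unfolding gX by (simp add: add.assoc)
        then show False using L(1) by simp
      qed
      ultimately show ?thesis using u xi z by (simp add: candidate_def)
    next
      case Z
      have "False \<in> set (rev v)"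
      proof (rule ccontr)
        assume "False \<notin> set (rev v)"
        then have "False \<notin> set v" by simp
        from all_ones[OF this] have "rev (True # v) = True # v" by (metis rev_replicate replicate_Suc)
        then show False using gA(2) palindrome_symmetric gv by metis
      qed
      then obtain j w where w: "rev v = replicate j True @ False # w" using split_ones by blast
      have vw: "v = rev w @ False # replicate j True" using arg_cong[OF w, of rev] by simp
      define p where "p = True # rev w"
      have gp: "\<gamma> = replicate i False @ p @ False # replicate j True" unfolding gv vw p_def by simp
      have be: "\<beta> = replicate i False @ p @ True # replicate j True"
        using Z(3) last_zero_eq[of "replicate i False @ p" j] unfolding gp by simp
      have z: "z = i" "y = p @ True # replicate j True"
        using be y(1,2) unfolding p_def using zeros_unique[of i _ z] by (metis append_Cons)+
      define q where "q = i + length p"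
      have nq: "n = q + Suc j" using bA(1) unfolding be q_def by simp
      have fl: "flip \<beta> (Suc q) = \<gamma>" unfolding be gp q_def
        by (simp add: flip_def list_update_append nth_append)
      have u: "x' = q" if "x' < n" "necklace_of (flip \<beta> (Suc x')) = \<gamma>" for x'
      proof (rule flip_unique_last_zero[OF bA(1) that(1) _ _ ap bA(2)])
        show "q < n" using nq by simp
        show "flip \<beta> (Suc x') \<in> rotations (flip \<beta> (Suc q))" using that necklace_of_in fl rotations_sym by metis
        show "necklace_of (flip \<beta> (Suc q)) = flip \<beta> (Suc q)" using fl gA by simp
        show "\<beta> ! l" if "q \<le> l" "l < n" for l
        proof -
          have "\<beta> = (replicate i False @ p) @ replicate (Suc j) True" unfolding be by (simp add: replicate_Suc)
          moreover have "length (replicate i False @ p) = q" by (simp add: q_def)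
          ultimately show ?thesis using that nq nth_append[of "replicate i False @ p" "replicate (Suc j) True" l] by simp
        qed
        \<comment> \<open>Conjugate strings have equally many ones, so the other change clears a
          bit, too.\<close>
        have c: "count_list (flip \<beta> (Suc x')) True = count_list (flip \<beta> (Suc q)) True"
          using count_rotations[OF necklace_of_in[of "flip \<beta> (Suc x')"], of True] that(2) fl by simp
        have "\<beta> ! q" unfolding be q_def by (simp add: nth_append)
        then have "count_list (flip \<beta> (Suc q)) True < count_list \<beta> True"
          using count_flip[of q \<beta>] nq bA(1) by simp
        then show "\<beta> ! x'" using c count_flip(1)[of x' \<beta>] that(1) bA(1) by (auto split: if_splits)
      qed
      have xi: "x = q" using u x G(1) by simp
      have "False \<in> set p"
      proof (rule ccontr)
        assume "False \<notin> set p"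
        then have "False \<notin> set y" unfolding z by auto
        then show False using y(4) by simp
      qed
      then obtain a' p' where p': "p = replicate a' True @ False # p'" using split_ones by blast
      then have "y = replicate a' True @ False # (p' @ True # replicate j True)" using z by simp
      then have a': "a' = a" using y(4) ones_unique by metis
      have aj: "a \<le> j"
      proof (rule ccontr)
        assume "\<not> a \<le> j"
        then have "rev (p @ False # replicate j True) < p @ False # replicate j True"
          unfolding p' a' using ones_less[of j a] by simp
        then show False using revle[OF gp] by simp
      qed
      \<comment> \<open>With more than \<open>a + 1\<close> final ones, LastOne could clear one of
        them: at least \<open>a + 1\<close> would remain against \<open>a\<close> ones after the
        leading block, and the result would precede its reversal. The last zero of \<gamma> is at
        position \<open>n - 1 - j\<close>, whence the last three disjuncts of
        \<open>candidate\<close>.\<close>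
      have "j = 1 \<or> j = a \<or> j = a + 1"
      proof (rule ccontr)
        assume "\<not> (j = 1 \<or> j = a \<or> j = a + 1)"
        moreover have "a \<noteq> 0" using y(2,4) by (cases a) auto
        ultimately obtain j' where j': "j = Suc j'" "a < j'" "0 < j'" using aj by (cases j) auto
        define X' where "X' = p @ False # replicate j' True"
        have gX: "\<gamma> = replicate i False @ X' @ [True]"
          unfolding gp X'_def j' by (simp add: replicate_append_same replicate_Suc)
        have hdl: "X' \<noteq> []" "hd X'" "last X'" using j' by (auto simp: X'_def p_def)
        have bl: "zero_block (Suc i) X'"
          by (rule zero_block_of_necklace[OF gA(3) gv, of "replicate i False" X' "[True]"]) (use gX hdl in auto)
        have "butlast \<gamma> @ [False] = (replicate i False @ X') @ replicate 1 False"
          unfolding gX by (simp add: butlast_append replicate_Suc)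
        then have "last_one \<gamma> = necklace_of (replicate 1 False @ replicate i False @ X')"
          unfolding last_one_def using rotate_zeros_front by metis
        also have "\<dots> = necklace_of (replicate (Suc i) False @ X')" by (simp add: replicate_Suc)
        also have "\<dots> = replicate (Suc i) False @ X'" by (rule zero_block_necklace[OF bl])
        finally have lo: "last_one \<gamma> = replicate (Suc i) False @ X'" .
        have "X' < rev X'" unfolding X'_def p' a' using ones_less[of a j'] j' by simp
        then have "last_one \<gamma> \<in> asym_bracelets n"
          unfolding lo using zero_block_asym[OF bl, of n] gA(1) unfolding gX by simp
        then show False using Z(2) by simp
      qed
      then have "candidate n z M r s h a x" unfolding xi candidate_def using nq by auto
      then show ?thesis using u xi by blast
    qed
  qed
  show "candidate n z M r s h a x" using red by blast
  show "x' < n \<Longrightarrow> necklace_of (flip \<beta> (Suc x')) = \<gamma> \<Longrightarrow> x' = x" using red by blast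
qed

section \<open>Finding the parameters of the shape by linear searches\<close>

definition next_index :: "bool \<Rightarrow> bool list \<Rightarrow> nat \<Rightarrow> nat" where
  "next_index b l p = p + length (takeWhile (\<lambda>x. x \<noteq> b) (drop p l))"

lemma next_index_zeros: "drop p l = replicate k (\<not> b) @ b # u \<Longrightarrow> next_index b l p = p + k"
  by (simp add: next_index_def takeWhile_append takeWhile_replicate)

lemma next_index_le: "p \<le> length l \<Longrightarrow> next_index b l p \<le> length l"
  using length_takeWhile_le[of "\<lambda>x. x \<noteq> b" "drop p l"] by (simp add: next_index_def)

text \<open>The case \<open>q = length l\<close> covers a search without success.\<close>

lemma next_index_eqI:
  assumes "p \<le> q" "q \<le> length l" "\<And>i. p \<le> i \<Longrightarrow> i < q \<Longrightarrow> l ! i \<noteq> b" "q < length l \<Longrightarrow> l ! q = b"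
  shows "next_index b l p = q"
proof -
  have "takeWhile (\<lambda>x. x \<noteq> b) (drop p l) = take (q - p) (drop p l)"
    using assms by (intro takeWhile_eq_take_P_nth) auto
  then show ?thesis using assms(1,2) by (simp add: next_index_def)
qed

text \<open>These are the searches that the program performs: the first three ones give the block
  and the two gaps after it, the reversed string gives \<open>h\<close>, and the first zero after
  the block gives \<open>a\<close>.\<close>

lemma shape_next_index:
  assumes B: "\<beta> \<in> asym_bracelets n" "0 < n"
    and z: "z = next_index True \<beta> 0" and q2: "q2 = next_index True \<beta> (z + 1)" and q3: "q3 = next_index True \<beta> (q2 + 1)"
    and M: "max_run (drop z \<beta>) M"
  shows "shape \<beta> z M (q3 - (q2 + 1)) (q2 - (z + 1)) (next_index True (rev \<beta>) 1 - 1) (next_index False \<beta> z - z)"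
proof -
  note [simp del] = replicate_Suc
  obtain i s r u where g: "\<beta> = replicate i False @ True # replicate s False @ True # replicate r False @ True # u"
    and l: "last \<beta>" and f: "False \<in> set (replicate s False @ True # replicate r False @ True # u)"
    using asym_shape[OF B] by metis
  define v where "v = replicate s False @ True # replicate r False @ True # u"
  have gv: "\<beta> = replicate i False @ True # v" by (simp add: g v_def)
  have zi: "z = i" unfolding z by (subst next_index_zeros[of _ _ i _ v]) (auto simp: gv)
  have "drop (z + 1) \<beta> = v" by (simp add: gv zi)
  then have q2': "q2 = z + 1 + s" unfolding q2 v_def by (subst next_index_zeros) auto
  have "drop (q2 + 1) \<beta> = replicate r False @ True # u"
  proof -
    have "\<beta> = (replicate i False @ True # replicate s False @ [True]) @ replicate r False @ True # u" by (simp add: g)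
    moreover have "length (replicate i False @ True # replicate s False @ [True]) = q2 + 1" using q2' zi by simp
    ultimately show ?thesis by (metis append_eq_conv_conj)
  qed
  then have q3': "q3 = q2 + 1 + r" unfolding q3 by (subst next_index_zeros) auto
  define y where "y = True # v"
  have by': "\<beta> = replicate z False @ y" by (simp add: gv y_def zi)
  have lv: "v \<noteq> []" "last v" using l by (auto simp: gv v_def)
  then obtain v' where v': "v = v' @ [True]" by (metis (full_types) append_butlast_last_id)
  have "True \<in> set (rev v' @ [True])" by simp
  then obtain h u' where h: "rev v' @ [True] = replicate h False @ True # u'" using split_zeros by blast
  have ry: "rev y = True # replicate h False @ True # u'" using h by (simp add: y_def v')
  have "next_index True (rev \<beta>) 1 = 1 + h"
    by (rule next_index_zeros[of _ _ _ _ "u' @ replicate z False"]) (simp add: by' ry)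
  moreover
  have "False \<in> set y" using f by (simp add: y_def v_def)
  then obtain a u'' where a: "y = replicate a True @ False # u''" using split_ones by blast
  have "next_index False \<beta> z = z + a" by (rule next_index_zeros[of _ _ _ _ u'']) (simp add: by' a)
  moreover have "max_run y M" using M by (simp add: by')
  moreover have "q3 - (q2 + 1) = r" "q2 - (z + 1) = s" using q2' q3' by auto
  moreover have "y = True # replicate s False @ True # replicate r False @ True # u" by (simp add: y_def v_def)
  ultimately have "shape \<beta> z M r s h a" "next_index True (rev \<beta>) 1 - 1 = h" "next_index False \<beta> z - z = a"
    "q3 - (q2 + 1) = r" "q2 - (z + 1) = s"
    unfolding shape_def using by' ry a by (blast | simp)+
  then show ?thesis by simp
qed

lemma max_run_ex: "\<exists>M. max_run y M"
proof -
  let ?S = "{m. \<exists>b. b + m \<le> length y \<and> (\<forall>j<m. \<not> y ! (b + j))}"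
  have f: "finite ?S" by (rule finite_subset[of _ "{..length y}"]) auto
  have "0 \<in> ?S" by auto
  then have "?S \<noteq> {}" by blast
  then have "Max ?S \<in> ?S" using f Max_in by blast
  moreover have "m \<le> Max ?S" if "m \<in> ?S" for m using that f by simp
  ultimately show ?thesis unfolding max_run_def by blast
qed

lemma shape_ex: "\<beta> \<in> asym_bracelets n \<Longrightarrow> 0 < n \<Longrightarrow> \<exists>z M r s h a. shape \<beta> z M r s h a"
  using shape_next_index[OF _ _ refl refl refl] max_run_ex by metis

subsection \<open>Children in terms of labels\<close>

text \<open>The position in \<open>rotate d \<alpha>\<close> of the letter at \<open>i\<close> in
  \<alpha>; \<open>n\<close> is added before the subtraction because it truncates.\<close>

definition back_pos :: "nat \<Rightarrow> nat \<Rightarrow> nat \<Rightarrow> nat" where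
  "back_pos n d i = (i + n - d) mod n"

lemma flip_rotate:
  assumes "length \<alpha> = n" "i < n" "d < n"
  shows "rotate d (flip \<alpha> (Suc i)) = flip (rotate d \<alpha>) (Suc (back_pos n d i))"
proof (rule nth_equalityI)
  fix j assume j: "j < length (rotate d (flip \<alpha> (Suc i)))"
  then have jn: "j < n" using assms by simp
  have "(d + j) mod n = i \<longleftrightarrow> j = back_pos n d i"
  proof (cases "d \<le> i")
    case True
    then have "back_pos n d i = i - d" using assms by (simp add: back_pos_def mod_if)
    then show ?thesis using True assms jn by (auto simp: mod_if)
  next
    case False
    then have "back_pos n d i = i + n - d" using assms by (simp add: back_pos_def mod_if)
    then show ?thesis using False assms jn by (auto simp: mod_if)
  qed
  moreover have "(d + j) mod n < n" "back_pos n d i < n" using assms by (auto simp: back_pos_def)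
  ultimately show "rotate d (flip \<alpha> (Suc i)) ! j = flip (rotate d \<alpha>) (Suc (back_pos n d i)) ! j"
    using jn assms by (auto simp: nth_rotate' flip_def nth_list_update)
qed simp

lemma back_pos_inj:
  assumes "i < n" "j < n" "d < n" "back_pos n d i = back_pos n d j" shows "i = j"
  using assms by (auto simp: back_pos_def mod_if split: if_splits)

lemma back_pos_less: "0 < n \<Longrightarrow> back_pos n d i < n"
  by (simp add: back_pos_def)

lemma flip_flip [simp]: "k - 1 < length \<alpha> \<Longrightarrow> flip (flip \<alpha> k) k = \<alpha>"
  by (simp add: flip_def)

lemma set_child_indices:
  "k \<in> set (child_indices n \<alpha>) \<longleftrightarrow> \<not> periodic \<alpha> \<and> 1 \<le> k \<and> k \<le> n \<and>
     necklace_of (flip \<alpha> k) \<in> asym_bracelets n - {root_label n} \<and>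
     par n (necklace_of (flip \<alpha> k)) = necklace_of \<alpha>"
  by (auto simp: child_indices_def)

lemma necklace_flip:
  assumes "length \<alpha> = n" "rotate d \<alpha> = \<beta>" "d < n" "1 \<le> k" "k \<le> n"
  shows "necklace_of (flip \<alpha> k) = necklace_of (flip \<beta> (Suc (back_pos n d (k - 1))))"
    "periodic (flip \<alpha> k) \<longleftrightarrow> periodic (flip \<beta> (Suc (back_pos n d (k - 1))))"
proof -
  have "rotate d (flip \<alpha> k) = flip \<beta> (Suc (back_pos n d (k - 1)))"
    using flip_rotate[of \<alpha> n "k - 1" d] assms by simp
  then show "necklace_of (flip \<alpha> k) = necklace_of (flip \<beta> (Suc (back_pos n d (k - 1))))"
    "periodic (flip \<alpha> k) \<longleftrightarrow> periodic (flip \<beta> (Suc (back_pos n d (k - 1))))"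
    using necklace_of_rotate[of d "flip \<alpha> k"] periodic_rotate[of d "flip \<alpha> k"] by auto
qed

text \<open>Changing bit \<open>k\<close> of the label is, up to rotation, changing position
  \<open>back_pos n d (k - 1)\<close> of the necklace; change indices count from \<open>1\<close>,
  positions from \<open>0\<close>.\<close>

lemma child_imp_candidate:
  assumes "length \<alpha> = n" "\<beta> = necklace_of \<alpha>" "\<beta> \<in> asym_bracelets n" "rotate d \<alpha> = \<beta>" "d < n"
    "shape \<beta> z M r s h a" "k \<in> set (child_indices n \<alpha>)"
  shows "candidate n z M r s h a (back_pos n d (k - 1))"
    "1 \<le> k' \<Longrightarrow> k' \<le> n \<Longrightarrow> necklace_of (flip \<alpha> k') = necklace_of (flip \<alpha> k) \<Longrightarrow> k' = k"
proof -
  from assms(7) have k: "\<not> periodic \<alpha>" "1 \<le> k" "k \<le> n" "necklace_of (flip \<alpha> k) \<in> asym_bracelets n"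
    "par n (necklace_of (flip \<alpha> k)) = \<beta>" by (auto simp: set_child_indices assms(2))
  have n0: "0 < n" using assms(5) by simp
  have nk: "necklace_of (flip \<alpha> k) = necklace_of (flip \<beta> (Suc (back_pos n d (k - 1))))"
    if "1 \<le> k" "k \<le> n" for k using necklace_flip[OF assms(1,4,5)] that by blast
  have ap: "\<not> periodic \<beta>" using k(1) by (simp add: assms(2) periodic_necklace_of)
  note ck = child_kinds[OF assms(3) n0 ap back_pos_less[OF n0] nk[OF k(2,3)] k(4,5) assms(6)]
  show "candidate n z M r s h a (back_pos n d (k - 1))" by (rule ck(1))
  show "k' = k" if "1 \<le> k'" "k' \<le> n" "necklace_of (flip \<alpha> k') = necklace_of (flip \<alpha> k)"
  proof -
    have "back_pos n d (k' - 1) = back_pos n d (k - 1)"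
      using ck(2)[OF back_pos_less[OF n0]] nk[OF that(1,2)] that(3) by simp
    then have "k' - 1 = k - 1" using back_pos_inj[of "k' - 1" n "k - 1" d] that k assms(5) by simp
    then show ?thesis using that k by simp
  qed
qed

lemma necklace_rotation:
  assumes "length \<alpha> = n" "0 < n"
  obtains d where "d < n" "rotate d \<alpha> = necklace_of \<alpha>"
  using rotationsE[OF necklace_of_in[of \<alpha>]] assms by (metis length_greater_0_conv)

text \<open>This injectivity serves twice: it separates the necklaces of sibling subtrees, and it
  makes the change index recoverable.\<close>

lemma child_unique:
  assumes "length \<alpha> = n" "0 < n" "necklace_of \<alpha> \<in> asym_bracelets n" "k \<in> set (child_indices n \<alpha>)"
    "1 \<le> k'" "k' \<le> n" "necklace_of (flip \<alpha> k') = necklace_of (flip \<alpha> k)"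
  shows "k' = k"
proof -
  obtain d where d: "d < n" "rotate d \<alpha> = necklace_of \<alpha>" using necklace_rotation assms(1,2) by blast
  obtain z M r s h a where "shape (necklace_of \<alpha>) z M r s h a" using shape_ex[OF assms(3,2)] by blast
  from child_imp_candidate(2)[OF assms(1) refl assms(3) d(2,1) this assms(4-7)] show ?thesis .
qed

lemma candidate_imp_child:
  assumes "length \<alpha> = n" "\<beta> = necklace_of \<alpha>" "\<beta> \<in> asym_bracelets n" "rotate d \<alpha> = \<beta>" "d < n"
    "shape \<beta> z M r s h a" "\<not> periodic \<alpha>" "1 \<le> k" "k \<le> n"
    "candidate n z M r s h a (back_pos n d (k - 1))" "back_pos n d (k - 1) \<notin> special n z M r s h a"
  shows "k \<in> set (child_indices n \<alpha>)" "\<not> periodic (flip \<alpha> k)"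
  using candidate_child[OF assms(3,6,10,11)] necklace_flip[OF assms(1,4,5,8,9)] assms
  by (auto simp: set_child_indices)

definition special_labels :: "nat \<Rightarrow> nat \<Rightarrow> nat set \<Rightarrow> nat set" where
  "special_labels n d S = {k \<in> {1..n}. back_pos n d (k - 1) \<in> S}"

lemma card_special_labels: assumes "d < n" "finite S" "card S \<le> m" shows "card (special_labels n d S) \<le> m"
proof -
  have "inj_on (\<lambda>k. back_pos n d (k - 1)) (special_labels n d S)"
  proof (rule inj_onI)
    fix x y assume xy: "x \<in> special_labels n d S" "y \<in> special_labels n d S" "back_pos n d (x - 1) = back_pos n d (y - 1)"
    then have b: "1 \<le> x" "x \<le> n" "1 \<le> y" "y \<le> n" by (simp_all add: special_labels_def)
    then have "x - 1 < n" "y - 1 < n" by linarith+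
    from back_pos_inj[OF this assms(1) xy(3)] b show "x = y" by linarith
  qed
  then have "card (special_labels n d S) \<le> card S" using assms(2) by (intro card_inj_on_le) (auto simp: special_labels_def)
  then show ?thesis using assms(3) by simp
qed

section \<open>Recovering the change index from a label\<close>

definition par_pos :: "nat \<Rightarrow> bool list \<Rightarrow> nat" where
  "par_pos n \<gamma> = (if first_one \<gamma> \<in> asym_bracelets n then next_index True \<gamma> 0
     else if last_one \<gamma> \<in> asym_bracelets n then n - 1
     else n - 1 - next_index False (rev \<gamma>) 0)"

text \<open>The flipped string and the parent agree only up to rotation, since LastOne takes a
  necklace.\<close>

lemma par_pos:
  assumes "\<gamma> \<in> asym_bracelets n" "0 < n"
  shows "necklace_of (flip \<gamma> (Suc (par_pos n \<gamma>))) = necklace_of (par n \<gamma>)" "par_pos n \<gamma> < n"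
proof -
  note [simp del] = replicate_Suc
  obtain i s r u where g: "\<gamma> = replicate i False @ True # replicate s False @ True # replicate r False @ True # u"
    and l: "last \<gamma>" and f: "False \<in> set (replicate s False @ True # replicate r False @ True # u)"
    using asym_shape[OF assms] by metis
  define v where "v = replicate s False @ True # replicate r False @ True # u"
  have gv: "\<gamma> = replicate i False @ True # v" by (simp add: g v_def)
  have n: "length \<gamma> = n" using asym_braceletsD[OF assms(1)] by simp
  have i: "next_index True \<gamma> 0 = i" by (subst next_index_zeros[of _ _ i _ v]) (auto simp: gv)
  have fo: "first_one \<gamma> = flip \<gamma> (Suc i)" unfolding gv first_one_eq by (simp add: flip_def list_update_append nth_append)
  have lo: "butlast \<gamma> @ [False] = flip \<gamma> (Suc (n - 1))"
  proof -
    have "\<gamma> \<noteq> []" using gv by simp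
    then have e: "\<gamma> = butlast \<gamma> @ [True]" using l by (metis (full_types) append_butlast_last_id)
    have "length (butlast \<gamma>) = n - 1" using n by simp
    then have "flip (butlast \<gamma> @ [True]) (Suc (n - 1)) = butlast \<gamma> @ [False]"
      by (simp add: flip_def list_update_append nth_append)
    then show ?thesis using e by metis
  qed
  have "False \<in> set (rev \<gamma>)" using f by (auto simp: g)
  then obtain j w where w: "rev \<gamma> = replicate j True @ False # w" using split_ones by blast
  have gw: "\<gamma> = rev w @ False # replicate j True" using arg_cong[OF w, of rev] by simp
  have j: "next_index False (rev \<gamma>) 0 = j" by (subst next_index_zeros[of _ _ j _ w]) (auto simp: w)
  have nj: "n = length w + Suc j" using n gw by (metis length_append length_rev length_replicate length_Cons)
  have lz: "last_zero \<gamma> = flip \<gamma> (Suc (n - 1 - j))"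
  proof -
    have "n - 1 - j = length (rev w)" using nj by simp
    then show ?thesis unfolding gw last_zero_eq by (simp add: flip_def list_update_append nth_append)
  qed
  show "necklace_of (flip \<gamma> (Suc (par_pos n \<gamma>))) = necklace_of (par n \<gamma>)"
    unfolding par_pos_def par_def i j using fo lo lz by (auto simp: last_one_def)
  show "par_pos n \<gamma> < n" unfolding par_pos_def i j using assms(2) n by (auto simp: gv)
qed

text \<open>Undoing the change that \<open>par\<close> prescribes, at position \<open>c\<close> of
  the child's label, gives a rotation of \<alpha>, by some \<open>f\<close>. Hence the child's label
  also arises from \<alpha> by a change at \<open>e\<close> followed by this rotation.
  \<open>child_unique\<close> forces \<open>e + 1 = k\<close>, so rotation by \<open>f\<close> fixes
  the child's label; as this is aperiodic, \<open>f = 0\<close> and \<open>e = c\<close>.\<close>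

lemma change_index_of_child:
  assumes "length \<alpha> = n" "0 < n" "necklace_of \<alpha> \<in> asym_bracelets n" "k \<in> set (child_indices n \<alpha>)"
    and o: "d < n" "rotate d (flip \<alpha> k) = necklace_of (flip \<alpha> k)" and ap: "\<not> periodic (flip \<alpha> k)"
  shows "(d + par_pos n (necklace_of (flip \<alpha> k))) mod n + 1 = k"
proof -
  let ?\<alpha>' = "flip \<alpha> k" and ?\<gamma> = "necklace_of (flip \<alpha> k)"
  from assms(4) have k: "1 \<le> k" "k \<le> n" "?\<gamma> \<in> asym_bracelets n" "par n ?\<gamma> = necklace_of \<alpha>"
    by (auto simp: set_child_indices)
  have len: "length ?\<alpha>' = n" using assms by simp
  define q where "q = par_pos n ?\<gamma>"
  have q: "q < n" "necklace_of (flip ?\<gamma> (Suc q)) = necklace_of \<alpha>"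
    using par_pos[OF k(3) assms(2)] k(4) by (auto simp: q_def)
  define c where "c = (d + q) mod n"
  have c: "c < n" using assms(2) by (simp add: c_def)
  have "back_pos n d c = q"
    unfolding back_pos_def c_def using o(1) q(1) by (cases "d + q < n") (auto simp: mod_if)
  then have "rotate d (flip ?\<alpha>' (Suc c)) = flip ?\<gamma> (Suc q)"
    using flip_rotate[OF len c o(1)] o(2) by simp
  then have "necklace_of (flip ?\<alpha>' (Suc c)) = necklace_of \<alpha>"
    using q(2) necklace_of_rotate[of d "flip ?\<alpha>' (Suc c)"] by simp
  then have "flip ?\<alpha>' (Suc c) \<in> rotations \<alpha>" using necklace_of_eq_iff by blast
  moreover have "\<alpha> \<noteq> []" using assms by auto
  ultimately obtain f where f: "f < n" "flip ?\<alpha>' (Suc c) = rotate f \<alpha>" using rotationsE assms(1) by metis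
  define e where "e = (c + f) mod n"
  have e: "e < n" using assms(2) by (simp add: e_def)
  have "back_pos n f e = c"
    unfolding back_pos_def e_def using f(1) c by (cases "c + f < n") (auto simp: mod_if)
  then have r: "rotate f (flip \<alpha> (Suc e)) = ?\<alpha>'"
    using flip_rotate[OF assms(1) e f(1)] f(2) flip_flip[of "Suc c" ?\<alpha>'] c len by simp
  then have "necklace_of (flip \<alpha> (Suc e)) = ?\<gamma>" using necklace_of_rotate[of f "flip \<alpha> (Suc e)"] by simp
  then have "Suc e = k" using child_unique[OF assms(1-4), of "Suc e"] e by simp
  then have "rotate f ?\<alpha>' = ?\<alpha>'" using r by simp
  moreover have "?\<alpha>' \<noteq> []" using len assms(2) by (metis list.size(3) less_irrefl)
  ultimately have "f = 0" using ap f(1) len periodic_iff_rotate[of ?\<alpha>'] by auto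
  then have "e = c" using c by (simp add: e_def)
  then show ?thesis using \<open>Suc e = k\<close> by (simp add: c_def q_def)
qed

subsection \<open>Counting the nodes\<close>

lemma root_zero_block: assumes "n \<ge> 6" shows "zero_block (n - 4) [True, False, True, True]"
  unfolding zero_block_def
proof (intro conjI allI impI)
  fix a assume a: "a + (n - 4) \<le> length [True, False, True, True]"
  then have "a = 0 \<or> a = 1 \<or> a = 2" using assms by auto
  then show "\<exists>j<n - 4. [True, False, True, True] ! (a + j)"
    using assms by (intro exI[of _ "if a = 1 then 1 else 0"]) auto
qed (use assms in auto)

lemma root_asym: assumes "n \<ge> 6" shows "root_label n \<in> asym_bracelets n"
  using zero_block_asym[OF root_zero_block[OF assms], of n] assms by (simp add: root_label_def)

lemma reach_asym:
  assumes "reach n d \<alpha>" "n \<ge> 6"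
  shows "necklace_of \<alpha> \<in> asym_bracelets n" "length \<alpha> = n"
proof -
  show "length \<alpha> = n" using reach_par(4)[OF assms] .
  show "necklace_of \<alpha> \<in> asym_bracelets n" using assms(1)
  proof cases
    case 1
    then show ?thesis using root_asym assms by (simp add: necklace_of_root)
  qed (auto simp: set_child_indices)
qed

text \<open>The depth is the number of applications of \<open>par\<close> after which the root label
  is met for the first time, and this depends on the necklace only.\<close>

lemma reach_depth_unique:
  assumes "reach n d \<alpha>" "reach n e \<delta>" "necklace_of \<alpha> = necklace_of \<delta>" "n \<ge> 6"
  shows "d = e"
  using reach_par(1,2)[OF assms(1,4)] reach_par(1,2)[OF assms(2,4)] assms(3)
  by (metis linorder_neqE_nat)

text \<open>An iterate of \<open>par\<close> leads from a node back to the top of its subtree; this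
  tells in which sibling's subtree a node lies.\<close>

lemma subtree_reach:
  assumes "subtree_at n \<alpha> c t" "reach n D \<alpha>" "\<delta> \<in> set (rcl_order t)"
  shows "\<exists>d. reach n (D + d) \<delta> \<and> (par n ^^ d) (necklace_of \<delta>) = necklace_of \<alpha>"
  using assms
proof (induction arbitrary: D \<delta> rule: subtree_at.induct)
  case (1 \<alpha> c rs ls)
  have sub: "\<exists>d. reach n (D + d) \<delta> \<and> (par n ^^ d) (necklace_of \<delta>) = necklace_of \<alpha>"
    if k: "k \<in> set (child_indices n \<alpha>)" and \<delta>: "\<delta> \<in> set (rcl_order t)"
      and IH: "\<And>D \<delta>. reach n D (flip \<alpha> k) \<Longrightarrow> \<delta> \<in> set (rcl_order t) \<Longrightarrow>
        \<exists>d. reach n (D + d) \<delta> \<and> (par n ^^ d) (necklace_of \<delta>) = necklace_of (flip \<alpha> k)" for k t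
  proof -
    have "reach n (Suc D) (flip \<alpha> k)" using "1.prems"(1) k by (rule reach.intros)
    from IH[OF this \<delta>] obtain d where d: "reach n (Suc D + d) \<delta>"
      "(par n ^^ d) (necklace_of \<delta>) = necklace_of (flip \<alpha> k)" by blast
    have "(par n ^^ Suc d) (necklace_of \<delta>) = necklace_of \<alpha>" using d(2) k by (simp add: set_child_indices)
    then show ?thesis using d(1) by (intro exI[of _ "Suc d"]) simp
  qed
  from "1.prems"(2) consider (r) t where "t \<in> set rs" "\<delta> \<in> set (rcl_order t)" | (s) "\<delta> = \<alpha>"
    | (l) t where "t \<in> set ls" "\<delta> \<in> set (rcl_order t)" by auto
  then show ?case
  proof cases
    case r
    then obtain j where j: "j < length rs" "t = rs ! j" by (auto simp: in_set_conv_nth)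
    have len: "length (filter (\<lambda>k. k > c) (child_indices n \<alpha>)) = length rs" using "1.IH"(1) by (simp add: list_all2_lengthD)
    let ?k = "filter (\<lambda>k. k > c) (child_indices n \<alpha>) ! j"
    have "?k \<in> set (filter (\<lambda>k. k > c) (child_indices n \<alpha>))" using j len by (metis nth_mem)
    then show ?thesis using sub[of ?k t] r "1.IH"(1) j len by (auto simp: list_all2_conv_all_nth)
  next
    case s
    then show ?thesis using "1.prems" by (intro exI[of _ 0]) simp
  next
    case l
    then obtain j where j: "j < length ls" "t = ls ! j" by (auto simp: in_set_conv_nth)
    have len: "length (filter (\<lambda>k. k < c) (child_indices n \<alpha>)) = length ls" using "1.IH"(2) by (simp add: list_all2_lengthD)
    let ?k = "filter (\<lambda>k. k < c) (child_indices n \<alpha>) ! j"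
    have "?k \<in> set (filter (\<lambda>k. k < c) (child_indices n \<alpha>))" using j len by (metis nth_mem)
    then show ?thesis using sub[of ?k t] l "1.IH"(2) j len by (auto simp: list_all2_conv_all_nth)
  qed
qed

lemma distinct_child_indices: "distinct (child_indices n \<alpha>)"
  by (simp add: child_indices_def)

text \<open>A common necklace of nodes below two siblings would lie at the same depth, so the same
  iterate of \<open>par\<close> would lead to the necklaces of both siblings, and
  \<open>child_unique\<close> identifies these.\<close>

lemma distinct_forest:
  assumes "list_all2 (\<lambda>k t. subtree_at n (flip \<alpha> k) k t \<and> distinct (map necklace_of (rcl_order t))) ks ts"
    "distinct ks" "set ks \<subseteq> set (child_indices n \<alpha>)" "reach n D \<alpha>" "n \<ge> 6"
  shows "distinct (map necklace_of (concat (map rcl_order ts))) \<and>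
    (\<forall>\<delta>\<in>set (concat (map rcl_order ts)). \<exists>k\<in>set ks. \<exists>d. reach n (Suc D + d) \<delta> \<and>
       (par n ^^ d) (necklace_of \<delta>) = necklace_of (flip \<alpha> k))"
  using assms(1-3)
proof (induction rule: list_all2_induct)
  case (Cons k ks t ts)
  have k: "k \<in> set (child_indices n \<alpha>)" using Cons.prems by simp
  have rk: "reach n (Suc D) (flip \<alpha> k)" using assms(4) k by (rule reach.intros)
  have t: "subtree_at n (flip \<alpha> k) k t" "distinct (map necklace_of (rcl_order t))" using Cons.hyps by auto
  have IH: "distinct (map necklace_of (concat (map rcl_order ts)))"
    "\<And>\<delta>. \<delta>\<in>set (concat (map rcl_order ts)) \<Longrightarrow> \<exists>k\<in>set ks. \<exists>d. reach n (Suc D + d) \<delta> \<and>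
       (par n ^^ d) (necklace_of \<delta>) = necklace_of (flip \<alpha> k)" using Cons by auto
  note T = subtree_reach[OF t(1) rk]
  have "necklace_of \<delta> \<noteq> necklace_of \<delta>'"
    if in_t: "\<delta> \<in> set (rcl_order t)" and in_ts: "\<delta>' \<in> set (concat (map rcl_order ts))" for \<delta> \<delta>'
  proof
    assume e: "necklace_of \<delta> = necklace_of \<delta>'"
    obtain d where d: "reach n (Suc D + d) \<delta>" "(par n ^^ d) (necklace_of \<delta>) = necklace_of (flip \<alpha> k)"
      using T[OF in_t] by blast
    obtain k' d' where d': "k' \<in> set ks" "reach n (Suc D + d') \<delta>'"
      "(par n ^^ d') (necklace_of \<delta>') = necklace_of (flip \<alpha> k')" using IH(2)[OF in_ts] by blast
    have "d = d'" using reach_depth_unique[OF d(1) d'(2) e assms(5)] by simp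
    then have "necklace_of (flip \<alpha> k') = necklace_of (flip \<alpha> k)" using d d' e by simp
    moreover have "1 \<le> k'" "k' \<le> n" using d'(1) Cons.prems(2) by (auto simp: set_child_indices subset_iff)
    ultimately have "k' = k"
      using child_unique[OF reach_asym(2)[OF assms(4,5)] _ reach_asym(1)[OF assms(4,5)] k] assms(5) by simp
    then show False using Cons.prems(1) d'(1) by simp
  qed
  then have "set (map necklace_of (rcl_order t)) \<inter> set (map necklace_of (concat (map rcl_order ts))) = {}"
    unfolding set_map by blast
  then have "distinct (map necklace_of (concat (map rcl_order (t # ts))))"
    using t(2) IH(1) by (simp only: list.map concat.simps map_append distinct_append)
  then show ?case using T IH(2) by fastforce
qed simp

lemma subtree_distinct:
  assumes "subtree_at n \<alpha> c t" "reach n D \<alpha>" "n \<ge> 6"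
  shows "distinct (map necklace_of (rcl_order t))"
  using assms(1,2)
proof (induction arbitrary: D rule: subtree_at.induct)
  case (1 \<alpha> c rs ls)
  let ?R = "filter (\<lambda>k. k > c) (child_indices n \<alpha>)" and ?L = "filter (\<lambda>k. k < c) (child_indices n \<alpha>)"
  have r: "reach n (Suc D) (flip \<alpha> k)" if "k \<in> set (child_indices n \<alpha>)" for k
    using "1.prems" that by (rule reach.intros)
  have "list_all2 (\<lambda>k t. subtree_at n (flip \<alpha> k) k t \<and> distinct (map necklace_of (rcl_order t))) ?R rs"
    using "1.IH"(1) by (rule list.rel_mono_strong) (use r in auto)
  moreover have "list_all2 (\<lambda>k t. subtree_at n (flip \<alpha> k) k t \<and> distinct (map necklace_of (rcl_order t))) ?L ls"
    using "1.IH"(2) by (rule list.rel_mono_strong) (use r in auto)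
  ultimately have "list_all2 (\<lambda>k t. subtree_at n (flip \<alpha> k) k t \<and> distinct (map necklace_of (rcl_order t)))
      (?R @ ?L) (rs @ ls)" by (rule list_all2_appendI)
  moreover have "distinct (?R @ ?L)" using distinct_child_indices by auto
  ultimately have F: "distinct (map necklace_of (concat (map rcl_order (rs @ ls))))"
    "\<forall>\<delta>\<in>set (concat (map rcl_order (rs @ ls))). \<exists>k\<in>set (?R @ ?L). \<exists>d. reach n (Suc D + d) \<delta> \<and>
       (par n ^^ d) (necklace_of \<delta>) = necklace_of (flip \<alpha> k)"
    using distinct_forest[of n \<alpha> "?R @ ?L" "rs @ ls" D] "1.prems" assms(3) by auto
  have "necklace_of \<alpha> \<noteq> necklace_of \<delta>" if "\<delta> \<in> set (concat (map rcl_order (rs @ ls)))" for \<delta>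
  proof
    assume e: "necklace_of \<alpha> = necklace_of \<delta>"
    from F(2) that obtain d where "reach n (Suc D + d) \<delta>" by blast
    from reach_depth_unique[OF "1.prems" this e assms(3)] show False by simp
  qed
  then show ?case using F(1) by (auto simp: image_iff)
qed

text \<open>The unit of payment: an aperiodic node outputs \<open>n\<close> bits.\<close>

definition weight :: "ctree \<Rightarrow> nat" where
  "weight t = length (filter (\<lambda>\<alpha>. \<not> periodic \<alpha>) (rcl_order t))"

lemma weight_RCL:
  assumes "\<And>\<alpha>. \<alpha> \<in> set (rcl_order t) \<Longrightarrow> length \<alpha> = n" "0 < n"
  shows "n * weight t \<le> length (RCL t)"
proof -
  have "n * length (filter (\<lambda>\<alpha>. \<not> periodic \<alpha>) l) \<le> length (concat (map ap l))"
    if "\<forall>\<alpha>\<in>set l. length \<alpha> = n" for l :: "bool list list"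
    using that
  proof (induction l)
    case (Cons \<alpha> l)
    have "\<not> periodic \<alpha> \<Longrightarrow> length (ap \<alpha>) = n" using Cons.prems assms(2) by (subst ap_aperiodic) auto
    then show ?case using Cons by auto
  qed simp
  then show ?thesis using assms(1) by (simp add: weight_def RCL_def)
qed

text \<open>By their necklaces the aperiodic nodes inject into the aperiodic members of
  \<open>asym_bracelets n\<close>, each of which contributes \<open>n\<close> to
  \<open>Lsum n\<close>.\<close>

lemma weight_Lsum:
  assumes "n \<ge> 6" shows "n * weight (conc_tree n) \<le> Lsum n"
proof -
  note T = conc_tree[OF assms] and R = reach.intros(1)[of n]
  let ?l = "map necklace_of (filter (\<lambda>\<alpha>. \<not> periodic \<alpha>) (rcl_order (conc_tree n)))"
  have dl: "distinct ?l" using subtree_distinct[OF T R assms] by (rule distinct_map_filter)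
  have sub: "\<gamma> \<in> asym_bracelets n \<and> length (ap \<gamma>) = n" if "\<gamma> \<in> set ?l" for \<gamma>
  proof -
    from that obtain \<delta> where \<delta>: "\<delta> \<in> set (rcl_order (conc_tree n))" "\<not> periodic \<delta>" "\<gamma> = necklace_of \<delta>" by auto
    obtain d where "reach n (0 + d) \<delta>" using subtree_reach[OF T R \<delta>(1)] by blast
    then have "\<gamma> \<in> asym_bracelets n" "length \<delta> = n" using reach_asym assms \<delta> by auto
    moreover have "\<not> periodic \<gamma>" using \<delta> by (simp add: periodic_necklace_of)
    moreover have "\<gamma> \<noteq> []" using \<delta> \<open>length \<delta> = n\<close> assms by (metis length_necklace_of list.size(3) not_numeral_le_zero)
    ultimately show ?thesis using ap_aperiodic[of \<gamma>] \<delta>(3) by simp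
  qed
  have fin: "finite (asym_bracelets n)"
    by (rule finite_subset[OF _ finite_lists_length_eq[of "UNIV :: bool set" n]]) (auto simp: asym_bracelets_def)
  have "n * weight (conc_tree n) = n * card (set ?l)" using distinct_card[OF dl] by (simp add: weight_def)
  also have "\<dots> = (\<Sum>\<gamma>\<in>set ?l. length (ap \<gamma>))" using sub by simp
  also have "\<dots> \<le> Lsum n" unfolding Lsum_def using sub fin by (intro sum_mono2) auto
  finally show ?thesis .
qed

section \<open>The program\<close>

lemma fst_assign [simp]: "x \<noteq> 0 \<Longrightarrow> fst (assign x e \<sigma>) = (fst \<sigma>)(x := if e < 8 * fst \<sigma> 0 then e else 0)"
  by (simp add: assign_def)

lemma snd_assign [simp]: "snd (assign x e \<sigma>) = snd \<sigma>"
  by (simp add: assign_def)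

lemma fst_put_bit [simp]: "fst (put_bit j i e \<sigma>) = fst \<sigma>"
  by (simp add: put_bit_def)

lemma snd_put_bit [simp]: "snd (put_bit j i e \<sigma>) = (snd \<sigma>)(j := (snd \<sigma> j)((if i < fst \<sigma> 0 then i else 0) := (e \<noteq> 0)))"
  by (simp add: put_bit_def)

lemma length_bits [simp]: "length (bits \<sigma> j) = fst \<sigma> 0"
  by (simp add: bits_def)

lemma bits_nth: "i < fst \<sigma> 0 \<Longrightarrow> bits \<sigma> j ! i = snd \<sigma> j i"
  by (simp add: bits_def)

lemma bits_assign [simp]: "bits (assign x e \<sigma>) j = bits \<sigma> j"
  by (simp add: bits_def assign_def)

lemma bits_put_bit: "i < fst \<sigma> 0 \<Longrightarrow> bits (put_bit j i e \<sigma>) j' = (if j = j' then (bits \<sigma> j)[i := (e \<noteq> 0)] else bits \<sigma> j')"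
  by (intro nth_equalityI) (auto simp: bits_nth nth_list_update put_bit_def)

lemma frame_var: "frame c \<sigma> \<sigma>' \<Longrightarrow> x \<notin> mod_vars c \<Longrightarrow> fst \<sigma>' x = fst \<sigma> x"
  by (simp add: frame_def)

lemma frame_size: "frame c \<sigma> \<sigma>' \<Longrightarrow> fst \<sigma>' 0 = fst \<sigma> 0"
  by (simp add: frame_def)

lemma frame_array: "frame c \<sigma> \<sigma>' \<Longrightarrow> j \<notin> mod_arrays c \<Longrightarrow> snd \<sigma>' j = snd \<sigma> j"
  by (simp add: frame_def)

lemma frame_bits: "frame c \<sigma> \<sigma>' \<Longrightarrow> j \<notin> mod_arrays c \<Longrightarrow> bits \<sigma>' j = bits \<sigma> j"
  by (simp add: frame_def bits_def)

lemma wp_pos: "(0 < fst \<sigma> 0 \<Longrightarrow> wp c Q \<sigma>) \<Longrightarrow> wp c Q \<sigma>"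
  by (auto simp: wp_def)

text \<open>Reduction modulo \<open>n\<close> for values below \<open>2 * n\<close>, by one
  conditional subtraction; expressions have no division.\<close>

definition wrap :: "hexp \<Rightarrow> hexp" where
  "wrap e = Sub e (Mul (Var 0) (Sub (Cst 1) (Lt e (Var 0))))"

lemma eval_wrap: "eval_ex \<sigma> e < 2 * fst \<sigma> 0 \<Longrightarrow> eval_ex \<sigma> (wrap e) = eval_ex \<sigma> e mod fst \<sigma> 0"
  by (auto simp: wrap_def mod_if)

lemma eval_Bit: "eval_ex \<sigma> e < fst \<sigma> 0 \<Longrightarrow> eval_ex \<sigma> (Bit a e) = of_bool (bits \<sigma> a ! eval_ex \<sigma> e)"
  by (simp add: bits_nth)

lemma eval_Bit_wrap: "eval_ex \<sigma> e < 2 * fst \<sigma> 0 \<Longrightarrow> eval_ex \<sigma> (Bit a (wrap e)) = of_bool (bits \<sigma> a ! (eval_ex \<sigma> e mod fst \<sigma> 0))"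
  using eval_wrap[of \<sigma> e] by (subst eval_Bit) auto

subsection \<open>Least rotation\<close>

text \<open>The invariant of the two-pointer search: among the starting positions below \<open>j\<close> only \<open>i\<close> may be
  needed to attain the least rotation, and the rotations at \<open>i\<close> and \<open>j\<close> agree on \<open>k\<close> letters.\<close>

definition lrot_inv :: "bool list \<Rightarrow> nat \<Rightarrow> nat \<Rightarrow> nat \<Rightarrow> bool" where
  "lrot_inv s i j k \<longleftrightarrow> i < j \<and> i < length s \<and> k \<le> length s \<and> j \<le> 2 * length s + 1 \<and>
     (\<forall>l<k. s ! ((i + l) mod length s) = s ! ((j + l) mod length s)) \<and>
     (\<forall>x<j. rotate x s = necklace_of s \<longrightarrow> rotate i s = necklace_of s)"

lemma lrot_init: "s \<noteq> [] \<Longrightarrow> lrot_inv s 0 1 0"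
  by (auto simp: lrot_inv_def)

lemma lrot_eq:
  "lrot_inv s i j k \<Longrightarrow> k < length s \<Longrightarrow> s ! ((i + k) mod length s) = s ! ((j + k) mod length s) \<Longrightarrow>
   lrot_inv s i j (Suc k)"
  by (auto simp: lrot_inv_def less_Suc_eq)

lemma necklace_of_le_rotate: "\<not> rotate d s < necklace_of s"
  using necklace_of_le[OF rotate_in_rotations[of d s]] by simp

text \<open>The rotations starting at \<open>j, ..., j + k\<close> are beaten by those at
  \<open>i, ..., i + k\<close>, so all of them are skipped at once.\<close>

lemma lrot_lt:
  assumes "lrot_inv s i j k" "j < length s" "k < length s" "\<not> s ! ((i + k) mod length s)" "s ! ((j + k) mod length s)"
  shows "lrot_inv s i (j + k + 1) 0"
proof -
  have "rotate i s = necklace_of s" if x: "x < j + k + 1" "rotate x s = necklace_of s" for x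
  proof (cases "x < j")
    case False
    have "rotate (i + (x - j)) s < rotate (j + (x - j)) s"
      using assms x False by (intro rotate_less_skip[of s "length s" k]) (auto simp: lrot_inv_def)
    then show ?thesis using x False necklace_of_le_rotate by simp
  qed (use assms(1) x in \<open>auto simp: lrot_inv_def\<close>)
  then show ?thesis using assms by (auto simp: lrot_inv_def)
qed

text \<open>Now the starts \<open>i, ..., i + k\<close> are beaten; since of those below
  \<open>j\<close> only \<open>i\<close> mattered, the next start that can be least is the maximum
  of \<open>j\<close> and \<open>i + k + 1\<close>. It lies below the length because a least
  rotation exists.\<close>

lemma lrot_gt:
  assumes "lrot_inv s i j k" "j < length s" "k < length s" "s ! ((i + k) mod length s)" "\<not> s ! ((j + k) mod length s)"
    and i': "i' = max j (i + k + 1)"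
  shows "lrot_inv s i' (i' + 1) 0"
proof -
  have ni: "rotate (i + l) s \<noteq> necklace_of s" if "l \<le> k" for l
  proof -
    have "rotate (j + l) s < rotate (i + l) s"
      using assms that by (intro rotate_less_skip[of s "length s" k]) (auto simp: lrot_inv_def)
    then show ?thesis using necklace_of_le_rotate by metis
  qed
  have "rotate i' s = necklace_of s" if x: "x < i' + 1" "rotate x s = necklace_of s" for x
  proof -
    have "\<not> x < j" using assms(1) x ni[of 0] by (auto simp: lrot_inv_def)
    moreover have "\<not> (i \<le> x \<and> x \<le> i + k)"
    proof
      assume "i \<le> x \<and> x \<le> i + k"
      then have "x - i \<le> k" "i + (x - i) = x" by auto
      then show False using ni[of "x - i"] x by simp
    qed
    ultimately have "x = i'" using x assms by (auto simp: lrot_inv_def)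
    then show ?thesis using x by simp
  qed
  note hexp = this
  have "s \<noteq> []" using assms(2) by auto
  then obtain d where d: "d < length s" "necklace_of s = rotate d s" using rotationsE[OF necklace_of_in] by blast
  have "i' < length s"
  proof (cases "d < i' + 1")
    case True
    have "\<not> d < j" using assms(1) d ni[of 0] by (auto simp: lrot_inv_def)
    moreover have "\<not> (i \<le> d \<and> d \<le> i + k)"
    proof
      assume "i \<le> d \<and> d \<le> i + k"
      then have "d - i \<le> k" "i + (d - i) = d" by auto
      then show False using ni[of "d - i"] d by simp
    qed
    ultimately have "d = i'" using True assms by (auto simp: lrot_inv_def)
    then show ?thesis using d by simp
  qed (use d in simp)
  then show ?thesis using assms hexp by (auto simp: lrot_inv_def)
qed

text \<open>Full agreement makes the distance \<open>j - i\<close> a period, so any start from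
  \<open>j\<close> on can be moved down until it is below \<open>j\<close>.\<close>

lemma lrot_full:
  assumes "lrot_inv s i j (length s)" "j < length s"
  shows "lrot_inv s i (j + length s + 1) 0"
proof -
  have "rotate i s = rotate j s"
    using assms by (intro nth_equalityI) (auto simp: lrot_inv_def nth_rotate')
  then have r: "rotate (i + l) s = rotate (j + l) s" for l by (metis rotate_rotate add.commute)
  have "rotate i s = necklace_of s" if "rotate x s = necklace_of s" for x
    using that
  proof (induction x rule: less_induct)
    case (less x)
    show ?case
    proof (cases "x < j")
      case False
      then have "rotate (i + (x - j)) s = necklace_of s" using less.prems r[of "x - j"] by simp
      moreover have "i + (x - j) < x" using False assms(1) by (auto simp: lrot_inv_def)
      ultimately show ?thesis using less.IH by blast
    qed (use assms(1) less.prems in \<open>auto simp: lrot_inv_def\<close>)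
  qed
  then show ?thesis using assms by (auto simp: lrot_inv_def)
qed

lemma lrot_exit:
  assumes "lrot_inv s i j k" "length s \<le> j" "s \<noteq> []"
  shows "i < length s" "rotate i s = necklace_of s"
proof -
  obtain d where d: "d < length s" "necklace_of s = rotate d s" using rotationsE[OF necklace_of_in assms(3)] .
  have "d < j" using d(1) assms(2) by simp
  then show r: "rotate i s = necklace_of s" using assms(1) d(2) unfolding lrot_inv_def by metis
  show "i < length s" using assms by (simp add: lrot_inv_def)
qed

text \<open>Scalars: \<open>0\<close> is \<open>n\<close>; \<open>1\<close> the change index; \<open>2\<close> the position to be examined next; \<open>3\<close> the flag of the
  main loop; \<open>4\<close> the rotation that takes the label to its necklace; \<open>5\<close> its least period;
  \<open>6\<close> to \<open>11\<close> the parameters \<open>z\<close>, \<open>M\<close>, \<open>r\<close>, \<open>s\<close>, \<open>h\<close>, \<open>a\<close> of \<open>shape\<close>; \<open>12\<close> whether the node is the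
  root; \<open>13\<close> the change index recomputed from the label; from \<open>14\<close> on temporaries. Arrays: \<open>0\<close> is the
  label; \<open>1\<close> the root label; \<open>2\<close> the necklace of the label; \<open>3\<close> the necklace of the child under
  test; \<open>4\<close> a parent; \<open>5\<close> to \<open>8\<close> temporaries.\<close>

definition LROT :: "nat \<Rightarrow> hcmd" where
  "LROT a = Asg 14 (Cst 0);; Asg 15 (Cst 1);; Asg 16 (Cst 0);;
     Loop (Lt (Var 15) (Var 0))
       (Cond (Lt (Var 16) (Var 0))
         (Asg 17 (Bit a (wrap (Add (Var 14) (Var 16))));;
          Asg 18 (Bit a (wrap (Add (Var 15) (Var 16))));;
          Cond (Equ (Var 17) (Var 18))
            (Asg 16 (Add (Var 16) (Cst 1)))
            (Cond (Lt (Var 17) (Var 18))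
              (Asg 15 (Add (Add (Var 15) (Var 16)) (Cst 1));; Asg 16 (Cst 0))
              (Asg 14 (Add (Add (Var 14) (Var 16)) (Cst 1));;
               Cond (Lt (Var 14) (Var 15)) (Asg 14 (Var 15)) Nop;;
               Asg 15 (Add (Var 14) (Cst 1));; Asg 16 (Cst 0))))
         (Asg 15 (Add (Add (Var 15) (Var 16)) (Cst 1));; Asg 16 (Cst 0)))"

lemma mods_LROT [simp]: "mod_vars (LROT a) = {14, 15, 16, 17, 18}" "mod_arrays (LROT a) = {}" "wf_cmd (LROT a) \<longleftrightarrow> a < 12"
  by (auto simp: LROT_def wrap_def)

text \<open>Each branch increases the sum of the two pointers and the number of matched letters,
  which is below \<open>3 * n\<close> whenever the loop body runs; this gives the linear
  time.\<close>

lemma wp_LROT: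
  assumes "\<And>\<sigma>'. frame (LROT a) \<sigma> \<sigma>' \<Longrightarrow> fst \<sigma>' 14 < fst \<sigma> 0 \<Longrightarrow>
    rotate (fst \<sigma>' 14) (bits \<sigma> a) = necklace_of (bits \<sigma> a) \<Longrightarrow> Q \<sigma>'"
  shows "wp (LROT a) Q \<sigma>"
proof (rule wp_pos)
  assume n: "0 < fst \<sigma> 0"
  let ?s = "bits \<sigma> a" and ?n = "fst \<sigma> 0"
  have ne: "?s \<noteq> []" using n by (metis length_bits list.size(3) less_irrefl)
  let ?I = "\<lambda>\<sigma>'. lrot_inv ?s (fst \<sigma>' 14) (fst \<sigma>' 15) (fst \<sigma>' 16)"
  have "wp (LROT a) (\<lambda>\<sigma>'. fst \<sigma>' 14 < ?n \<and> rotate (fst \<sigma>' 14) ?s = necklace_of ?s) \<sigma>"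
    unfolding LROT_def
  proof (intro wp_Seq wp_Asg, rule wp_Loop[where Inv = ?I and
        \<mu> = "\<lambda>\<sigma>'. 3 * fst \<sigma>' 0 - (fst \<sigma>' 14 + fst \<sigma>' 15 + fst \<sigma>' 16)"], goal_cases)
    case 1
    show ?case by simp
  next
    case 2
    show ?case using lrot_init[OF ne] n by simp
  next
    case 3
    show ?case by simp
  next
    case (4 \<sigma>')
    have fn: "fst \<sigma>' 0 = ?n" using frame_size[OF 4(1)] by simp
    have fb: "bits \<sigma>' a = ?s" using frame_bits[OF 4(1), of a] by simp
    let ?i = "fst \<sigma>' 14" and ?j = "fst \<sigma>' 15" and ?k = "fst \<sigma>' 16"
    have j: "?j < ?n" using 4(3) fn by simp
    have b: "?i < ?j" "?k \<le> ?n" using 4(2) by (auto simp: lrot_inv_def)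
    show ?case
    proof (cases "?k < ?n")
      case True
      have b1: "eval_ex \<tau> (Bit a (wrap (Add (Var 14) (Var 16)))) = of_bool (?s ! ((?i + ?k) mod ?n))"
        if "fst \<tau> 0 = ?n" "snd \<tau> = snd \<sigma>'" "fst \<tau> 14 = ?i" "fst \<tau> 16 = ?k" for \<tau>
        using that fb fn j True b by (subst eval_Bit_wrap) (auto simp: bits_def)
      have b2: "eval_ex \<tau> (Bit a (wrap (Add (Var 15) (Var 16)))) = of_bool (?s ! ((?j + ?k) mod ?n))"
        if "fst \<tau> 0 = ?n" "snd \<tau> = snd \<sigma>'" "fst \<tau> 15 = ?j" "fst \<tau> 16 = ?k" for \<tau>
        using that fb fn j True b by (subst eval_Bit_wrap) (auto simp: bits_def)
      consider (eq) "?s ! ((?i + ?k) mod ?n) = ?s ! ((?j + ?k) mod ?n)"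
        | (lt) "\<not> ?s ! ((?i + ?k) mod ?n)" "?s ! ((?j + ?k) mod ?n)"
        | (gt) "?s ! ((?i + ?k) mod ?n)" "\<not> ?s ! ((?j + ?k) mod ?n)" by blast
      then show ?thesis
      proof cases
        case eq
        then show ?thesis using lrot_eq[OF 4(2)] True fn j b
          by (simp add: b1 b2 del: eval_ex.simps(3))
      next
        case lt
        then show ?thesis using lrot_lt[OF 4(2)] True fn j b
          by (simp add: b1 b2 del: eval_ex.simps(3))
      next
        case gt
        then show ?thesis using lrot_gt[OF 4(2) _ _ _ _ refl] True fn j b
          by (auto simp add: b1 b2 max_def simp del: eval_ex.simps(3))
      qed
    next
      case False
      then have "?k = ?n" using b by simp
      then show ?thesis using lrot_full[of ?s ?i ?j] 4(2) fn j b by simp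
    qed
  next
    case (5 \<sigma>')
    have fn: "fst \<sigma>' 0 = ?n" using frame_size[OF 5(1)] by simp
    then show ?case using lrot_exit[OF 5(2) _ ne] 5(3) by simp
  qed
  then show "wp (LROT a) Q \<sigma>" using assms by (rule wp_frame) auto
qed

subsection \<open>Copying, reversing, comparing, searching\<close>

text \<open>The rotation distance is taken from scalar \<open>14\<close>, where \<open>LROT\<close>
  leaves it.\<close>

definition ROT :: "nat \<Rightarrow> nat \<Rightarrow> hcmd" where
  "ROT a b = Asg 15 (Cst 0);; Loop (Lt (Var 15) (Var 0))
     (Put b (Var 15) (Bit a (wrap (Add (Var 14) (Var 15))));; Asg 15 (Add (Var 15) (Cst 1)))"

lemma mods_ROT [simp]: "mod_vars (ROT a b) = {15}" "mod_arrays (ROT a b) = {b}" "wf_cmd (ROT a b) \<longleftrightarrow> a < 12 \<and> b < 12"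
  by (auto simp: ROT_def wrap_def)

lemma wp_ROT:
  assumes ab: "a \<noteq> b" and d: "fst \<sigma> 14 < fst \<sigma> 0"
    and Q: "\<And>\<sigma>'. frame (ROT a b) \<sigma> \<sigma>' \<Longrightarrow> bits \<sigma>' b = rotate (fst \<sigma> 14) (bits \<sigma> a) \<Longrightarrow> Q \<sigma>'"
  shows "wp (ROT a b) Q \<sigma>"
proof -
  let ?s = "bits \<sigma> a" and ?n = "fst \<sigma> 0" and ?d = "fst \<sigma> 14"
  let ?I = "\<lambda>\<sigma>'. fst \<sigma>' 15 \<le> ?n \<and> (\<forall>l<fst \<sigma>' 15. snd \<sigma>' b l = ?s ! ((?d + l) mod ?n))"
  have "wp (ROT a b) (\<lambda>\<sigma>'. fst \<sigma>' 0 = ?n \<and> (\<forall>l<?n. snd \<sigma>' b l = ?s ! ((?d + l) mod ?n))) \<sigma>"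
    unfolding ROT_def
  proof (intro wp_Seq wp_Asg, rule wp_Loop[where Inv = ?I and \<mu> = "\<lambda>\<sigma>'. fst \<sigma>' 0 - fst \<sigma>' 15"], goal_cases)
    case (4 \<sigma>')
    have fn: "fst \<sigma>' 0 = ?n" "fst \<sigma>' 14 = ?d" using frame_size[OF 4(1)] frame_var[OF 4(1), of 14] by auto
    have fb: "bits \<sigma>' a = ?s" using frame_bits[OF 4(1), of a] ab by simp
    have i: "fst \<sigma>' 15 < ?n" using 4(3) fn by simp
    have "eval_ex \<sigma>' (Bit a (wrap (Add (Var 14) (Var 15)))) = of_bool (?s ! ((?d + fst \<sigma>' 15) mod ?n))"
      using fn fb i d by (subst eval_Bit_wrap) auto
    then show ?case using 4(2) fn i by (auto simp: less_Suc_eq simp del: eval_ex.simps(3))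
  next
    case (5 \<sigma>')
    then show ?case using frame_size[OF 5(1)] by simp
  qed (use d in simp_all)
  then show ?thesis
    by (rule wp_frame) (intro Q; auto intro!: nth_equalityI simp: bits_nth nth_rotate')
qed

definition NECK :: "nat \<Rightarrow> nat \<Rightarrow> hcmd" where
  "NECK a b = LROT a;; ROT a b"

lemma mods_NECK [simp]: "mod_vars (NECK a b) = {14, 15, 16, 17, 18}" "mod_arrays (NECK a b) = {b}"
    "wf_cmd (NECK a b) \<longleftrightarrow> a < 12 \<and> b < 12"
  by (auto simp: NECK_def)

lemma wp_NECK:
  assumes ab: "a \<noteq> b"
    and Q: "\<And>\<sigma>'. frame (NECK a b) \<sigma> \<sigma>' \<Longrightarrow> bits \<sigma>' b = necklace_of (bits \<sigma> a) \<Longrightarrow> fst \<sigma>' 14 < fst \<sigma> 0 \<Longrightarrow>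
      rotate (fst \<sigma>' 14) (bits \<sigma> a) = necklace_of (bits \<sigma> a) \<Longrightarrow> Q \<sigma>'"
  shows "wp (NECK a b) Q \<sigma>"
proof -
  have "wp (NECK a b) (\<lambda>\<sigma>'. bits \<sigma>' b = necklace_of (bits \<sigma> a) \<and> fst \<sigma>' 14 < fst \<sigma> 0 \<and>
      rotate (fst \<sigma>' 14) (bits \<sigma> a) = necklace_of (bits \<sigma> a)) \<sigma>"
    unfolding NECK_def
    apply (rule wp_Seq, rule wp_LROT)
    subgoal premises p for \<sigma>1
      apply (rule wp_ROT[OF ab])
      using p frame_size[OF p(1)] frame_bits[OF p(1), of a] by (auto dest: frame_var[of _ _ _ 14])
    done
  then show ?thesis by (rule wp_frame) (intro Q; auto)
qed

definition COPY :: "nat \<Rightarrow> nat \<Rightarrow> hcmd" where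
  "COPY a b = Asg 14 (Cst 0);; ROT a b"

lemma mods_COPY [simp]: "mod_vars (COPY a b) = {14, 15}" "mod_arrays (COPY a b) = {b}" "wf_cmd (COPY a b) \<longleftrightarrow> a < 12 \<and> b < 12"
  by (auto simp: COPY_def)

lemma wp_COPY:
  assumes ab: "a \<noteq> b" and Q: "\<And>\<sigma>'. frame (COPY a b) \<sigma> \<sigma>' \<Longrightarrow> bits \<sigma>' b = bits \<sigma> a \<Longrightarrow> Q \<sigma>'"
  shows "wp (COPY a b) Q \<sigma>"
proof (rule wp_pos)
  assume "0 < fst \<sigma> 0"
  then have "wp (COPY a b) (\<lambda>\<sigma>'. bits \<sigma>' b = bits \<sigma> a) \<sigma>"
    unfolding COPY_def by (intro wp_Seq wp_Asg wp_ROT[OF ab]) auto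
  then show "wp (COPY a b) Q \<sigma>" by (rule wp_frame) (intro Q)
qed

definition REV :: "nat \<Rightarrow> nat \<Rightarrow> hcmd" where
  "REV a b = Asg 15 (Cst 0);; Loop (Lt (Var 15) (Var 0))
     (Put b (Var 15) (Bit a (Sub (Sub (Var 0) (Cst 1)) (Var 15)));; Asg 15 (Add (Var 15) (Cst 1)))"

lemma mods_REV [simp]: "mod_vars (REV a b) = {15}" "mod_arrays (REV a b) = {b}" "wf_cmd (REV a b) \<longleftrightarrow> a < 12 \<and> b < 12"
  by (auto simp: REV_def)

lemma wp_REV:
  assumes ab: "a \<noteq> b"
    and Q: "\<And>\<sigma>'. frame (REV a b) \<sigma> \<sigma>' \<Longrightarrow> bits \<sigma>' b = rev (bits \<sigma> a) \<Longrightarrow> Q \<sigma>'"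
  shows "wp (REV a b) Q \<sigma>"
proof -
  let ?s = "bits \<sigma> a" and ?n = "fst \<sigma> 0"
  let ?I = "\<lambda>\<sigma>'. fst \<sigma>' 15 \<le> ?n \<and> (\<forall>l<fst \<sigma>' 15. snd \<sigma>' b l = ?s ! (?n - 1 - l))"
  have "wp (REV a b) (\<lambda>\<sigma>'. fst \<sigma>' 0 = ?n \<and> (\<forall>l<?n. snd \<sigma>' b l = ?s ! (?n - 1 - l))) \<sigma>"
    unfolding REV_def
  proof (intro wp_Seq wp_Asg, rule wp_Loop[where Inv = ?I and \<mu> = "\<lambda>\<sigma>'. fst \<sigma>' 0 - fst \<sigma>' 15"], goal_cases)
    case (4 \<sigma>')
    have fn: "fst \<sigma>' 0 = ?n" using frame_size[OF 4(1)] by auto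
    have fb: "bits \<sigma>' a = ?s" using frame_bits[OF 4(1), of a] ab by simp
    have i: "fst \<sigma>' 15 < ?n" using 4(3) fn by simp
    have "eval_ex \<sigma>' (Bit a (Sub (Sub (Var 0) (Cst 1)) (Var 15))) = of_bool (?s ! (?n - 1 - fst \<sigma>' 15))"
      using fn fb i by (subst eval_Bit) auto
    then show ?case using 4(2) fn i by (auto simp: less_Suc_eq simp del: eval_ex.simps(3))
  next
    case (5 \<sigma>')
    then show ?case using frame_size[OF 5(1)] by simp
  qed simp_all
  then show ?thesis
    by (rule wp_frame) (intro Q; auto intro!: nth_equalityI simp: bits_nth rev_nth)
qed

definition CMP :: "nat \<Rightarrow> nat \<Rightarrow> hcmd" where
  "CMP a b = Asg 15 (Cst 0);; Loop (Mul (Lt (Var 15) (Var 0)) (Equ (Bit a (Var 15)) (Bit b (Var 15))))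
     (Asg 15 (Add (Var 15) (Cst 1)))"

lemma mods_CMP [simp]: "mod_vars (CMP a b) = {15}" "mod_arrays (CMP a b) = {}" "wf_cmd (CMP a b) \<longleftrightarrow> a < 12 \<and> b < 12"
  by (auto simp: CMP_def)

text \<open>Scalar \<open>15\<close> ends at the first difference of two strings of equal length, or
  at \<open>n\<close> if there is none; the letter of array \<open>b\<close> at a difference decides
  the order.\<close>

lemma wp_CMP:
  assumes Q: "\<And>\<sigma>'. frame (CMP a b) \<sigma> \<sigma>' \<Longrightarrow> (fst \<sigma>' 15 = fst \<sigma> 0 \<longleftrightarrow> bits \<sigma> a = bits \<sigma> b) \<Longrightarrow>
    (fst \<sigma>' 15 < fst \<sigma> 0 \<longleftrightarrow> bits \<sigma> a \<noteq> bits \<sigma> b) \<Longrightarrow>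
    (fst \<sigma>' 15 < fst \<sigma> 0 \<and> snd \<sigma> b (fst \<sigma>' 15) \<longleftrightarrow> bits \<sigma> a < bits \<sigma> b) \<Longrightarrow> Q \<sigma>'"
  shows "wp (CMP a b) Q \<sigma>"
proof -
  let ?s = "bits \<sigma> a" and ?t = "bits \<sigma> b" and ?n = "fst \<sigma> 0"
  let ?I = "\<lambda>\<sigma>'. fst \<sigma>' 15 \<le> ?n \<and> (\<forall>l<fst \<sigma>' 15. ?s ! l = ?t ! l)"
  have "wp (CMP a b) (\<lambda>\<sigma>'. fst \<sigma>' 15 \<le> ?n \<and> (\<forall>l<fst \<sigma>' 15. ?s ! l = ?t ! l) \<and>
      (fst \<sigma>' 15 < ?n \<longrightarrow> ?s ! fst \<sigma>' 15 \<noteq> ?t ! fst \<sigma>' 15)) \<sigma>"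
    unfolding CMP_def
  proof (intro wp_Seq wp_Asg, rule wp_Loop[where Inv = ?I and \<mu> = "\<lambda>\<sigma>'. fst \<sigma>' 0 - fst \<sigma>' 15"], goal_cases)
    case (4 \<sigma>')
    have fn: "fst \<sigma>' 0 = ?n" using frame_size[OF 4(1)] by auto
    have fb: "bits \<sigma>' a = ?s" "bits \<sigma>' b = ?t" using frame_bits[OF 4(1)] by auto
    have i: "fst \<sigma>' 15 < ?n" using 4(3) fn by (auto split: if_splits)
    have "?s ! fst \<sigma>' 15 = ?t ! fst \<sigma>' 15" using 4(3) fn fb i
      by (simp add: eval_Bit of_bool_def del: eval_ex.simps(3) split: if_splits)
    then show ?case using 4(2) fn i by (auto simp: less_Suc_eq)
  next
    case (5 \<sigma>')
    have fn: "fst \<sigma>' 0 = ?n" using frame_size[OF 5(1)] by auto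
    have fb: "bits \<sigma>' a = ?s" "bits \<sigma>' b = ?t" using frame_bits[OF 5(1)] by auto
    show ?case using 5(2,3) fn fb by (auto simp: eval_Bit simp del: eval_ex.simps(3))
  qed simp_all
  then show ?thesis
  proof (rule wp_frame)
    fix \<sigma>' :: hstate
    let ?i = "fst \<sigma>' 15"
    assume p: "?i \<le> ?n \<and> (\<forall>l<?i. ?s ! l = ?t ! l) \<and> (?i < ?n \<longrightarrow> ?s ! ?i \<noteq> ?t ! ?i)" and f: "frame (CMP a b) \<sigma> \<sigma>'"
    have eq: "?i = ?n \<longleftrightarrow> ?s = ?t"
      using p by (auto intro!: nth_equalityI simp: le_less)
    have tk: "take ?i ?s = take ?i ?t" using p by (intro nth_equalityI) auto
    have lt: "?i < ?n \<and> snd \<sigma> b ?i \<longleftrightarrow> ?s < ?t"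
    proof
      assume "?i < ?n \<and> snd \<sigma> b ?i"
      then show "?s < ?t" using p tk by (intro list_less_nthI[of ?i]) (auto simp: bits_nth)
    next
      assume hstate: "?s < ?t"
      then have "?i < ?n" using eq p by (auto simp: le_less)
      moreover have "snd \<sigma> b ?i"
      proof (rule ccontr)
        assume "\<not> snd \<sigma> b ?i"
        then have "?t < ?s" using p tk \<open>?i < ?n\<close> by (intro list_less_nthI[of ?i]) (auto simp: bits_nth)
        then show False using hstate by simp
      qed
      ultimately show "?i < ?n \<and> snd \<sigma> b ?i" by simp
    qed
    show "Q \<sigma>'" using Q[OF f eq _ lt] eq p by (auto simp: le_less)
  qed
qed

definition FIND :: "bool \<Rightarrow> nat \<Rightarrow> hexp \<Rightarrow> hcmd" where
  "FIND b a e = Asg 15 e;; Loop (Mul (Lt (Var 15) (Var 0)) (Equ (Bit a (Var 15)) (Cst (of_bool (\<not> b)))))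
     (Asg 15 (Add (Var 15) (Cst 1)))"

lemma mods_FIND [simp]: "mod_vars (FIND b a e) = {15}" "mod_arrays (FIND b a e) = {}" "wf_cmd (FIND b a e) \<longleftrightarrow> a < 12 \<and> wf_ex e"
  by (auto simp: FIND_def)

lemma wp_FIND:
  assumes e: "eval_ex \<sigma> e \<le> fst \<sigma> 0"
    and Q: "\<And>\<sigma>'. frame (FIND b a e) \<sigma> \<sigma>' \<Longrightarrow> fst \<sigma>' 15 = next_index b (bits \<sigma> a) (eval_ex \<sigma> e) \<Longrightarrow> Q \<sigma>'"
  shows "wp (FIND b a e) Q \<sigma>"
proof (rule wp_pos)
  assume n: "0 < fst \<sigma> 0"
  let ?s = "bits \<sigma> a" and ?n = "fst \<sigma> 0" and ?e = "eval_ex \<sigma> e"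
  let ?I = "\<lambda>\<sigma>'. ?e \<le> fst \<sigma>' 15 \<and> fst \<sigma>' 15 \<le> ?n \<and> (\<forall>l. ?e \<le> l \<longrightarrow> l < fst \<sigma>' 15 \<longrightarrow> ?s ! l \<noteq> b)"
  have "wp (FIND b a e) (\<lambda>\<sigma>'. fst \<sigma>' 15 = next_index b ?s ?e) \<sigma>"
    unfolding FIND_def
  proof (intro wp_Seq wp_Asg, rule wp_Loop[where Inv = ?I and \<mu> = "\<lambda>\<sigma>'. fst \<sigma>' 0 - fst \<sigma>' 15"], goal_cases)
    case 2
    show ?case using e n by auto
  next
    case (4 \<sigma>')
    have fn: "fst \<sigma>' 0 = ?n" using frame_size[OF 4(1)] by auto
    have fb: "bits \<sigma>' a = ?s" using frame_bits[OF 4(1)] by auto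
    have i: "fst \<sigma>' 15 < ?n" using 4(3) fn by (auto split: if_splits)
    have "?s ! fst \<sigma>' 15 \<noteq> b" using 4(3) fn fb i
      by (auto simp: eval_Bit of_bool_def simp del: eval_ex.simps(3) split: if_splits)
    then show ?case using 4(2) fn i by (auto simp: less_Suc_eq)
  next
    case (5 \<sigma>')
    have fn: "fst \<sigma>' 0 = ?n" using frame_size[OF 5(1)] by auto
    have fb: "bits \<sigma>' a = ?s" using frame_bits[OF 5(1)] by auto
    have "fst \<sigma>' 15 < ?n \<Longrightarrow> ?s ! fst \<sigma>' 15 = b" using 5(3) fn fb by (auto simp: eval_Bit of_bool_def simp del: eval_ex.simps(3) split: if_splits)
    then show ?case using 5(2) by (intro next_index_eqI[symmetric]) auto
  qed simp_all
  then show "wp (FIND b a e) Q \<sigma>" by (rule wp_frame) (intro Q)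
qed

subsection \<open>Period and longest run_straight\<close>

text \<open>As the string is a necklace, a mismatch after \<open>k\<close> letters rules out all periods from \<open>j\<close> to \<open>j + k\<close>.\<close>

definition PER :: "nat \<Rightarrow> hcmd" where
  "PER a = Asg 15 (Cst 1);; Asg 16 (Cst 0);; Loop (Lt (Var 16) (Var 0))
     (Cond (Equ (Bit a (Var 16)) (Bit a (wrap (Add (Var 15) (Var 16)))))
       (Asg 16 (Add (Var 16) (Cst 1)))
       (Asg 15 (Add (Add (Var 15) (Var 16)) (Cst 1));; Asg 16 (Cst 0)))"

lemma mods_PER [simp]: "mod_vars (PER a) = {15, 16}" "mod_arrays (PER a) = {}" "wf_cmd (PER a) \<longleftrightarrow> a < 12"
  by (auto simp: PER_def wrap_def)

definition per_inv :: "bool list \<Rightarrow> nat \<Rightarrow> nat \<Rightarrow> bool" where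
  "per_inv s j k \<longleftrightarrow> 0 < j \<and> j \<le> length s \<and> k \<le> length s \<and> (\<forall>l<k. s ! l = s ! ((j + l) mod length s)) \<and>
     (\<forall>q. 0 < q \<longrightarrow> q < j \<longrightarrow> rotate q s \<noteq> s)"

text \<open>In a necklace the mismatch must be \<open>0\<close> at \<open>k\<close> against
  \<open>1\<close> at \<open>j + k\<close>, as otherwise rotation by \<open>j\<close> would be
  smaller. A period \<open>x\<close> from \<open>j\<close> to \<open>j + k\<close> would then put
  rotation by \<open>x - j\<close> below \<open>s\<close>. As the length itself is a period,
  \<open>j + k\<close> stays below it.\<close>

lemma per_neq:
  assumes "per_inv s j k" "k < length s" "s ! k \<noteq> s ! ((j + k) mod length s)" "necklace_of s = s"
  shows "per_inv s (j + k + 1) 0"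
proof -
  have nl: "\<not> rotate d s < s" for d using necklace_of_le_rotate[of d s] assms(4) by simp
  have ag: "s ! ((0 + l) mod length s) = s ! ((j + l) mod length s)" if "l < k" for l
    using assms(1,2) that by (simp add: per_inv_def)
  have "\<not> (s ! k \<and> \<not> s ! ((j + k) mod length s))"
  proof
    assume "s ! k \<and> \<not> s ! ((j + k) mod length s)"
    then have "rotate (j + 0) s < rotate (0 + 0) s"
      using assms(2) ag by (intro rotate_less_skip[of s "length s" k]) auto
    then show False using nl by simp
  qed
  then have k: "\<not> s ! k" "s ! ((j + k) mod length s)" using assms(3) by auto
  have sk: "rotate x s \<noteq> s" if "j \<le> x" "x \<le> j + k" for x
  proof -
    have "rotate (0 + (x - j)) s < rotate (j + (x - j)) s"
      using assms(2) ag k that by (intro rotate_less_skip[of s "length s" k]) auto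
    then show ?thesis using nl[of "x - j"] that by auto
  qed
  have "j + k < length s"
  proof (rule ccontr)
    assume "\<not> j + k < length s"
    then have "rotate (length s) s \<noteq> s" using assms(1) by (intro sk) (auto simp: per_inv_def)
    then show False by (simp add: rotate_conv_mod)
  qed
  moreover have "rotate q s \<noteq> s" if "0 < q" "q < j + k + 1" for q
    using assms(1) sk[of q] that by (cases "q < j") (auto simp: per_inv_def)
  ultimately show ?thesis by (simp add: per_inv_def)
qed

lemma wp_PER:
  assumes nk: "necklace_of (bits \<sigma> a) = bits \<sigma> a"
    and Q: "\<And>\<sigma>'. frame (PER a) \<sigma> \<sigma>' \<Longrightarrow> 0 < fst \<sigma>' 15 \<Longrightarrow> rotate (fst \<sigma>' 15) (bits \<sigma> a) = bits \<sigma> a \<Longrightarrow>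
      fst \<sigma>' 15 \<le> fst \<sigma> 0 \<Longrightarrow> (\<And>q. 0 < q \<Longrightarrow> q < fst \<sigma>' 15 \<Longrightarrow> rotate q (bits \<sigma> a) \<noteq> bits \<sigma> a) \<Longrightarrow> Q \<sigma>'"
  shows "wp (PER a) Q \<sigma>"
proof (rule wp_pos)
  assume n: "0 < fst \<sigma> 0"
  let ?s = "bits \<sigma> a" and ?n = "fst \<sigma> 0"
  let ?I = "\<lambda>\<sigma>'. per_inv ?s (fst \<sigma>' 15) (fst \<sigma>' 16)"
  have "wp (PER a) (\<lambda>\<sigma>'. per_inv ?s (fst \<sigma>' 15) ?n) \<sigma>"
    unfolding PER_def
  proof (intro wp_Seq wp_Asg, rule wp_Loop[where Inv = ?I and \<mu> = "\<lambda>\<sigma>'. 2 * fst \<sigma>' 0 + 1 - (fst \<sigma>' 15 + fst \<sigma>' 16)"], goal_cases)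
    case 2
    show ?case using n by (auto simp: per_inv_def Suc_leI)
  next
    case 3
    show ?case using n by simp
  next
    case (4 \<sigma>')
    have fn: "fst \<sigma>' 0 = ?n" using frame_size[OF 4(1)] by auto
    have fb: "bits \<sigma>' a = ?s" using frame_bits[OF 4(1)] by auto
    let ?j = "fst \<sigma>' 15" and ?k = "fst \<sigma>' 16"
    have k: "?k < ?n" using 4(3) fn by simp
    have j: "?j \<le> ?n" using 4(2) by (simp add: per_inv_def)
    have b1: "eval_ex \<sigma>' (Bit a (wrap (Add (Var 15) (Var 16)))) = of_bool (?s ! ((?j + ?k) mod ?n))"
      using fb fn j k by (subst eval_Bit_wrap) auto
    have b2: "eval_ex \<sigma>' (Bit a (Var 16)) = of_bool (?s ! ?k)" using fb fn k by (subst eval_Bit) auto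
    show ?case
    proof (cases "?s ! ?k = ?s ! ((?j + ?k) mod ?n)")
      case True
      then have "per_inv ?s ?j (Suc ?k)" using 4(2) k by (auto simp: per_inv_def less_Suc_eq)
      then show ?thesis using True b1 b2 fn k j by (simp del: eval_ex.simps(3))
    next
      case False
      then have p: "per_inv ?s (?j + ?k + 1) 0" using per_neq[OF 4(2) _ _ nk] k by simp
      then have "?j + ?k + 1 \<le> ?n" by (simp add: per_inv_def)
      then show ?thesis using p False b1 b2 fn k j by (simp del: eval_ex.simps(3))
    qed
  next
    case (5 \<sigma>')
    have fn: "fst \<sigma>' 0 = ?n" using frame_size[OF 5(1)] by auto
    have "fst \<sigma>' 16 = ?n" using 5(2,3) fn by (simp add: per_inv_def)
    then show ?case using 5(2) by simp
  qed simp_all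
  then show "wp (PER a) Q \<sigma>"
  proof (rule wp_frame)
    fix \<sigma>' assume p: "per_inv ?s (fst \<sigma>' 15) ?n" and f: "frame (PER a) \<sigma> \<sigma>'"
    have "?s ! i = ?s ! ((fst \<sigma>' 15 + i) mod length ?s)" if "i < length ?s" for i
      using p that unfolding per_inv_def length_bits by blast
    then have "rotate (fst \<sigma>' 15) ?s ! i = ?s ! i" if "i < length ?s" for i
      using that nth_rotate'[OF that] by metis
    then have "rotate (fst \<sigma>' 15) ?s = ?s" by (intro nth_equalityI) simp_all
    moreover have "0 < fst \<sigma>' 15" "fst \<sigma>' 15 \<le> ?n" "\<And>q. 0 < q \<Longrightarrow> q < fst \<sigma>' 15 \<Longrightarrow> rotate q ?s \<noteq> ?s"
      using p unfolding per_inv_def length_bits by blast+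
    ultimately show "Q \<sigma>'" using f Q by blast
  qed
qed

definition MAXRUN :: hcmd where
  "MAXRUN = Asg 15 (Var 6);; Asg 16 (Cst 0);; Asg 7 (Cst 0);; Loop (Lt (Var 15) (Var 0))
     (Cond (Bit 2 (Var 15)) (Asg 16 (Cst 0))
        (Asg 16 (Add (Var 16) (Cst 1));; Cond (Lt (Var 7) (Var 16)) (Asg 7 (Var 16)) Nop);;
      Asg 15 (Add (Var 15) (Cst 1)))"

lemma mods_MAXRUN [simp]: "mod_vars MAXRUN = {15, 16, 7}" "mod_arrays MAXRUN = {}" "wf_cmd MAXRUN"
  by (auto simp: MAXRUN_def)

text \<open>\<open>c\<close> is the length of the zero run that ends just before \<open>i\<close>,
  and \<open>M\<close> that of the longest one so far; runs are cut off at \<open>z\<close>, where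
  the leading block ends.\<close>

definition run_inv :: "bool list \<Rightarrow> nat \<Rightarrow> nat \<Rightarrow> nat \<Rightarrow> nat \<Rightarrow> bool" where
  "run_inv s z i c M \<longleftrightarrow> z \<le> i \<and> i \<le> length s \<and> z + c \<le> i \<and> c \<le> M \<and> M \<le> i \<and> (\<forall>j<c. \<not> s ! (i - c + j)) \<and>
     (z + c = i \<or> s ! (i - c - 1)) \<and>
     (\<exists>b. z \<le> b \<and> b + M \<le> i \<and> (\<forall>j<M. \<not> s ! (b + j))) \<and>
     (\<forall>b m. z \<le> b \<longrightarrow> b + m \<le> i \<longrightarrow> (\<forall>j<m. \<not> s ! (b + j)) \<longrightarrow> m \<le> M)"

lemma run_one:
  assumes "run_inv s z i c M" "i < length s" "s ! i"
  shows "run_inv s z (Suc i) 0 M"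
proof -
  have "m \<le> M" if "z \<le> b" "b + m \<le> Suc i" "\<forall>j<m. \<not> s ! (b + j)" for b m
  proof (cases "b + m = Suc i")
    case True
    show ?thesis
    proof (cases m)
      case (Suc m')
      then have "b + m' = i" using True by simp
      then show ?thesis using that(3) Suc assms(3) by auto
    qed simp
  next
    case False
    then show ?thesis using assms(1) that unfolding run_inv_def by (meson le_SucE)
  qed
  then show ?thesis using assms unfolding run_inv_def by (auto intro: le_SucI)
qed

text \<open>A run that ends at \<open>i\<close> is no longer than \<open>c + 1\<close>, because
  these zeros are preceded by a \<open>1\<close> or start at the cut-off \<open>z\<close>.\<close>

lemma run_zero:
  assumes "run_inv s z i c M" "i < length s" "\<not> s ! i"
  shows "run_inv s z (Suc i) (Suc c) (max M (Suc c))"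
proof -
  have zc: "z + c \<le> i" "\<forall>j<c. \<not> s ! (i - c + j)" "z + c = i \<or> s ! (i - c - 1)" using assms(1) by (auto simp: run_inv_def)
  have new: "\<not> s ! (i - c + j)" if "j < Suc c" for j
    using that zc assms(3) by (cases "j = c") auto
  have "m \<le> max M (Suc c)" if b: "z \<le> b" "b + m \<le> Suc i" "\<forall>j<m. \<not> s ! (b + j)" for b m
  proof (cases "b + m = Suc i")
    case True
    have "m \<le> Suc c"
    proof (rule ccontr)
      assume "\<not> m \<le> Suc c"
      then have "b + 1 + c \<le> i" using True by simp
      moreover from this have "z + c \<noteq> i" using b(1) by simp
      ultimately have "s ! (i - c - 1)" "b \<le> i - c - 1" using zc by auto
      moreover have "i - c - 1 - b < m" using True \<open>\<not> m \<le> Suc c\<close> by simp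
      ultimately show False using b(3) by (metis le_add_diff_inverse)
    qed
    then show ?thesis by simp
  next
    case False
    then have "b + m \<le> i" using b(2) by simp
    then have "m \<le> M" using assms(1) b unfolding run_inv_def by blast
    then show ?thesis by simp
  qed
  moreover have "\<exists>b. z \<le> b \<and> b + max M (Suc c) \<le> Suc i \<and> (\<forall>j<max M (Suc c). \<not> s ! (b + j))"
  proof (cases "M < Suc c")
    case True
    then show ?thesis using new zc by (intro exI[of _ "i - c"]) (auto simp: max_def)
  next
    case False
    then have "max M (Suc c) = M" by simp
    moreover obtain b where "z \<le> b" "b + M \<le> i" "\<forall>j<M. \<not> s ! (b + j)" using assms(1) by (auto simp: run_inv_def)
    ultimately show ?thesis by (metis le_SucI)
  qed
  moreover have "\<not> s ! (Suc i - Suc c + j)" if "j < Suc c" for j using new[OF that] by simp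
  moreover have "z + Suc c = Suc i \<or> s ! (Suc i - Suc c - 1)" using zc by simp
  moreover have "z \<le> Suc i" "Suc i \<le> length s" "z + Suc c \<le> Suc i" "max M (Suc c) \<le> Suc i"
    using assms by (auto simp: run_inv_def)
  ultimately show ?thesis unfolding run_inv_def by simp
qed

lemma run_exit:
  assumes "run_inv s z (length s) c M"
  shows "max_run (drop z s) M"
  unfolding max_run_def
proof (intro conjI allI impI)
  have zl: "z \<le> length s" using assms by (simp add: run_inv_def)
  fix b m assume bm: "b + m \<le> length (drop z s)" "\<forall>j<m. \<not> drop z s ! (b + j)"
  have "\<not> s ! ((z + b) + j)" if "j < m" for j using bm zl that by (simp add: add.assoc)
  moreover have "(z + b) + m \<le> length s" using bm zl by simp
  ultimately show "m \<le> M" using assms unfolding run_inv_def by (meson le_add1)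
next
  have zl: "z \<le> length s" using assms by (simp add: run_inv_def)
  obtain b where b: "z \<le> b" "b + M \<le> length s" "\<forall>j<M. \<not> s ! (b + j)" using assms by (auto simp: run_inv_def)
  have "\<not> drop z s ! (b - z + j)" if "j < M" for j using b that zl by simp
  then show "\<exists>b. b + M \<le> length (drop z s) \<and> (\<forall>j<M. \<not> drop z s ! (b + j))"
    using b by (intro exI[of _ "b - z"]) auto
qed

lemma wp_MAXRUN:
  assumes z: "fst \<sigma> 6 \<le> fst \<sigma> 0"
    and Q: "\<And>\<sigma>'. frame MAXRUN \<sigma> \<sigma>' \<Longrightarrow> max_run (drop (fst \<sigma> 6) (bits \<sigma> 2)) (fst \<sigma>' 7) \<Longrightarrow> fst \<sigma>' 7 \<le> fst \<sigma> 0 \<Longrightarrow> Q \<sigma>'"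
  shows "wp MAXRUN Q \<sigma>"
proof (rule wp_pos)
  assume n: "0 < fst \<sigma> 0"
  let ?s = "bits \<sigma> 2" and ?n = "fst \<sigma> 0" and ?z = "fst \<sigma> 6"
  let ?I = "\<lambda>\<sigma>'. run_inv ?s ?z (fst \<sigma>' 15) (fst \<sigma>' 16) (fst \<sigma>' 7)"
  have "wp MAXRUN (\<lambda>\<sigma>'. max_run (drop ?z ?s) (fst \<sigma>' 7) \<and> fst \<sigma>' 7 \<le> ?n) \<sigma>"
    unfolding MAXRUN_def
  proof (intro wp_Seq wp_Asg, rule wp_Loop[where Inv = ?I and \<mu> = "\<lambda>\<sigma>'. fst \<sigma>' 0 - fst \<sigma>' 15"], goal_cases)
    case 2
    show ?case using n z by (auto simp: run_inv_def)
  next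
    case (4 \<sigma>')
    have fn: "fst \<sigma>' 0 = ?n" using frame_size[OF 4(1)] by auto
    have fb: "bits \<sigma>' 2 = ?s" using frame_bits[OF 4(1)] by auto
    let ?i = "fst \<sigma>' 15" and ?c = "fst \<sigma>' 16" and ?M = "fst \<sigma>' 7"
    have i: "?i < ?n" using 4(3) fn by simp
    have c: "?c \<le> ?i" "?M \<le> ?i" using 4(2) by (auto simp: run_inv_def)
    have b: "eval_ex \<sigma>' (Bit 2 (Var 15)) = of_bool (?s ! ?i)" using fb fn i by (subst eval_Bit) auto
    show ?case
    proof (cases "?s ! ?i")
      case True
      then show ?thesis using run_one[OF 4(2)] b fn i by (simp del: eval_ex.simps(3))
    next
      case False
      then show ?thesis using run_zero[OF 4(2)] b fn i c by (auto simp: max_def simp del: eval_ex.simps(3))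
    qed
  next
    case (5 \<sigma>')
    have fn: "fst \<sigma>' 0 = ?n" using frame_size[OF 5(1)] by auto
    have "fst \<sigma>' 15 = ?n" using 5(2,3) fn by (simp add: run_inv_def)
    then have r: "run_inv ?s ?z (length ?s) (fst \<sigma>' 16) (fst \<sigma>' 7)" using 5(2) by simp
    then have "fst \<sigma>' 7 \<le> length ?s" unfolding run_inv_def by blast
    then show ?case using run_exit[OF r] by simp
  qed simp_all
  then show "wp MAXRUN Q \<sigma>" by (rule wp_frame) (intro Q; simp)
qed

lemma frame_all: "frame c \<sigma> \<sigma>' \<Longrightarrow> fst \<sigma>' 0 = fst \<sigma> 0 \<and> (\<forall>x. x \<notin> mod_vars c \<longrightarrow> fst \<sigma>' x = fst \<sigma> x) \<and>
    (\<forall>j. j \<notin> mod_arrays c \<longrightarrow> bits \<sigma>' j = bits \<sigma> j)"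
  by (auto simp: frame_var frame_size frame_bits)

subsection \<open>Membership and parent\<close>

definition ISA :: "nat \<Rightarrow> hcmd" where
  "ISA a = NECK a 5;; CMP a 5;; Asg 19 (Equ (Var 15) (Var 0));; REV a 6;; NECK 6 7;; CMP a 7;;
     Asg 19 (Mul (Var 19) (Mul (Lt (Var 15) (Var 0)) (Bit 7 (Var 15))))"

lemma mods_ISA [simp]: "mod_vars (ISA a) = {14, 15, 16, 17, 18, 19}" "mod_arrays (ISA a) = {5, 6, 7}" "wf_cmd (ISA a) \<longleftrightarrow> a < 12"
  by (auto simp: ISA_def)

lemma wp_ISA:
  assumes a: "a \<noteq> 5" "a \<noteq> 6" "a \<noteq> 7"
    and Q: "\<And>\<sigma>'. frame (ISA a) \<sigma> \<sigma>' \<Longrightarrow> fst \<sigma>' 19 = of_bool (bits \<sigma> a \<in> asym_bracelets (fst \<sigma> 0)) \<Longrightarrow> Q \<sigma>'"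
  shows "wp (ISA a) Q \<sigma>"
proof (rule wp_pos)
  assume n: "0 < fst \<sigma> 0"
  have "wp (ISA a) (\<lambda>\<sigma>'. fst \<sigma>' 19 = of_bool (bits \<sigma> a \<in> asym_bracelets (fst \<sigma> 0))) \<sigma>"
    unfolding ISA_def
    apply (rule wp_Seq, rule wp_NECK, simp add: a)
    subgoal premises p1 for \<sigma>1
      apply (rule wp_Seq, rule wp_CMP)
      subgoal premises p2 for \<sigma>2
        apply (rule wp_Seq, rule wp_Asg, rule wp_Seq, rule wp_REV, simp add: a)
        subgoal premises p3 for \<sigma>3
          apply (rule wp_Seq, rule wp_NECK, simp)
          subgoal premises p4 for \<sigma>4
            apply (rule wp_Seq, rule wp_CMP)
            subgoal premises p5 for \<sigma>5
              apply (rule wp_Asg)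
              using a n p1(2) p2(2) p3(2) p4(2) p5(4) frame_all[OF p1(1)] frame_all[OF p2(1)] frame_all[OF p3(1)] frame_all[OF p4(1)] frame_all[OF p5(1)]
                frame_array[OF p5(1), of 7]
              by (auto simp: asym_bracelets_iff)
            done
          done
        done
      done
    done
  then show "wp (ISA a) Q \<sigma>" by (rule wp_frame) (intro Q)
qed

text \<open>Besides the parent in array \<open>4\<close>, the changed position is left in scalar
  \<open>20\<close>; from it the change index is recomputed on the way up.\<close>

definition PAR :: "nat \<Rightarrow> hcmd" where
  "PAR a = FIND True a (Cst 0);; Asg 20 (Var 15);; COPY a 4;; Put 4 (Var 20) (Cst 0);; ISA 4;;
     Cond (Var 19) Nop
       (COPY a 8;; Put 8 (Sub (Var 0) (Cst 1)) (Cst 0);; NECK 8 4;; Asg 20 (Sub (Var 0) (Cst 1));; ISA 4;;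
        Cond (Var 19) Nop
          (REV a 8;; FIND False 8 (Cst 0);; Asg 20 (Sub (Sub (Var 0) (Cst 1)) (Var 15));;
           COPY a 4;; Put 4 (Var 20) (Cst 1)))"

lemma mods_PAR [simp]: "mod_vars (PAR a) = {14, 15, 16, 17, 18, 19, 20}" "mod_arrays (PAR a) = {4, 5, 6, 7, 8}"
    "wf_cmd (PAR a) \<longleftrightarrow> a < 12"
  by (auto simp: PAR_def)

lemma next_index_less: "b \<in> set (drop p l) \<Longrightarrow> next_index b l p < length l"
proof -
  assume b: "b \<in> set (drop p l)"
  have "length (takeWhile (\<lambda>x. x \<noteq> b) (drop p l)) < length (drop p l)"
  proof (rule ccontr)
    assume "\<not> ?thesis"
    then have "takeWhile (\<lambda>x. x \<noteq> b) (drop p l) = drop p l"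
      by (metis length_takeWhile_le nat_less_le takeWhile_eq_take take_all_iff)
    then show False using b by (metis (mono_tags, lifting) set_takeWhileD)
  qed
  then show ?thesis by (simp add: next_index_def)
qed

lemma first_one_next_index: "first_one \<gamma> = \<gamma>[next_index True \<gamma> 0 := False]"
proof -
  have "Not = (\<lambda>x. x \<noteq> True)" by auto
  then show ?thesis by (simp add: first_one_def next_index_def)
qed

lemma list_update_last: "xs \<noteq> [] \<Longrightarrow> xs[length xs - Suc 0 := x] = butlast xs @ [x]"
  by (induction xs rule: rev_induct) auto

lemma last_zero_next_index:
  assumes "next_index False (rev \<gamma>) 0 < length \<gamma>"
  shows "last_zero \<gamma> = \<gamma>[length \<gamma> - 1 - next_index False (rev \<gamma>) 0 := True]"
proof -
  have "id = (\<lambda>x. x \<noteq> False)" by auto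
  then show ?thesis using assms by (simp add: last_zero_def next_index_def rev_update)
qed

lemma asym_next_index:
  assumes "\<gamma> \<in> asym_bracelets n" "0 < n"
  shows "next_index True \<gamma> 0 < n" "next_index False (rev \<gamma>) 0 < n" "next_index True \<gamma> (next_index True \<gamma> 0 + 1) < n" "\<gamma> \<noteq> []"
proof -
  obtain i s r u where g: "\<gamma> = replicate i False @ True # replicate s False @ True # replicate r False @ True # u"
    and f: "False \<in> set (replicate s False @ True # replicate r False @ True # u)"
    using asym_shape[OF assms] by metis
  have n: "length \<gamma> = n" using asym_braceletsD[OF assms(1)] by simp
  show "next_index True \<gamma> 0 < n" using next_index_less[of True 0 \<gamma>] n by (simp add: g)
  have "False \<in> set \<gamma>" using f by (auto simp: g)
  then show "next_index False (rev \<gamma>) 0 < n" using next_index_less[of False 0 "rev \<gamma>"] n by simp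
  have "next_index True \<gamma> 0 = i" by (subst next_index_zeros[of _ _ i]) (auto simp: g)
  then show "next_index True \<gamma> (next_index True \<gamma> 0 + 1) < n" using next_index_less[of True "i + 1" \<gamma>] n by (simp add: g)
  show "\<gamma> \<noteq> []" by (simp add: g)
qed

lemma wp_PAR:
  assumes a: "a \<notin> {4, 5, 6, 7, 8}" and A: "bits \<sigma> a \<in> asym_bracelets (fst \<sigma> 0)"
    and Q: "\<And>\<sigma>'. frame (PAR a) \<sigma> \<sigma>' \<Longrightarrow> bits \<sigma>' 4 = par (fst \<sigma> 0) (bits \<sigma> a) \<Longrightarrow>
      fst \<sigma>' 20 = par_pos (fst \<sigma> 0) (bits \<sigma> a) \<Longrightarrow> Q \<sigma>'"
  shows "wp (PAR a) Q \<sigma>"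
proof (rule wp_pos)
  let ?n = "fst \<sigma> 0" and ?g = "bits \<sigma> a"
  assume n: "0 < fst \<sigma> 0"
  note F = asym_next_index[OF A n]
  have "wp (PAR a) (\<lambda>\<sigma>'. bits \<sigma>' 4 = par ?n ?g \<and> fst \<sigma>' 20 = par_pos ?n ?g) \<sigma>"
    unfolding PAR_def
    apply (rule wp_Seq, rule wp_FIND, simp)
    subgoal premises p1 for \<sigma>1
      apply (rule wp_Seq, rule wp_Asg, rule wp_Seq, rule wp_COPY)
      using a apply simp
      subgoal premises p2 for \<sigma>2
        apply (rule wp_Seq, rule wp_Put, rule wp_Seq, rule wp_ISA)
        apply simp_all[3]
        subgoal premises p3 for \<sigma>3
        proof -
          let ?\<tau> = "put_bit 4 (eval_ex \<sigma>2 (Var 20)) (eval_ex \<sigma>2 (Cst 0)) \<sigma>2"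
          have v20: "fst \<sigma>2 20 = next_index True ?g 0" "fst \<sigma>2 0 = ?n"
            using frame_all[OF p1(1)] frame_all[OF p2(1)] p1(2) F(1) by auto
          have b4: "bits ?\<tau> 4 = first_one ?g"
            using v20 F(1) p2(2) frame_all[OF p1(1)] a by (simp add: bits_put_bit first_one_next_index)
          have ba: "bits ?\<tau> a = ?g" using v20 F(1) frame_all[OF p1(1)] frame_all[OF p2(1)] a by (simp add: bits_put_bit)
          have 3: "bits \<sigma>3 4 = first_one ?g" "bits \<sigma>3 a = ?g" "fst \<sigma>3 0 = ?n" "fst \<sigma>3 20 = next_index True ?g 0"
            "fst \<sigma>3 19 = of_bool (first_one ?g \<in> asym_bracelets ?n)"
            using b4 ba frame_all[OF p3(1)] a v20 p3(2) by auto
          show ?thesis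
          proof (rule wp_Cond)
            assume "eval_ex \<sigma>3 (Var 19) \<noteq> 0"
            then show "wp Nop (\<lambda>\<sigma>'. bits \<sigma>' 4 = par ?n ?g \<and> fst \<sigma>' 20 = par_pos ?n ?g) \<sigma>3"
              using 3 by (intro wp_Nop) (auto simp: par_def par_pos_def)
          next
            assume "eval_ex \<sigma>3 (Var 19) = 0"
            then have nf: "first_one ?g \<notin> asym_bracelets ?n" using 3 by simp
            show "wp (COPY a 8;; Put 8 (Sub (Var 0) (Cst 1)) (Cst 0);; NECK 8 4;; Asg 20 (Sub (Var 0) (Cst 1));; ISA 4;;
              Cond (Var 19) Nop
                (REV a 8;; FIND False 8 (Cst 0);; Asg 20 (Sub (Sub (Var 0) (Cst 1)) (Var 15));;
                 COPY a 4;; Put 4 (Var 20) (Cst 1)))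
              (\<lambda>\<sigma>'. bits \<sigma>' 4 = par ?n ?g \<and> fst \<sigma>' 20 = par_pos ?n ?g) \<sigma>3"
              apply (rule wp_Seq, rule wp_COPY)
              using a apply simp
              subgoal premises p4 for \<sigma>4
                apply (rule wp_Seq, rule wp_Put, rule wp_Seq, rule wp_NECK, simp)
                subgoal premises p5 for \<sigma>5
                  apply (rule wp_Seq, rule wp_Asg, rule wp_Seq, rule wp_ISA)
                  apply simp_all[3]
                  subgoal premises p6 for \<sigma>6
                  proof -
                    have 4: "fst \<sigma>4 0 = ?n" "bits \<sigma>4 8 = ?g" "bits \<sigma>4 a = ?g"
                      using frame_all[OF p4(1)] 3 a p4(2) by auto
                    have l: "?g[?n - Suc 0 := False] = butlast ?g @ [False]" using list_update_last[OF F(4)] by simp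
                    have 5: "bits \<sigma>5 4 = last_one ?g" "bits \<sigma>5 a = ?g" "fst \<sigma>5 0 = ?n"
                      using frame_all[OF p5(1)] p5(2) 4 n a l by (auto simp: bits_put_bit last_one_def)
                    have 6: "bits \<sigma>6 4 = last_one ?g" "bits \<sigma>6 a = ?g" "fst \<sigma>6 0 = ?n" "fst \<sigma>6 20 = ?n - 1"
                      "fst \<sigma>6 19 = of_bool (last_one ?g \<in> asym_bracelets ?n)"
                      using frame_all[OF p6(1)] p6(2) 5 n a by auto
                    show ?thesis
                    proof (rule wp_Cond)
                      assume "eval_ex \<sigma>6 (Var 19) \<noteq> 0"
                      then show "wp Nop (\<lambda>\<sigma>'. bits \<sigma>' 4 = par ?n ?g \<and> fst \<sigma>' 20 = par_pos ?n ?g) \<sigma>6"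
                        using 6 nf by (intro wp_Nop) (auto simp: par_def par_pos_def)
                    next
                      assume "eval_ex \<sigma>6 (Var 19) = 0"
                      then have nl: "last_one ?g \<notin> asym_bracelets ?n" using 6 by simp
                      show "wp (REV a 8;; FIND False 8 (Cst 0);; Asg 20 (Sub (Sub (Var 0) (Cst 1)) (Var 15));;
                         COPY a 4;; Put 4 (Var 20) (Cst 1))
                         (\<lambda>\<sigma>'. bits \<sigma>' 4 = par ?n ?g \<and> fst \<sigma>' 20 = par_pos ?n ?g) \<sigma>6"
                        apply (rule wp_Seq, rule wp_REV)
                        using a apply simp
                        subgoal premises p7 for \<sigma>7
                          apply (rule wp_Seq, rule wp_FIND, simp)
                          subgoal premises p8 for \<sigma>8
                            apply (rule wp_Seq, rule wp_Asg, rule wp_Seq, rule wp_COPY)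
                            using a apply simp
                            subgoal premises p9 for \<sigma>9
                            proof (rule wp_Put)
                              have 8: "fst \<sigma>8 15 = next_index False (rev ?g) 0" "bits \<sigma>8 a = ?g" "fst \<sigma>8 0 = ?n"
                                using frame_all[OF p7(1)] frame_all[OF p8(1)] p7(2) p8(2) 6 a by auto
                              have 9: "bits \<sigma>9 4 = ?g" "fst \<sigma>9 0 = ?n" "fst \<sigma>9 20 = ?n - 1 - next_index False (rev ?g) 0"
                                using frame_all[OF p9(1)] p9(2) 8 n by auto
                              show "bits (put_bit 4 (eval_ex \<sigma>9 (Var 20)) (eval_ex \<sigma>9 (Cst 1)) \<sigma>9) 4 = par ?n ?g \<and>
                                 fst (put_bit 4 (eval_ex \<sigma>9 (Var 20)) (eval_ex \<sigma>9 (Cst 1)) \<sigma>9) 20 = par_pos ?n ?g"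
                                using 9 n nf nl last_zero_next_index[of ?g] F(2) by (simp add: bits_put_bit par_def par_pos_def)
                            qed
                            done
                          done
                        done
                    qed
                  qed
                  done
                done
              done
          qed
        qed
        done
      done
    done
  then show "wp (PAR a) Q \<sigma>" by (rule wp_frame) (intro Q; simp)
qed

subsection \<open>The child test\<close>

text \<open>The parent rule is run only after membership has been confirmed, since its searches rely
  on the shape of an asymmetric bracelet.\<close>

definition CHILD :: hcmd where
  "CHILD = COPY 0 8;; Put 8 (Sub (Var 2) (Cst 1)) (Sub (Cst 1) (Bit 0 (Sub (Var 2) (Cst 1))));; NECK 8 3;;
     ISA 3;; CMP 3 1;; Asg 21 (Mul (Var 19) (Lt (Var 15) (Var 0)));;
     Cond (Var 21) (PAR 3;; CMP 4 2;; Asg 21 (Equ (Var 15) (Var 0))) Nop"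

lemma mods_CHILD [simp]: "mod_vars CHILD = {14, 15, 16, 17, 18, 19, 20, 21}" "mod_arrays CHILD = {3, 4, 5, 6, 7, 8}" "wf_cmd CHILD"
  by (auto simp: CHILD_def)

lemma wp_CHILD:
  assumes k: "1 \<le> fst \<sigma> 2" "fst \<sigma> 2 \<le> fst \<sigma> 0" and R: "bits \<sigma> 1 = root_label (fst \<sigma> 0)"
    and B: "bits \<sigma> 2 = necklace_of (bits \<sigma> 0)"
    and Q: "\<And>\<sigma>'. frame CHILD \<sigma> \<sigma>' \<Longrightarrow> fst \<sigma>' 21 = of_bool
        (necklace_of (flip (bits \<sigma> 0) (fst \<sigma> 2)) \<in> asym_bracelets (fst \<sigma> 0) - {root_label (fst \<sigma> 0)} \<and>
         par (fst \<sigma> 0) (necklace_of (flip (bits \<sigma> 0) (fst \<sigma> 2))) = necklace_of (bits \<sigma> 0)) \<Longrightarrow> Q \<sigma>'"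
  shows "wp CHILD Q \<sigma>"
proof (rule wp_pos)
  let ?n = "fst \<sigma> 0" and ?a = "bits \<sigma> 0" and ?k = "fst \<sigma> 2"
  let ?g = "necklace_of (flip (bits \<sigma> 0) (fst \<sigma> 2))"
  assume n: "0 < fst \<sigma> 0"
  have "wp CHILD (\<lambda>\<sigma>'. fst \<sigma>' 21 = of_bool (?g \<in> asym_bracelets ?n - {root_label ?n} \<and> par ?n ?g = necklace_of ?a)) \<sigma>"
    unfolding CHILD_def
    apply (rule wp_Seq, rule wp_COPY, simp)
    subgoal premises p1 for \<sigma>1
      apply (rule wp_Seq, rule wp_Put, rule wp_Seq, rule wp_NECK, simp)
      subgoal premises p2 for \<sigma>2
        apply (rule wp_Seq, rule wp_ISA)
        apply simp_all[3]
        subgoal premises p3 for \<sigma>3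
          apply (rule wp_Seq, rule wp_CMP)
          subgoal premises p4 for \<sigma>4
          proof (rule wp_Seq, rule wp_Asg)
            let ?\<tau> = "assign 21 (eval_ex \<sigma>4 (Mul (Var 19) (Lt (Var 15) (Var 0)))) \<sigma>4"
            have 1: "fst \<sigma>1 0 = ?n" "fst \<sigma>1 2 = ?k" "bits \<sigma>1 0 = ?a" "bits \<sigma>1 8 = ?a" "bits \<sigma>1 1 = root_label ?n"
              "bits \<sigma>1 2 = necklace_of ?a"
              using frame_all[OF p1(1)] p1(2) R B by auto
            have "?k - 1 < ?n" using k by simp
            moreover have "snd \<sigma>1 0 (?k - 1) = ?a ! (?k - 1)" using bits_nth[of "?k - 1" \<sigma>1 0] 1 k by simp
            ultimately have b: "bits (put_bit 8 (eval_ex \<sigma>1 (Sub (Var 2) (Cst 1))) (eval_ex \<sigma>1 (Sub (Cst 1) (Bit 0 (Sub (Var 2) (Cst 1))))) \<sigma>1) 8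
                = flip ?a ?k"
              using 1 k by (simp add: bits_put_bit flip_def)
            have b': "bits (put_bit 8 (eval_ex \<sigma>1 (Sub (Var 2) (Cst 1))) (eval_ex \<sigma>1 (Sub (Cst 1) (Bit 0 (Sub (Var 2) (Cst 1))))) \<sigma>1) j
                = bits \<sigma>1 j" if "j \<noteq> 8" for j
              using 1 k that by (simp add: bits_put_bit)
            have 2: "fst \<sigma>2 0 = ?n" "bits \<sigma>2 3 = ?g" "bits \<sigma>2 1 = root_label ?n" "bits \<sigma>2 2 = necklace_of ?a"
              using frame_all[OF p2(1)] p2(2) 1 b b' by auto
            have 3: "fst \<sigma>3 0 = ?n" "bits \<sigma>3 3 = ?g" "bits \<sigma>3 1 = root_label ?n" "bits \<sigma>3 2 = necklace_of ?a"
               "fst \<sigma>3 19 = of_bool (?g \<in> asym_bracelets ?n)"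
              using frame_all[OF p3(1)] p3(2) 2 by auto
            have 4: "fst ?\<tau> 0 = ?n" "bits ?\<tau> 3 = ?g" "bits ?\<tau> 2 = necklace_of ?a"
               "fst ?\<tau> 21 = of_bool (?g \<in> asym_bracelets ?n - {root_label ?n})"
              using frame_all[OF p4(1)] p4(2,3) 3 n by auto
            show "wp (Cond (Var 21) (PAR 3;; CMP 4 2;; Asg 21 (Equ (Var 15) (Var 0))) Nop)
              (\<lambda>\<sigma>'. fst \<sigma>' 21 = of_bool (?g \<in> asym_bracelets ?n - {root_label ?n} \<and> par ?n ?g = necklace_of ?a)) ?\<tau>"
            proof (rule wp_Cond)
              assume "eval_ex ?\<tau> (Var 21) \<noteq> 0"
              then have A: "?g \<in> asym_bracelets ?n - {root_label ?n}" using 4(4) by simp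
              show "wp (PAR 3;; CMP 4 2;; Asg 21 (Equ (Var 15) (Var 0)))
                (\<lambda>\<sigma>'. fst \<sigma>' 21 = of_bool (?g \<in> asym_bracelets ?n - {root_label ?n} \<and> par ?n ?g = necklace_of ?a)) ?\<tau>"
                apply (rule wp_Seq, rule wp_PAR, simp)
                 apply (use 4 A in simp)
                subgoal premises p5 for \<sigma>5
                  apply (rule wp_Seq, rule wp_CMP)
                  subgoal premises p6 for \<sigma>6
                    apply (rule wp_Asg)
                    using frame_all[OF p5(1)] p5(2) frame_all[OF p6(1)] p6(2) 4(1-3) A n by auto
                  done
                done
            next
              assume "eval_ex ?\<tau> (Var 21) = 0"
              then have "?g \<notin> asym_bracelets ?n - {root_label ?n}" using 4(4) by simp
              then show "wp Nop (\<lambda>\<sigma>'. fst \<sigma>' 21 = of_bool (?g \<in> asym_bracelets ?n - {root_label ?n} \<and> par ?n ?g = necklace_of ?a)) ?\<tau>"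
                using 4(4) by (intro wp_Nop) auto
            qed
          qed
          done
        done
      done
    done
  then show "wp CHILD Q \<sigma>" by (rule wp_frame) (intro Q)
qed

subsection \<open>Preparing a node\<close>

definition PREP1 :: hcmd where
  "PREP1 = NECK 0 2;; Asg 4 (Var 14);; PER 2;; Asg 5 (Var 15);; FIND True 2 (Cst 0);; Asg 6 (Var 15);;
     FIND True 2 (Add (Var 6) (Cst 1));; Asg 22 (Var 15)"

definition PREP2 :: hcmd where
  "PREP2 = FIND True 2 (Add (Var 22) (Cst 1));;
     Asg 8 (Sub (Var 15) (Add (Var 22) (Cst 1)));; Asg 9 (Sub (Var 22) (Add (Var 6) (Cst 1)));;
     REV 2 8;; FIND True 8 (Cst 1);; Asg 10 (Sub (Var 15) (Cst 1));;
     FIND False 2 (Var 6);; Asg 11 (Sub (Var 15) (Var 6));; MAXRUN"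

definition PREP3 :: hcmd where
  "PREP3 = CMP 2 1;; Asg 12 (Equ (Var 15) (Var 0));;
     Cond (Var 12) (Asg 13 (Var 0)) (PAR 2;; Asg 13 (Add (wrap (Add (Var 4) (Var 20))) (Cst 1)))"

text \<open>Run after every move, downwards or upwards. Apart from the constant root label and the
  loop flag, the traversal carries only the label, its change index and the scan position from node
  to node.\<close>

definition PREP :: hcmd where
  "PREP = PREP1;; PREP2;; PREP3"

lemma mods_PREP1 [simp]: "mod_vars PREP1 = {4, 5, 6, 14, 15, 16, 17, 18, 22}" "mod_arrays PREP1 = {2}" "wf_cmd PREP1"
  by (auto simp: PREP1_def)

lemma mods_PREP2 [simp]: "mod_vars PREP2 = {7, 8, 9, 10, 11, 15, 16}" "mod_arrays PREP2 = {8}" "wf_cmd PREP2"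
  by (auto simp: PREP2_def)

lemma mods_PREP3 [simp]: "mod_vars PREP3 = {12, 13, 14, 15, 16, 17, 18, 19, 20}" "mod_arrays PREP3 = {4, 5, 6, 7, 8}" "wf_cmd PREP3"
  by (auto simp: PREP3_def wrap_def)

lemma mods_PREP [simp]: "mod_vars PREP = {4, 5, 6, 7, 8, 9, 10, 11, 12, 13, 14, 15, 16, 17, 18, 19, 20, 22}"
    "mod_arrays PREP = {2, 4, 5, 6, 7, 8}" "wf_cmd PREP"
  by (auto simp: PREP_def)

lemma rotate_inject: "rotate d x = rotate d y \<longleftrightarrow> x = y"
  by (metis length_rotate rotate_back)

lemma wp_PREP1:
  assumes A: "necklace_of (bits \<sigma> 0) \<in> asym_bracelets (fst \<sigma> 0)"
    and Q: "\<And>\<sigma>' \<beta>. frame PREP1 \<sigma> \<sigma>' \<Longrightarrow> \<beta> = necklace_of (bits \<sigma> 0) \<Longrightarrow> bits \<sigma>' 2 = \<beta> \<Longrightarrow> fst \<sigma>' 4 < fst \<sigma> 0 \<Longrightarrow>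
      rotate (fst \<sigma>' 4) (bits \<sigma> 0) = \<beta> \<Longrightarrow> 0 < fst \<sigma>' 5 \<Longrightarrow> fst \<sigma>' 5 \<le> fst \<sigma> 0 \<Longrightarrow>
      rotate (fst \<sigma>' 5) (bits \<sigma> 0) = bits \<sigma> 0 \<Longrightarrow>
      (\<And>q. 0 < q \<Longrightarrow> q < fst \<sigma>' 5 \<Longrightarrow> rotate q (bits \<sigma> 0) \<noteq> bits \<sigma> 0) \<Longrightarrow>
      fst \<sigma>' 6 = next_index True \<beta> 0 \<Longrightarrow> fst \<sigma>' 22 = next_index True \<beta> (fst \<sigma>' 6 + 1) \<Longrightarrow> Q \<sigma>'"
  shows "wp PREP1 Q \<sigma>"
proof (rule wp_pos)
  let ?n = "fst \<sigma> 0" and ?a = "bits \<sigma> 0"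
  let ?b = "necklace_of (bits \<sigma> 0)"
  assume n: "0 < fst \<sigma> 0"
  note F = asym_next_index[OF A n]
  have "wp PREP1 (\<lambda>\<sigma>'. bits \<sigma>' 2 = ?b \<and> fst \<sigma>' 4 < ?n \<and> rotate (fst \<sigma>' 4) ?a = ?b \<and> 0 < fst \<sigma>' 5 \<and>
      fst \<sigma>' 5 \<le> ?n \<and> rotate (fst \<sigma>' 5) ?b = ?b \<and> (\<forall>q. 0 < q \<longrightarrow> q < fst \<sigma>' 5 \<longrightarrow> rotate q ?b \<noteq> ?b) \<and>
      fst \<sigma>' 6 = next_index True ?b 0 \<and> fst \<sigma>' 22 = next_index True ?b (fst \<sigma>' 6 + 1)) \<sigma>"
    unfolding PREP1_def
    apply (rule wp_Seq, rule wp_NECK, simp)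
    subgoal premises p1 for \<sigma>1
      apply (rule wp_Seq, rule wp_Asg, rule wp_Seq, rule wp_PER)
       apply (use p1(2) in simp)
      subgoal premises p2 for \<sigma>2
        apply (rule wp_Seq, rule wp_Asg, rule wp_Seq, rule wp_FIND, simp)
        subgoal premises p3 for \<sigma>3
        proof -
          have 1: "fst \<sigma>1 0 = ?n" "bits \<sigma>1 0 = ?a" using frame_all[OF p1(1)] by auto
          have 2: "fst \<sigma>2 0 = ?n" "bits \<sigma>2 2 = ?b" "fst \<sigma>2 4 = fst \<sigma>1 14"
            using frame_all[OF p2(1)] p1(2,3) 1 by auto
          have 3: "fst \<sigma>3 0 = ?n" "bits \<sigma>3 2 = ?b" "fst \<sigma>3 4 = fst \<sigma>1 14" "fst \<sigma>3 5 = fst \<sigma>2 15" "fst \<sigma>3 15 = next_index True ?b 0"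
            using frame_all[OF p3(1)] p3(2) 2 p2(4) 1 by auto
          show ?thesis
            apply (rule wp_Seq, rule wp_Asg, rule wp_Seq, rule wp_FIND)
             apply (use 3 F(1) in simp)
            subgoal premises p4 for \<sigma>4
              apply (rule wp_Asg)
              using frame_all[OF p4(1)] p4(2) 3 F p1(2-4) p2(2-5) 1 by auto
            done
        qed
        done
      done
    done
  then show "wp PREP1 Q \<sigma>"
  proof (rule wp_frame)
    fix \<sigma>' assume f: "frame PREP1 \<sigma> \<sigma>'"
      and p: "bits \<sigma>' 2 = ?b \<and> fst \<sigma>' 4 < ?n \<and> rotate (fst \<sigma>' 4) ?a = ?b \<and> 0 < fst \<sigma>' 5 \<and>
      fst \<sigma>' 5 \<le> ?n \<and> rotate (fst \<sigma>' 5) ?b = ?b \<and> (\<forall>q. 0 < q \<longrightarrow> q < fst \<sigma>' 5 \<longrightarrow> rotate q ?b \<noteq> ?b) \<and>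
      fst \<sigma>' 6 = next_index True ?b 0 \<and> fst \<sigma>' 22 = next_index True ?b (fst \<sigma>' 6 + 1)"
    \<comment> \<open>Rotations commute, so the period found on the necklace is that of the
      label.\<close>
    have "rotate q ?b = ?b \<longleftrightarrow> rotate q ?a = ?a" for q
    proof -
      have "rotate q (rotate (fst \<sigma>' 4) ?a) = rotate (fst \<sigma>' 4) (rotate q ?a)" by (simp add: rotate_rotate add.commute)
      then show ?thesis using p rotate_inject by metis
    qed
    then show "Q \<sigma>'" using p f by (intro Q[OF f refl]) auto
  qed
qed

lemma wp_PREP2:
  assumes A: "bits \<sigma> 2 \<in> asym_bracelets (fst \<sigma> 0)" "fst \<sigma> 6 = next_index True (bits \<sigma> 2) 0"
      "fst \<sigma> 22 = next_index True (bits \<sigma> 2) (fst \<sigma> 6 + 1)"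
    and Q: "\<And>\<sigma>'. frame PREP2 \<sigma> \<sigma>' \<Longrightarrow>
      shape (bits \<sigma> 2) (fst \<sigma> 6) (fst \<sigma>' 7) (fst \<sigma>' 8) (fst \<sigma>' 9) (fst \<sigma>' 10) (fst \<sigma>' 11) \<Longrightarrow> Q \<sigma>'"
  shows "wp PREP2 Q \<sigma>"
proof (rule wp_pos)
  let ?n = "fst \<sigma> 0" and ?b = "bits \<sigma> 2" and ?z = "fst \<sigma> 6" and ?q = "fst \<sigma> 22"
  assume n: "0 < fst \<sigma> 0"
  note F = asym_next_index[OF A(1) n]
  have z: "?z < ?n" "?q < ?n" using F A by auto

  have "wp PREP2 (\<lambda>\<sigma>'. shape ?b ?z (fst \<sigma>' 7) (fst \<sigma>' 8) (fst \<sigma>' 9) (fst \<sigma>' 10) (fst \<sigma>' 11)) \<sigma>"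
    unfolding PREP2_def
    apply (rule wp_Seq, rule wp_FIND)
     apply (use z in simp)
    subgoal premises p1 for \<sigma>1
      apply (rule wp_Seq, rule wp_Asg, rule wp_Seq, rule wp_Asg, rule wp_Seq, rule wp_REV, simp)
      subgoal premises p2 for \<sigma>2
      proof -
        have 1: "fst \<sigma>1 0 = ?n" "bits \<sigma>1 2 = ?b" "fst \<sigma>1 6 = ?z" "fst \<sigma>1 22 = ?q" "fst \<sigma>1 15 = next_index True ?b (?q + 1)"
          "next_index True ?b (?q + 1) \<le> ?n"
          using frame_all[OF p1(1)] p1(2) next_index_le[of "?q + 1" ?b True] z by auto
        have 2: "fst \<sigma>2 0 = ?n" "bits \<sigma>2 2 = ?b" "bits \<sigma>2 8 = rev ?b" "fst \<sigma>2 6 = ?z"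
          "fst \<sigma>2 8 = next_index True ?b (?q + 1) - (?q + 1)" "fst \<sigma>2 9 = ?q - (?z + 1)"
          using frame_all[OF p2(1)] p2(2) 1 z by auto
        show ?thesis
          apply (rule wp_Seq, rule wp_FIND)
           apply (use 2 n in simp)
          subgoal premises p3 for \<sigma>3
          proof -
            have 3: "fst \<sigma>3 0 = ?n" "bits \<sigma>3 2 = ?b" "fst \<sigma>3 6 = ?z" "fst \<sigma>3 15 = next_index True (rev ?b) 1"
              "fst \<sigma>3 8 = next_index True ?b (?q + 1) - (?q + 1)" "fst \<sigma>3 9 = ?q - (?z + 1)" "next_index True (rev ?b) 1 \<le> ?n"
              using frame_all[OF p3(1)] p3(2) 2 next_index_le[of 1 "rev ?b" True] n by auto
            show ?thesis
              apply (rule wp_Seq, rule wp_Asg, rule wp_Seq, rule wp_FIND)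
               apply (use 3 z in simp)
              subgoal premises p4 for \<sigma>4
              proof -
                have 4: "fst \<sigma>4 0 = ?n" "bits \<sigma>4 2 = ?b" "fst \<sigma>4 6 = ?z" "fst \<sigma>4 10 = next_index True (rev ?b) 1 - 1"
                  "fst \<sigma>4 8 = next_index True ?b (?q + 1) - (?q + 1)" "fst \<sigma>4 9 = ?q - (?z + 1)" "fst \<sigma>4 15 = next_index False ?b ?z"
                  "next_index False ?b ?z \<le> ?n"
                  using frame_all[OF p4(1)] p4(2) 3 next_index_le[of ?z ?b False] z by auto
                show ?thesis
                  apply (rule wp_Seq, rule wp_Asg, rule wp_MAXRUN)
                   apply (use 4 z in simp)
                  subgoal premises p5 for \<sigma>5
                  proof -
                    have "max_run (drop ?z ?b) (fst \<sigma>5 7)" using p5(2) 4 by simp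
                    from shape_next_index[OF A(1) n A(2,3) refl this]
                    moreover have "next_index False ?b ?z - ?z < 8 * ?n" using 4(8) n by linarith
                    ultimately show ?thesis using frame_all[OF p5(1)] 4 by simp
                  qed
                  done
              qed
              done
          qed
          done
      qed
      done
    done
  then show "wp PREP2 Q \<sigma>" by (rule wp_frame) (intro Q)
qed

lemma wp_PREP3:
  assumes A: "bits \<sigma> 2 \<in> asym_bracelets (fst \<sigma> 0)" "bits \<sigma> 1 = root_label (fst \<sigma> 0)" "fst \<sigma> 4 < fst \<sigma> 0"
    and Q: "\<And>\<sigma>'. frame PREP3 \<sigma> \<sigma>' \<Longrightarrow> fst \<sigma>' 12 = of_bool (bits \<sigma> 2 = root_label (fst \<sigma> 0)) \<Longrightarrow>
      fst \<sigma>' 13 = (if bits \<sigma> 2 = root_label (fst \<sigma> 0) then fst \<sigma> 0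
        else (fst \<sigma> 4 + par_pos (fst \<sigma> 0) (bits \<sigma> 2)) mod fst \<sigma> 0 + 1) \<Longrightarrow> Q \<sigma>'"
  shows "wp PREP3 Q \<sigma>"
proof (rule wp_pos)
  let ?n = "fst \<sigma> 0" and ?b = "bits \<sigma> 2"
  assume n: "0 < fst \<sigma> 0"
  note pp = par_pos(2)[OF A(1) n]
  have "wp PREP3 (\<lambda>\<sigma>'. fst \<sigma>' 12 = of_bool (?b = root_label ?n) \<and> fst \<sigma>' 13 = (if ?b = root_label ?n then ?n
        else (fst \<sigma> 4 + par_pos ?n ?b) mod ?n + 1)) \<sigma>"
    unfolding PREP3_def
    apply (rule wp_Seq, rule wp_CMP)
    subgoal premises p1 for \<sigma>1
      apply (rule wp_Seq, rule wp_Asg)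
    proof -
      let ?\<tau> = "assign 12 (eval_ex \<sigma>1 (Equ (Var 15) (Var 0))) \<sigma>1"
      have 1: "fst ?\<tau> 0 = ?n" "fst ?\<tau> 12 = of_bool (?b = root_label ?n)" "bits ?\<tau> 2 = ?b" "fst ?\<tau> 4 = fst \<sigma> 4"
        using frame_all[OF p1(1)] p1(2) A n by auto
      have e12: "eval_ex ?\<tau> (Var 12) = of_bool (?b = root_label ?n)" using 1(2) by (simp only: eval_ex.simps(2))
      show "wp (Cond (Var 12) (Asg 13 (Var 0)) (PAR 2;; Asg 13 (Add (wrap (Add (Var 4) (Var 20))) (Cst 1))))
         (\<lambda>\<sigma>'. fst \<sigma>' 12 = of_bool (?b = root_label ?n) \<and> fst \<sigma>' 13 = (if ?b = root_label ?n then ?n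
            else (fst \<sigma> 4 + par_pos ?n ?b) mod ?n + 1)) ?\<tau>"
      proof (rule wp_Cond)
        assume "eval_ex ?\<tau> (Var 12) \<noteq> 0"
        then have "?b = root_label ?n" using e12 by (metis of_bool_eq_0_iff)
        then show "wp (Asg 13 (Var 0))
           (\<lambda>\<sigma>'. fst \<sigma>' 12 = of_bool (?b = root_label ?n) \<and> fst \<sigma>' 13 = (if ?b = root_label ?n then ?n
            else (fst \<sigma> 4 + par_pos ?n ?b) mod ?n + 1)) ?\<tau>"
          using frame_all[OF p1(1)] p1(2) A n by (intro wp_Asg) auto
      next
        assume "eval_ex ?\<tau> (Var 12) = 0"
        then have z: "?b \<noteq> root_label ?n" using e12 by (metis of_bool_eq_0_iff)
        show "wp (PAR 2;; Asg 13 (Add (wrap (Add (Var 4) (Var 20))) (Cst 1)))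
           (\<lambda>\<sigma>'. fst \<sigma>' 12 = of_bool (?b = root_label ?n) \<and> fst \<sigma>' 13 = (if ?b = root_label ?n then ?n
            else (fst \<sigma> 4 + par_pos ?n ?b) mod ?n + 1)) ?\<tau>"
          apply (rule wp_Seq, rule wp_PAR, simp)
           apply (use 1 A in simp)
          subgoal premises p2 for \<sigma>2
          proof (rule wp_Asg)
            have 2: "fst \<sigma>2 0 = ?n" "fst \<sigma>2 12 = of_bool (?b = root_label ?n)" "fst \<sigma>2 4 = fst \<sigma> 4"
              "fst \<sigma>2 20 = par_pos ?n ?b"
              using trans[OF frame_size[OF p2(1)] 1(1)] trans[OF frame_var[OF p2(1), of 12] 1(2)]
                trans[OF frame_var[OF p2(1), of 4] 1(4)] p2(3)[unfolded 1(1,3)]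
              by (simp_all only: mods_PAR) simp_all
            have w: "eval_ex \<sigma>2 (wrap (Add (Var 4) (Var 20))) = (fst \<sigma> 4 + par_pos ?n ?b) mod ?n"
              using 2 pp A(3) by (subst eval_wrap) auto
            have "(fst \<sigma> 4 + par_pos ?n ?b) mod ?n + 1 < 8 * ?n"
              using n mod_less_divisor[of ?n "fst \<sigma> 4 + par_pos ?n ?b"] by linarith
            then show "fst (assign 13 (eval_ex \<sigma>2 (Add (wrap (Add (Var 4) (Var 20))) (Cst 1))) \<sigma>2) 12 = of_bool (?b = root_label ?n) \<and>
              fst (assign 13 (eval_ex \<sigma>2 (Add (wrap (Add (Var 4) (Var 20))) (Cst 1))) \<sigma>2) 13 = (if ?b = root_label ?n then ?n
              else (fst \<sigma> 4 + par_pos ?n ?b) mod ?n + 1)"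
              using 2 z w by simp
          qed
          done
      qed
    qed
    done
  then show "wp PREP3 Q \<sigma>" by (rule wp_frame) (intro Q; blast)
qed

definition prepared :: "hstate \<Rightarrow> bool" where
  "prepared \<sigma> \<longleftrightarrow> (let n = fst \<sigma> 0; \<alpha> = bits \<sigma> 0; \<beta> = necklace_of \<alpha> in
     bits \<sigma> 2 = \<beta> \<and> fst \<sigma> 4 < n \<and> rotate (fst \<sigma> 4) \<alpha> = \<beta> \<and>
     0 < fst \<sigma> 5 \<and> fst \<sigma> 5 \<le> n \<and> rotate (fst \<sigma> 5) \<alpha> = \<alpha> \<and> (\<forall>q. 0 < q \<longrightarrow> q < fst \<sigma> 5 \<longrightarrow> rotate q \<alpha> \<noteq> \<alpha>) \<and>
     shape \<beta> (fst \<sigma> 6) (fst \<sigma> 7) (fst \<sigma> 8) (fst \<sigma> 9) (fst \<sigma> 10) (fst \<sigma> 11) \<and>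
     fst \<sigma> 12 = of_bool (\<beta> = root_label n) \<and>
     fst \<sigma> 13 = (if \<beta> = root_label n then n else (fst \<sigma> 4 + par_pos n \<beta>) mod n + 1))"

lemma wp_PREP:
  assumes A: "necklace_of (bits \<sigma> 0) \<in> asym_bracelets (fst \<sigma> 0)" "bits \<sigma> 1 = root_label (fst \<sigma> 0)"
    and Q: "\<And>\<sigma>'. frame PREP \<sigma> \<sigma>' \<Longrightarrow> prepared \<sigma>' \<Longrightarrow> Q \<sigma>'"
  shows "wp PREP Q \<sigma>"
proof -
  have "wp PREP prepared \<sigma>"
    unfolding PREP_def
    apply (rule wp_Seq, rule wp_PREP1[OF A(1)])
    subgoal premises p1 for \<sigma>1 \<beta>
    proof -
      have 1: "fst \<sigma>1 0 = fst \<sigma> 0" "bits \<sigma>1 0 = bits \<sigma> 0" "bits \<sigma>1 1 = root_label (fst \<sigma> 0)" using frame_all[OF p1(1)] A by auto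
      show ?thesis
        apply (rule wp_Seq, rule wp_PREP2)
           apply (use p1(2,3) A 1 in simp)
          apply (use p1(3,10) in simp)
         apply (use p1(3,11) in simp)
        subgoal premises p2 for \<sigma>2
        proof -
          have 2: "fst \<sigma>2 0 = fst \<sigma> 0" "bits \<sigma>2 0 = bits \<sigma> 0" "bits \<sigma>2 1 = root_label (fst \<sigma> 0)" "bits \<sigma>2 2 = \<beta>"
            "fst \<sigma>2 4 = fst \<sigma>1 4" "fst \<sigma>2 5 = fst \<sigma>1 5" "fst \<sigma>2 6 = fst \<sigma>1 6"
            using frame_all[OF p2(1)] 1 p1(3) by auto
          show ?thesis
            apply (rule wp_PREP3)
            using 2 p1(2) A apply simp
            using 2 apply simp
            using 2 p1(4) apply simp
            subgoal premises p3 for \<sigma>3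
              using frame_all[OF p3(1)] p3(2,3) 2 p1 p2(2) unfolding prepared_def Let_def by simp
            done
        qed
        done
    qed
    done
  then show ?thesis by (rule wp_frame) (intro Q)
qed

subsection \<open>The traversal program\<close>

definition le_ex :: "hexp \<Rightarrow> hexp \<Rightarrow> hexp" where
  "le_ex e f = Lt e (Add f (Cst 1))"

text \<open>Products are conjunctions and sums disjunctions. Scalars \<open>23\<close> and
  \<open>24\<close> hold the position \<open>x\<close> in the necklace and \<open>z - 1 - x\<close>;
  the leading factor requires the least period to be \<open>n\<close>, so that no child test is run
  at a periodic node.\<close>

definition CANDIDATE :: hexp where
  "CANDIDATE = Mul (Equ (Var 5) (Var 0)) (Add (Add
     (Mul (Lt (Var 23) (Var 6)) (Mul (le_ex (Var 7) (Var 23)) (Mul (le_ex (Var 24) (Var 23)) (le_ex (Var 10) (Var 24)))))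
     (Mul (Lt (Var 23) (Var 6)) (Mul (le_ex (Var 7) (Var 24)) (Mul (le_ex (Var 23) (Var 24))
        (Mul (le_ex (Var 8) (Var 23)) (le_ex (Var 23) (Var 9)))))))
     (Add (Equ (Var 23) (Sub (Var 0) (Cst 2))) (Add (Equ (Var 23) (Sub (Sub (Var 0) (Cst 1)) (Var 11)))
        (Equ (Var 23) (Sub (Sub (Var 0) (Cst 2)) (Var 11))))))"

definition NEXT :: hcmd where
  "NEXT = Asg 2 (Add (Var 2) (Cst 1))"

definition FLIP :: "nat \<Rightarrow> hcmd" where
  "FLIP x = Put 0 (Sub (Var x) (Cst 1)) (Sub (Cst 1) (Bit 0 (Sub (Var x) (Cst 1))))"

text \<open>The scan of the new node starts one past its change index, with the
  right-children.\<close>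

definition DOWN :: hcmd where
  "DOWN = FLIP 2;; Asg 1 (Var 2);; NEXT;; Ent (Var 1);; PREP"

definition SCAN :: hcmd where
  "SCAN = Asg 23 (wrap (Sub (Add (Sub (Var 2) (Cst 1)) (Var 0)) (Var 4)));; Asg 24 (Sub (Sub (Var 6) (Cst 1)) (Var 23));;
     Cond CANDIDATE (CHILD;; Cond (Var 21) DOWN NEXT) NEXT"

text \<open>Flipping the bit at the change index restores the parent's label, and the scan of the
  parent resumes just past this index; the parent's own change index is read from scalar
  \<open>13\<close>. At the root the loop flag is cleared instead.\<close>

definition UP :: hcmd where
  "UP = Lv;; Cond (Var 12) (Asg 3 (Cst 0)) (FLIP 1;; Asg 2 (Add (Var 1) (Cst 1));; PREP;; Asg 1 (Var 13))"

definition OLOOP :: hcmd where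
  "OLOOP = Loop (Lt (Var 15) (Var 5)) (Out (Bit 0 (Var 15));; Asg 15 (Add (Var 15) (Cst 1)))"

definition OUTP :: hcmd where
  "OUTP = Asg 15 (Cst 0);; OLOOP;; Asg 2 (Cst 1)"

text \<open>After \<open>n\<close> the position becomes \<open>n + 1\<close>, where the label is output, and then starts again from \<open>1\<close>;
  the node is finished when it reaches the change index.\<close>

definition BODY :: hcmd where
  "BODY = Cond (Equ (Var 2) (Var 1)) UP (Cond (Lt (Var 0) (Var 2)) OUTP SCAN)"

text \<open>As the change index of the root is \<open>n\<close>, it has no right-children; the
  position starts at \<open>n + 1\<close>, where the label is output.\<close>

definition INIT :: hcmd where
  "INIT = Put 1 (Sub (Var 0) (Cst 4)) (Cst 1);; Put 1 (Sub (Var 0) (Cst 2)) (Cst 1);; Put 1 (Sub (Var 0) (Cst 1)) (Cst 1);;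
     COPY 1 0;; Asg 1 (Var 0);; Asg 2 (Add (Var 0) (Cst 1));; Asg 3 (Cst 1)"

definition TRAVERSE :: hcmd where
  "TRAVERSE = Loop (Var 3) BODY"

definition MAIN :: hcmd where
  "MAIN = INIT;; Ent (Var 1);; PREP;; TRAVERSE"

lemma wf_MAIN: "wf_cmd MAIN"
  by (simp add: MAIN_def INIT_def TRAVERSE_def BODY_def OUTP_def OLOOP_def UP_def SCAN_def DOWN_def FLIP_def
      NEXT_def CANDIDATE_def le_ex_def wrap_def)

subsection \<open>Commands with events\<close>

text \<open>The counterpart of \<open>wp\<close> for commands with events, with an explicit time
  bound instead of a linear one.\<close>

definition wp_events :: "hcmd \<Rightarrow> event list \<Rightarrow> nat \<Rightarrow> (hstate \<Rightarrow> bool) \<Rightarrow> hstate \<Rightarrow> bool" where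
  "wp_events c es T Q \<sigma> \<longleftrightarrow> (\<exists>t \<sigma>'. exec c \<sigma> es t \<sigma>' \<and> t \<le> T \<and> Q \<sigma>')"

lemma wp_events_mono: "wp_events c es T Q \<sigma> \<Longrightarrow> T \<le> T' \<Longrightarrow> (\<And>\<sigma>'. Q \<sigma>' \<Longrightarrow> Q' \<sigma>') \<Longrightarrow> wp_events c es T' Q' \<sigma>"
  unfolding wp_events_def using le_trans by blast

lemma wp_events_wp: "wp c Q \<sigma> \<Longrightarrow> 0 < fst \<sigma> 0 \<Longrightarrow> fst \<sigma> 0 = n \<Longrightarrow> wp_events c [] (time_coeff c * n) Q \<sigma>"
  unfolding wp_events_def wp_def by blast

lemma wp_events_straight: "loop_free c \<Longrightarrow> Q (run_straight c \<sigma>) \<Longrightarrow> wp_events c [] (time_coeff c) Q \<sigma>"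
  unfolding wp_events_def using exec_straight by blast

lemma wp_events_Seq:
  assumes "wp_events c es T (wp_events d es' T' Q) \<sigma>"
  shows "wp_events (c ;; d) (es @ es') (T + T' + 1) Q \<sigma>"
proof -
  from assms obtain t \<sigma>1 t' \<sigma>2 where "exec c \<sigma> es t \<sigma>1" "t \<le> T" "exec d \<sigma>1 es' t' \<sigma>2" "t' \<le> T'" "Q \<sigma>2"
    unfolding wp_events_def by blast
  then show ?thesis unfolding wp_events_def by (intro exI[of _ "Suc (t + t')"] exI[of _ \<sigma>2]) (auto intro: exec_Seq)
qed

lemma wp_events_Seq_silent: "wp_events c [] T (wp_events d es T' Q) \<sigma> \<Longrightarrow> wp_events (c ;; d) es (T + T' + 1) Q \<sigma>"
  using wp_events_Seq[of c "[]"] by simp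

lemma wp_events_det:
  "loop_free c \<Longrightarrow> time_coeff c = 1 \<Longrightarrow> \<tau> = run_straight c \<sigma> \<Longrightarrow> wp_events d es T Q \<tau> \<Longrightarrow> wp_events (c ;; d) es (1 + T + 1) Q \<sigma>"
  using wp_events_straight[of c "wp_events d es T Q" \<sigma>] by (intro wp_events_Seq_silent) simp

lemma wp_events_Cond1: "eval_ex \<sigma> b \<noteq> 0 \<Longrightarrow> wp_events c es T Q \<sigma> \<Longrightarrow> wp_events (Cond b c d) es (T + 1) Q \<sigma>"
  unfolding wp_events_def by (metis exec_Cond1 Suc_eq_plus1 Suc_le_mono)

lemma wp_events_Cond2: "eval_ex \<sigma> b = 0 \<Longrightarrow> wp_events d es T Q \<sigma> \<Longrightarrow> wp_events (Cond b c d) es (T + 1) Q \<sigma>"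
  unfolding wp_events_def by (metis exec_Cond2 Suc_eq_plus1 Suc_le_mono)

lemma wp_events_Ent: "Q \<sigma> \<Longrightarrow> es = [Enter (bits \<sigma> 0) (eval_ex \<sigma> e)] \<Longrightarrow> wp_events (Ent e) es 1 Q \<sigma>"
  unfolding wp_events_def using exec_Ent by blast

lemma wp_events_Lv: "Q \<sigma> \<Longrightarrow> wp_events Lv [Leave] 1 Q \<sigma>"
  unfolding wp_events_def using exec_Lv by blast

subsection \<open>Moves of the traversal\<close>

definition state_inv :: "nat \<Rightarrow> bool list \<Rightarrow> nat \<Rightarrow> nat \<Rightarrow> hstate \<Rightarrow> bool" where
  "state_inv n \<alpha> c k \<sigma> \<longleftrightarrow> fst \<sigma> 0 = n \<and> bits \<sigma> 0 = \<alpha> \<and> bits \<sigma> 1 = root_label n \<and> fst \<sigma> 1 = c \<and> fst \<sigma> 2 = k \<and>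
     fst \<sigma> 3 = 1 \<and> prepared \<sigma>"

lemma prepared_cong:
  assumes "prepared \<sigma>" "fst \<sigma>' 0 = fst \<sigma> 0" "bits \<sigma>' 0 = bits \<sigma> 0" "bits \<sigma>' 2 = bits \<sigma> 2"
    "\<And>x. 4 \<le> x \<Longrightarrow> x \<le> 13 \<Longrightarrow> fst \<sigma>' x = fst \<sigma> x"
  shows "prepared \<sigma>'"
  using assms(1) unfolding prepared_def Let_def assms(2-4) by (simp add: assms(5))

text \<open>\<open>unit_cost * n\<close> bounds one run of the body of the main loop. The
  \<open>60\<close> covers constant overhead and the output of a label, and makes the
  \<open>9 * n\<close> steps of a scan small in comparison.\<close>

definition unit_cost :: nat where
  "unit_cost = time_coeff CHILD + time_coeff PREP + 60"

text \<open>Identifies the parameters computed by the program with those for which the positions in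
  \<open>special\<close> are counted.\<close>

lemma shape_unique:
  assumes "shape \<beta> z M r s h a" "shape \<beta> z' M' r' s' h' a'"
  shows "z' = z \<and> M' = M \<and> r' = r \<and> s' = s \<and> h' = h \<and> a' = a"
proof -
  from assms(1) obtain y u u1 u2 where y: "\<beta> = replicate z False @ y"
     "y = True # replicate s False @ True # replicate r False @ True # u"
     "rev y = True # replicate h False @ True # u1" "y = replicate a True @ False # u2" "max_run y M"
    unfolding shape_def by blast
  from assms(2) obtain y' u' u1' u2' where y': "\<beta> = replicate z' False @ y'"
     "y' = True # replicate s' False @ True # replicate r' False @ True # u'"
     "rev y' = True # replicate h' False @ True # u1'" "y' = replicate a' True @ False # u2'" "max_run y' M'"
    unfolding shape_def by blast
  have zy: "z' = z" "y' = y" using y(1,2) y'(1,2) zeros_unique by metis+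
  have s: "s' = s \<and> replicate r' False @ True # u' = replicate r False @ True # u"
    using y(2) y'(2) zy zeros_unique by (metis list.inject)
  have "r' = r" using s zeros_unique by blast
  moreover have "h' = h" using y(3) y'(3) zy zeros_unique by (metis list.inject)
  moreover have "a' = a" using y(4) y'(4) zy ones_unique by metis
  moreover have "M' = M" using y(5) y'(5) zy unfolding max_run_def by (meson le_antisym)
  ultimately show ?thesis using zy s by blast
qed

lemma rotate_unique:
  assumes "\<not> periodic \<alpha>" "d < length \<alpha>" "e < length \<alpha>" "rotate d \<alpha> = rotate e \<alpha>"
  shows "d = e"
proof (rule ccontr)
  assume ne: "d \<noteq> e"
  have *: False if "d < e" "e < length \<alpha>" "rotate d \<alpha> = rotate e \<alpha>" for d e
  proof -
    have "rotate d (rotate (e - d) \<alpha>) = rotate d \<alpha>" using that by (simp add: rotate_rotate)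
    then have "rotate (e - d) \<alpha> = \<alpha>" using rotate_inject by blast
    moreover have "\<alpha> \<noteq> []" using that by auto
    moreover have "0 < e - d" "e - d < length \<alpha>" using that by auto
    ultimately show False using assms(1) periodic_iff_rotate by blast
  qed
  show False using ne *[of d e] *[of e d] assms by (metis linorder_neqE_nat)
qed

lemma eval_CANDIDATE:
  assumes "fst \<sigma> 24 = fst \<sigma> 6 - 1 - fst \<sigma> 23"
  shows "eval_ex \<sigma> CANDIDATE \<noteq> 0 \<longleftrightarrow> fst \<sigma> 5 = fst \<sigma> 0 \<and>
    candidate (fst \<sigma> 0) (fst \<sigma> 6) (fst \<sigma> 7) (fst \<sigma> 8) (fst \<sigma> 9) (fst \<sigma> 10) (fst \<sigma> 11) (fst \<sigma> 23)"
  unfolding CANDIDATE_def le_ex_def candidate_def using assms by (simp add: less_Suc_eq_le) blast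

lemma FLIP_straight:
  assumes "1 \<le> fst \<sigma> x" "fst \<sigma> x \<le> fst \<sigma> 0"
  shows "fst (run_straight (FLIP x) \<sigma>) = fst \<sigma>" "bits (run_straight (FLIP x) \<sigma>) 0 = flip (bits \<sigma> 0) (fst \<sigma> x)"
    "j \<noteq> 0 \<Longrightarrow> bits (run_straight (FLIP x) \<sigma>) j = bits \<sigma> j"
proof -
  have k: "fst \<sigma> x - 1 < fst \<sigma> 0" using assms by simp
  show "fst (run_straight (FLIP x) \<sigma>) = fst \<sigma>" by (simp add: FLIP_def)
  show "bits (run_straight (FLIP x) \<sigma>) 0 = flip (bits \<sigma> 0) (fst \<sigma> x)"
    using k bits_nth[OF k, of 0] by (simp add: FLIP_def bits_put_bit flip_def)
  show "j \<noteq> 0 \<Longrightarrow> bits (run_straight (FLIP x) \<sigma>) j = bits \<sigma> j" using k by (simp add: FLIP_def bits_put_bit)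
qed

lemma preparedD:
  assumes "prepared \<sigma>"
  shows "bits \<sigma> 2 = necklace_of (bits \<sigma> 0)" "fst \<sigma> 4 < fst \<sigma> 0" "rotate (fst \<sigma> 4) (bits \<sigma> 0) = necklace_of (bits \<sigma> 0)"
    "0 < fst \<sigma> 5" "rotate (fst \<sigma> 5) (bits \<sigma> 0) = bits \<sigma> 0"
    "\<And>q. 0 < q \<Longrightarrow> q < fst \<sigma> 5 \<Longrightarrow> rotate q (bits \<sigma> 0) \<noteq> bits \<sigma> 0"
    "shape (necklace_of (bits \<sigma> 0)) (fst \<sigma> 6) (fst \<sigma> 7) (fst \<sigma> 8) (fst \<sigma> 9) (fst \<sigma> 10) (fst \<sigma> 11)"
    "fst \<sigma> 12 = of_bool (necklace_of (bits \<sigma> 0) = root_label (fst \<sigma> 0))"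
    "fst \<sigma> 13 = (if necklace_of (bits \<sigma> 0) = root_label (fst \<sigma> 0) then fst \<sigma> 0
       else (fst \<sigma> 4 + par_pos (fst \<sigma> 0) (necklace_of (bits \<sigma> 0))) mod fst \<sigma> 0 + 1)"
    "fst \<sigma> 5 \<le> fst \<sigma> 0"
  using assms unfolding prepared_def Let_def by blast+

lemma SCAN_split:
  assumes I: "state_inv n \<alpha> c k \<sigma>" and k: "1 \<le> k" "k \<le> n"
  obtains \<tau> where "\<And>Q es T. wp_events (Cond CANDIDATE (CHILD;; Cond (Var 21) DOWN NEXT) NEXT) es T Q \<tau> \<Longrightarrow> wp_events SCAN es (T + 4) Q \<sigma>"
    "state_inv n \<alpha> c k \<tau>" "eval_ex \<tau> CANDIDATE \<noteq> 0 \<longleftrightarrow> fst \<sigma> 5 = n \<and>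
      candidate n (fst \<sigma> 6) (fst \<sigma> 7) (fst \<sigma> 8) (fst \<sigma> 9) (fst \<sigma> 10) (fst \<sigma> 11) (back_pos n (fst \<sigma> 4) (k - 1))"
proof -
  define \<tau>1 where "\<tau>1 = assign 23 (eval_ex \<sigma> (wrap (Sub (Add (Sub (Var 2) (Cst 1)) (Var 0)) (Var 4)))) \<sigma>"
  define \<tau> where "\<tau> = assign 24 (eval_ex \<tau>1 (Sub (Sub (Var 6) (Cst 1)) (Var 23))) \<tau>1"
  have P: "prepared \<sigma>" "fst \<sigma> 0 = n" "bits \<sigma> 0 = \<alpha>" "fst \<sigma> 2 = k" using I by (auto simp: state_inv_def)
  note D = preparedD[OF P(1)]
  have len: "length (necklace_of \<alpha>) = n" using P by (metis length_bits length_necklace_of)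
  have z: "fst \<sigma> 6 \<le> n" using D(7) P len unfolding shape_def by (auto dest: arg_cong[of _ _ length])
  have "eval_ex \<sigma> (wrap (Sub (Add (Sub (Var 2) (Cst 1)) (Var 0)) (Var 4))) = back_pos n (fst \<sigma> 4) (k - 1)"
    using P D(2) k by (subst eval_wrap) (auto simp: back_pos_def)
  moreover have "back_pos n (fst \<sigma> 4) (k - 1) < n" using k by (intro back_pos_less) simp
  ultimately have t1: "fst \<tau>1 = (fst \<sigma>)(23 := back_pos n (fst \<sigma> 4) (k - 1))" "snd \<tau>1 = snd \<sigma>"
    unfolding \<tau>1_def using P by (auto simp: fun_eq_iff)
  have t2: "fst \<tau> = (fst \<tau>1)(24 := fst \<sigma> 6 - 1 - back_pos n (fst \<sigma> 4) (k - 1))" "snd \<tau> = snd \<sigma>"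
    unfolding \<tau>_def using t1 z P k by (auto simp: fun_eq_iff)
  have b: "bits \<tau> j = bits \<sigma> j" for j using t1 t2 by (simp add: bits_def)
  show thesis
  proof (rule that[of \<tau>])
    fix Q es T
    assume a: "wp_events (Cond CANDIDATE (CHILD;; Cond (Var 21) DOWN NEXT) NEXT) es T Q \<tau>"
    have "wp_events SCAN es (1 + (1 + T + 1) + 1) Q \<sigma>"
      unfolding SCAN_def
      by (rule wp_events_det[where \<tau> = \<tau>1], simp, simp, simp add: \<tau>1_def, rule wp_events_det[OF _ _ _ a]) (simp_all add: \<tau>_def)
    then show "wp_events SCAN es (T + 4) Q \<sigma>" by (rule wp_events_mono) auto
  next
    have "prepared \<tau>" by (rule prepared_cong[OF P(1)]) (use t1 t2 b in auto)
    then show "state_inv n \<alpha> c k \<tau>" using I t1 t2 b by (simp add: state_inv_def)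
  next
    show "eval_ex \<tau> CANDIDATE \<noteq> 0 \<longleftrightarrow> fst \<sigma> 5 = n \<and>
      candidate n (fst \<sigma> 6) (fst \<sigma> 7) (fst \<sigma> 8) (fst \<sigma> 9) (fst \<sigma> 10) (fst \<sigma> 11) (back_pos n (fst \<sigma> 4) (k - 1))"
      using t1 t2 P by (subst eval_CANDIDATE) auto
  qed
qed

definition child_test :: "nat \<Rightarrow> bool list \<Rightarrow> nat \<Rightarrow> bool" where
  "child_test n \<alpha> k \<longleftrightarrow> necklace_of (flip \<alpha> k) \<in> asym_bracelets n - {root_label n} \<and>
     par n (necklace_of (flip \<alpha> k)) = necklace_of \<alpha>"

lemma wp_events_NEXT: "state_inv n \<alpha> c k \<sigma> \<Longrightarrow> k \<le> n \<Longrightarrow> 6 \<le> n \<Longrightarrow> wp_events NEXT [] 1 (state_inv n \<alpha> c (Suc k)) \<sigma>"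
proof -
  assume I: "state_inv n \<alpha> c k \<sigma>" and k: "k \<le> n" "6 \<le> n"
  have "prepared (run_straight NEXT \<sigma>)"
    by (rule prepared_cong[of \<sigma>]) (use I in \<open>auto simp: NEXT_def state_inv_def\<close>)
  then have "state_inv n \<alpha> c (Suc k) (run_straight NEXT \<sigma>)" using I k by (simp add: state_inv_def NEXT_def)
  then show ?thesis using wp_events_straight[of NEXT "state_inv n \<alpha> c (Suc k)" \<sigma>] by (simp add: NEXT_def)
qed

lemma wp_events_CHILD:
  assumes I: "state_inv n \<alpha> c k \<sigma>" and k: "1 \<le> k" "k \<le> n"
  shows "wp_events CHILD [] (time_coeff CHILD * n) (\<lambda>\<sigma>'. state_inv n \<alpha> c k \<sigma>' \<and> fst \<sigma>' 21 = of_bool (child_test n \<alpha> k)) \<sigma>"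
proof (rule wp_events_wp)
  have P: "prepared \<sigma>" "fst \<sigma> 0 = n" "bits \<sigma> 0 = \<alpha>" "fst \<sigma> 2 = k" "bits \<sigma> 1 = root_label n" using I by (auto simp: state_inv_def)
  show "wp CHILD (\<lambda>\<sigma>'. state_inv n \<alpha> c k \<sigma>' \<and> fst \<sigma>' 21 = of_bool (child_test n \<alpha> k)) \<sigma>"
  proof (rule wp_CHILD)
    fix \<sigma>' assume f: "frame CHILD \<sigma> \<sigma>'" and c: "fst \<sigma>' 21 = of_bool
        (necklace_of (flip (bits \<sigma> 0) (fst \<sigma> 2)) \<in> asym_bracelets (fst \<sigma> 0) - {root_label (fst \<sigma> 0)} \<and>
         par (fst \<sigma> 0) (necklace_of (flip (bits \<sigma> 0) (fst \<sigma> 2))) = necklace_of (bits \<sigma> 0))"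
    have "prepared \<sigma>'" by (rule prepared_cong[OF P(1)]) (use frame_all[OF f] in auto)
    then have "state_inv n \<alpha> c k \<sigma>'" using I frame_all[OF f] by (simp add: state_inv_def)
    then show "state_inv n \<alpha> c k \<sigma>' \<and> fst \<sigma>' 21 = of_bool (child_test n \<alpha> k)" using c P by (simp add: child_test_def)
  qed (use P k preparedD(1)[OF P(1)] in auto)
qed (use I k in \<open>auto simp: state_inv_def\<close>)

lemma wp_events_DOWN:
  assumes I: "state_inv n \<alpha> c k \<sigma>" and k: "1 \<le> k" "k \<le> n" "6 \<le> n" and A: "necklace_of (flip \<alpha> k) \<in> asym_bracelets n"
  shows "wp_events DOWN [Enter (flip \<alpha> k) k] (time_coeff PREP * n + 8) (state_inv n (flip \<alpha> k) k (Suc k)) \<sigma>"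
proof -
  have P: "fst \<sigma> 0 = n" "bits \<sigma> 0 = \<alpha>" "fst \<sigma> 2 = k" "bits \<sigma> 1 = root_label n" "fst \<sigma> 3 = 1" using I by (auto simp: state_inv_def)
  define \<tau>1 where "\<tau>1 = run_straight (FLIP 2) \<sigma>"
  have t1: "fst \<tau>1 = fst \<sigma>" "bits \<tau>1 0 = flip \<alpha> k" "bits \<tau>1 1 = root_label n"
    using FLIP_straight[of \<sigma> 2] P k by (auto simp: \<tau>1_def)
  define \<tau>2 where "\<tau>2 = run_straight (Asg 1 (Var 2)) \<tau>1"
  have t2: "fst \<tau>2 = (fst \<sigma>)(1 := k)" "bits \<tau>2 0 = flip \<alpha> k" "bits \<tau>2 1 = root_label n"
    using t1 P k by (auto simp: \<tau>2_def)
  define \<tau> where "\<tau> = run_straight NEXT \<tau>2"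
  have t: "fst \<tau> = (fst \<sigma>)(1 := k, 2 := Suc k)" "bits \<tau> 0 = flip \<alpha> k" "bits \<tau> 1 = root_label n"
    using t2 P k by (auto simp: \<tau>_def NEXT_def)
  have 1: "wp_events PREP [] (time_coeff PREP * n) (state_inv n (flip \<alpha> k) k (Suc k)) \<tau>"
  proof (rule wp_events_wp)
    show "wp PREP (state_inv n (flip \<alpha> k) k (Suc k)) \<tau>"
    proof (rule wp_PREP)
      fix \<sigma>' assume "frame PREP \<tau> \<sigma>'" "prepared \<sigma>'"
      then show "state_inv n (flip \<alpha> k) k (Suc k) \<sigma>'" using frame_all[of PREP \<tau> \<sigma>'] t P by (simp add: state_inv_def)
    qed (use t P A in auto)
  qed (use t P k in auto)
  have 2: "wp_events (Ent (Var 1);; PREP) ([Enter (flip \<alpha> k) k] @ []) (1 + time_coeff PREP * n + 1) (state_inv n (flip \<alpha> k) k (Suc k)) \<tau>"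
    by (rule wp_events_Seq, rule wp_events_Ent) (use 1 t in auto)
  have 3: "wp_events (NEXT;; Ent (Var 1);; PREP) [Enter (flip \<alpha> k) k] (1 + (1 + time_coeff PREP * n + 1) + 1) (state_inv n (flip \<alpha> k) k (Suc k)) \<tau>2"
    by (rule wp_events_det[OF _ _ \<tau>_def 2[unfolded append_Nil2]]) (simp_all add: FLIP_def NEXT_def)
  have 4: "wp_events (Asg 1 (Var 2);; NEXT;; Ent (Var 1);; PREP) [Enter (flip \<alpha> k) k] (1 + (1 + (1 + time_coeff PREP * n + 1) + 1) + 1)
      (state_inv n (flip \<alpha> k) k (Suc k)) \<tau>1"
    by (rule wp_events_det[OF _ _ \<tau>2_def 3]) (simp_all add: FLIP_def NEXT_def)
  have 5: "wp_events DOWN [Enter (flip \<alpha> k) k] (1 + (1 + (1 + (1 + time_coeff PREP * n + 1) + 1) + 1) + 1) (state_inv n (flip \<alpha> k) k (Suc k)) \<sigma>"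
    unfolding DOWN_def
    by (rule wp_events_det[OF _ _ \<tau>1_def 4]) (simp_all add: FLIP_def NEXT_def)
  then show ?thesis by (rule wp_events_mono) auto
qed

definition moves :: "nat \<Rightarrow> bool list \<Rightarrow> nat \<Rightarrow> nat \<Rightarrow> event list \<Rightarrow> nat \<Rightarrow> bool list \<Rightarrow> nat \<Rightarrow> nat \<Rightarrow> bool" where
  "moves n \<alpha> c k es T \<alpha>' c' k' \<longleftrightarrow> (\<forall>\<sigma>. state_inv n \<alpha> c k \<sigma> \<longrightarrow> wp_events BODY es T (state_inv n \<alpha>' c' k') \<sigma>)"

lemma BODY_SCAN:
  assumes "state_inv n \<alpha> c k \<sigma>" "k \<noteq> c" "k \<le> n" "wp_events SCAN es T Q \<sigma>"
  shows "wp_events BODY es (T + 2) Q \<sigma>"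
proof -
  have "wp_events BODY es (T + 1 + 1) Q \<sigma>"
    unfolding BODY_def
    by (rule wp_events_Cond2, use assms in \<open>simp add: state_inv_def\<close>, rule wp_events_Cond2) (use assms in \<open>auto simp: state_inv_def\<close>)
  then show ?thesis by simp
qed

lemma unit_cost_ge: "6 \<le> n \<Longrightarrow> time_coeff CHILD * n + time_coeff PREP * n + 60 \<le> unit_cost * n"
  by (simp add: unit_cost_def algebra_simps)

text \<open>A child's position passes the filter: its parent is aperiodic, so the least period is
  \<open>n\<close>, and \<open>child_imp_candidate\<close> applies.\<close>

lemma move_child:
  assumes n: "6 \<le> n" and A: "necklace_of \<alpha> \<in> asym_bracelets n" and kc: "k \<noteq> c"
    and ch: "k \<in> set (child_indices n \<alpha>)"
  shows "moves n \<alpha> c k [Enter (flip \<alpha> k) k] (unit_cost * n) (flip \<alpha> k) k (Suc k)"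
  unfolding moves_def
proof (intro allI impI)
  fix \<sigma> assume I: "state_inv n \<alpha> c k \<sigma>"
  have k: "1 \<le> k" "k \<le> n" "\<not> periodic \<alpha>" "child_test n \<alpha> k" using ch by (auto simp: set_child_indices child_test_def)
  have P: "prepared \<sigma>" "fst \<sigma> 0 = n" "bits \<sigma> 0 = \<alpha>" using I by (auto simp: state_inv_def)
  note D = preparedD[OF P(1), unfolded P(2,3)]
  have len: "length \<alpha> = n" using P by (metis length_bits)
  have ne: "\<alpha> \<noteq> []" using len n by auto
  obtain \<tau> where t: "\<And>Q es T. wp_events (Cond CANDIDATE (CHILD;; Cond (Var 21) DOWN NEXT) NEXT) es T Q \<tau> \<Longrightarrow> wp_events SCAN es (T + 4) Q \<sigma>"
    "state_inv n \<alpha> c k \<tau>" "eval_ex \<tau> CANDIDATE \<noteq> 0 \<longleftrightarrow> fst \<sigma> 5 = n \<and>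
      candidate n (fst \<sigma> 6) (fst \<sigma> 7) (fst \<sigma> 8) (fst \<sigma> 9) (fst \<sigma> 10) (fst \<sigma> 11) (back_pos n (fst \<sigma> 4) (k - 1))"
    using SCAN_split[OF I k(1,2)] by metis
  have "fst \<sigma> 5 = n" using least_period(3)[OF D(4,5) D(6) ne] k(3) D(10) len by simp
  moreover have "candidate n (fst \<sigma> 6) (fst \<sigma> 7) (fst \<sigma> 8) (fst \<sigma> 9) (fst \<sigma> 10) (fst \<sigma> 11) (back_pos n (fst \<sigma> 4) (k - 1))"
    by (rule child_imp_candidate(1)[OF len refl A D(3) D(2) D(7) ch])
  ultimately have cd: "eval_ex \<tau> CANDIDATE \<noteq> 0" using t(3) by blast
  have "wp_events CHILD [] (time_coeff CHILD * n) (wp_events (Cond (Var 21) DOWN NEXT) [Enter (flip \<alpha> k) k] (time_coeff PREP * n + 8 + 1)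
     (state_inv n (flip \<alpha> k) k (Suc k))) \<tau>"
  proof (rule wp_events_mono[OF wp_events_CHILD[OF t(2) k(1,2)] order.refl])
    fix \<sigma>' assume s: "state_inv n \<alpha> c k \<sigma>' \<and> fst \<sigma>' 21 = of_bool (child_test n \<alpha> k)"
    show "wp_events (Cond (Var 21) DOWN NEXT) [Enter (flip \<alpha> k) k] (time_coeff PREP * n + 8 + 1) (state_inv n (flip \<alpha> k) k (Suc k)) \<sigma>'"
      by (rule wp_events_Cond1, use s k in simp, rule wp_events_DOWN) (use s k n in \<open>auto simp: child_test_def\<close>)
  qed
  from BODY_SCAN[OF I kc k(2) t(1)[OF wp_events_Cond1[OF cd wp_events_Seq_silent[OF this]]]]
  show "wp_events BODY [Enter (flip \<alpha> k) k] (unit_cost * n) (state_inv n (flip \<alpha> k) k (Suc k)) \<sigma>"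
    by (rule wp_events_mono) (use unit_cost_ge[OF n] in auto)
qed

text \<open>The full unit is due only if the filter lets the position through; otherwise eight steps
  suffice.\<close>

lemma move_skip_gen:
  assumes n: "6 \<le> n" and kc: "k \<noteq> c" and ch: "k \<notin> set (child_indices n \<alpha>)" and k: "1 \<le> k" "k \<le> n"
    and I: "state_inv n \<alpha> c k \<sigma>"
    and T: "fst \<sigma> 5 = n \<Longrightarrow>
      candidate n (fst \<sigma> 6) (fst \<sigma> 7) (fst \<sigma> 8) (fst \<sigma> 9) (fst \<sigma> 10) (fst \<sigma> 11) (back_pos n (fst \<sigma> 4) (k - 1)) \<Longrightarrow> unit_cost * n \<le> T"
      "8 \<le> T"
  shows "wp_events BODY [] T (state_inv n \<alpha> c (Suc k)) \<sigma>"
proof -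
  have P: "prepared \<sigma>" "fst \<sigma> 0 = n" "bits \<sigma> 0 = \<alpha>" using I by (auto simp: state_inv_def)
  note D = preparedD[OF P(1), unfolded P(2,3)]
  have len: "length \<alpha> = n" using P by (metis length_bits)
  have ne: "\<alpha> \<noteq> []" using len n by auto
  obtain \<tau> where t: "\<And>Q es T. wp_events (Cond CANDIDATE (CHILD;; Cond (Var 21) DOWN NEXT) NEXT) es T Q \<tau> \<Longrightarrow> wp_events SCAN es (T + 4) Q \<sigma>"
    "state_inv n \<alpha> c k \<tau>" "eval_ex \<tau> CANDIDATE \<noteq> 0 \<longleftrightarrow> fst \<sigma> 5 = n \<and>
      candidate n (fst \<sigma> 6) (fst \<sigma> 7) (fst \<sigma> 8) (fst \<sigma> 9) (fst \<sigma> 10) (fst \<sigma> 11) (back_pos n (fst \<sigma> 4) (k - 1))"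
    using SCAN_split[OF I k(1,2)] by metis
  show ?thesis
  proof (cases "eval_ex \<tau> CANDIDATE = 0")
    case True
    from BODY_SCAN[OF I kc k(2) t(1)[OF wp_events_Cond2[OF True wp_events_NEXT[OF t(2) k(2) n]]]]
    show ?thesis by (rule wp_events_mono) (use T(2) in auto)
  next
    case False
    then have c: "fst \<sigma> 5 = n" "unit_cost * n \<le> T" using t(3) T(1) by auto
    have "\<not> periodic \<alpha>" using least_period(3)[OF D(4,5) D(6) ne] c(1) len by simp
    then have nc: "\<not> child_test n \<alpha> k" using ch k by (auto simp: set_child_indices child_test_def)
    have "wp_events CHILD [] (time_coeff CHILD * n) (wp_events (Cond (Var 21) DOWN NEXT) [] (1 + 1) (state_inv n \<alpha> c (Suc k))) \<tau>"
    proof (rule wp_events_mono[OF wp_events_CHILD[OF t(2) k(1,2)] order.refl])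
      fix \<sigma>' assume s: "state_inv n \<alpha> c k \<sigma>' \<and> fst \<sigma>' 21 = of_bool (child_test n \<alpha> k)"
      show "wp_events (Cond (Var 21) DOWN NEXT) [] (1 + 1) (state_inv n \<alpha> c (Suc k)) \<sigma>'"
        by (rule wp_events_Cond2, use s nc in simp, rule wp_events_NEXT) (use s k n in auto)
    qed
    from BODY_SCAN[OF I kc k(2) t(1)[OF wp_events_Cond1[OF False wp_events_Seq_silent[OF this]]]]
    show ?thesis by (rule wp_events_mono) (use unit_cost_ge[OF n] c(2) in auto)
  qed
qed

text \<open>A candidate outside \<open>special\<close> would be a child, so only special positions
  pay for a failing test.\<close>

lemma move_skip:
  assumes n: "6 \<le> n" and kc: "k \<noteq> c" and ch: "k \<notin> set (child_indices n \<alpha>)" and k: "1 \<le> k" "k \<le> n"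
    and A: "necklace_of \<alpha> \<in> asym_bracelets n" and ap: "\<not> periodic \<alpha>"
    and d: "d < n" "rotate d \<alpha> = necklace_of \<alpha>" and sh: "shape (necklace_of \<alpha>) z M r s h a"
  shows "moves n \<alpha> c k [] (8 + (if k \<in> special_labels n d (special n z M r s h a) then unit_cost * n else 0)) \<alpha> c (Suc k)"
  unfolding moves_def
proof (intro allI impI)
  fix \<sigma> assume I: "state_inv n \<alpha> c k \<sigma>"
  have P: "prepared \<sigma>" "fst \<sigma> 0 = n" "bits \<sigma> 0 = \<alpha>" using I by (auto simp: state_inv_def)
  note D = preparedD[OF P(1), unfolded P(2,3)]
  have len: "length \<alpha> = n" using P by (metis length_bits)
  have "d = fst \<sigma> 4" using rotate_unique[OF ap] d D(2,3) len by simp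
  moreover have "fst \<sigma> 6 = z \<and> fst \<sigma> 7 = M \<and> fst \<sigma> 8 = r \<and> fst \<sigma> 9 = s \<and> fst \<sigma> 10 = h \<and> fst \<sigma> 11 = a"
    using shape_unique[OF sh D(7)] .
  moreover have "back_pos n d (k - 1) \<in> special n z M r s h a" if "candidate n z M r s h a (back_pos n d (k - 1))"
    using candidate_imp_child(1)[OF len refl A d(2,1) sh ap k that] ch by blast
  ultimately show "wp_events BODY [] (8 + (if k \<in> special_labels n d (special n z M r s h a) then unit_cost * n else 0)) (state_inv n \<alpha> c (Suc k)) \<sigma>"
    using k by (intro move_skip_gen[OF n kc ch k I]) (auto simp: special_labels_def)
qed

lemma move_skip_periodic:
  assumes n: "6 \<le> n" and kc: "k \<noteq> c" and k: "1 \<le> k" "k \<le> n" and per: "periodic \<alpha>"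
  shows "moves n \<alpha> c k [] 8 \<alpha> c (Suc k)"
  unfolding moves_def
proof (intro allI impI)
  fix \<sigma> assume I: "state_inv n \<alpha> c k \<sigma>"
  have P: "prepared \<sigma>" "fst \<sigma> 0 = n" "bits \<sigma> 0 = \<alpha>" using I by (auto simp: state_inv_def)
  note D = preparedD[OF P(1), unfolded P(2,3)]
  have len: "length \<alpha> = n" using P by (metis length_bits)
  have ne: "\<alpha> \<noteq> []" using len n by auto
  have "fst \<sigma> 5 \<noteq> n" using least_period(3)[OF D(4,5) D(6) ne] per len by simp
  then show "wp_events BODY [] 8 (state_inv n \<alpha> c (Suc k)) \<sigma>"
    by (intro move_skip_gen[OF n kc _ k I]) (auto simp: set_child_indices per)
qed

text \<open>Each letter takes four steps: loop test, sequence, output, increment.\<close>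

lemma exec_OLOOP:
  assumes "fst \<sigma> 15 = i" "i \<le> fst \<sigma> 5" "fst \<sigma> 5 \<le> fst \<sigma> 0" "0 < fst \<sigma> 0"
  shows "\<exists>t \<sigma>'. exec OLOOP \<sigma> (map Emit (drop i (take (fst \<sigma> 5) (bits \<sigma> 0)))) t \<sigma>' \<and> t \<le> 4 * (fst \<sigma> 5 - i) + 1"
  using assms
proof (induction "fst \<sigma> 5 - i" arbitrary: i \<sigma>)
  case 0
  then have "exec OLOOP \<sigma> [] 1 \<sigma>" unfolding OLOOP_def by (intro exec_Loop2) simp
  then show ?case using 0 by (intro exI[of _ 1] exI[of _ \<sigma>]) simp
next
  case (Suc m)
  let ?p = "fst \<sigma> 5" and ?\<tau> = "assign 15 (eval_ex \<sigma> (Add (Var 15) (Cst 1))) \<sigma>"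
  have i: "i < ?p" using Suc.hyps(2) by simp
  have t: "fst ?\<tau> = (fst \<sigma>)(15 := Suc i)" "bits ?\<tau> 0 = bits \<sigma> 0" using Suc.prems i by auto
  have m: "m = fst ?\<tau> 5 - Suc i" using t(1) Suc.hyps(2) by simp
  have "fst ?\<tau> 15 = Suc i" "Suc i \<le> fst ?\<tau> 5" "fst ?\<tau> 5 \<le> fst ?\<tau> 0" "0 < fst ?\<tau> 0"
    using t(1) Suc.prems i by simp_all
  note IH = Suc.hyps(1)[OF m this]
  have "fst ?\<tau> 5 = ?p" using t(1) by simp
  then obtain t' \<sigma>' where
    1: "exec OLOOP ?\<tau> (map Emit (drop (Suc i) (take ?p (bits \<sigma> 0)))) t' \<sigma>'" "t' \<le> 4 * (?p - Suc i) + 1"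
    using IH t(2) by metis
  have b: "eval_ex \<sigma> (Bit 0 (Var 15)) \<noteq> 0 \<longleftrightarrow> bits \<sigma> 0 ! i" using Suc.prems i by (subst eval_Bit) auto
  have "exec (Out (Bit 0 (Var 15));; Asg 15 (Add (Var 15) (Cst 1))) \<sigma> ([Emit (bits \<sigma> 0 ! i)] @ []) (Suc (1 + 1)) ?\<tau>"
    using exec_Out[of "Bit 0 (Var 15)" \<sigma>] b exec_Asg[of 15 "Add (Var 15) (Cst 1)" \<sigma>] by (intro exec_Seq) (auto simp del: eval_ex.simps(3))
  from exec_Loop1[OF _ this 1(1)[unfolded OLOOP_def]]
  have "exec OLOOP \<sigma> (Emit (bits \<sigma> 0 ! i) # map Emit (drop (Suc i) (take ?p (bits \<sigma> 0)))) (Suc (Suc (1 + 1) + t')) \<sigma>'"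
    unfolding OLOOP_def using Suc.prems i by simp
  moreover have "drop i (take ?p (bits \<sigma> 0)) = bits \<sigma> 0 ! i # drop (Suc i) (take ?p (bits \<sigma> 0))"
    using Suc.prems i by (subst Cons_nth_drop_Suc[symmetric]) auto
  ultimately show ?case using 1(2) i by (intro exI[of _ "Suc (Suc (1 + 1) + t')"] exI[of _ \<sigma>']) auto
qed

lemma move_emit:
  assumes n: "6 \<le> n" and c: "c \<le> n"
  shows "moves n \<alpha> c (Suc n) (map Emit (ap \<alpha>)) (unit_cost * n) \<alpha> c 1"
  unfolding moves_def
proof (intro allI impI)
  fix \<sigma> assume I: "state_inv n \<alpha> c (Suc n) \<sigma>"
  have P: "prepared \<sigma>" "fst \<sigma> 0 = n" "bits \<sigma> 0 = \<alpha>" "fst \<sigma> 2 = Suc n" "fst \<sigma> 1 = c" using I by (auto simp: state_inv_def)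
  note D = preparedD[OF P(1), unfolded P(2,3)]
  have len: "length \<alpha> = n" using P by (metis length_bits)
  have ne: "\<alpha> \<noteq> []" using len n by auto
  have ap: "ap \<alpha> = take (fst \<sigma> 5) \<alpha>" by (rule least_period(2)[OF D(4,5) D(6) ne])
  define \<tau> where "\<tau> = run_straight (Asg 15 (Cst 0)) \<sigma>"
  have t: "fst \<tau> = (fst \<sigma>)(15 := 0)" "bits \<tau> j = bits \<sigma> j" for j using P n by (auto simp: \<tau>_def fun_eq_iff)
  from exec_OLOOP[of \<tau> 0] obtain t' \<tau>' where
    o: "exec OLOOP \<tau> (map Emit (ap \<alpha>)) t' \<tau>'" "t' \<le> 4 * n + 1"
    using t P D(10) n ap by auto
  have f: "frame OLOOP \<tau> \<tau>'" by (rule exec_frame[OF o(1)])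
  have f': "fst \<tau>' 0 = n" "\<And>x. x \<noteq> 15 \<Longrightarrow> fst \<tau>' x = fst \<sigma> x" "\<And>j. bits \<tau>' j = bits \<sigma> j"
    using frame_all[OF f] t P by (auto simp: OLOOP_def)
  have "prepared (run_straight (Asg 2 (Cst 1)) \<tau>')" by (rule prepared_cong[OF P(1)]) (use f' P in auto)
  then have s: "state_inv n \<alpha> c 1 (run_straight (Asg 2 (Cst 1)) \<tau>')" using I f' n by (simp add: state_inv_def)
  have 1: "wp_events (Asg 2 (Cst 1)) [] 1 (state_inv n \<alpha> c 1) \<tau>'" using wp_events_straight[of "Asg 2 (Cst 1)" "state_inv n \<alpha> c 1" \<tau>'] s by simp
  have 2: "wp_events (OLOOP;; Asg 2 (Cst 1)) (map Emit (ap \<alpha>) @ []) (4 * n + 1 + 1 + 1) (state_inv n \<alpha> c 1) \<tau>"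
    by (rule wp_events_Seq) (use o 1 wp_events_def[of OLOOP] in blast)
  have 3: "wp_events OUTP (map Emit (ap \<alpha>)) (1 + (4 * n + 1 + 1 + 1) + 1) (state_inv n \<alpha> c 1) \<sigma>"
    unfolding OUTP_def
    by (rule wp_events_det[OF _ _ \<tau>_def 2[unfolded append_Nil2]]) (simp_all add: FLIP_def NEXT_def)
  have "wp_events BODY (map Emit (ap \<alpha>)) (1 + (4 * n + 1 + 1 + 1) + 1 + 1 + 1) (state_inv n \<alpha> c 1) \<sigma>"
    unfolding BODY_def
    by (rule wp_events_Cond2, use P c in simp, rule wp_events_Cond1) (use P 3 in auto)
  then show "wp_events BODY (map Emit (ap \<alpha>)) (unit_cost * n) (state_inv n \<alpha> c 1) \<sigma>"
    by (rule wp_events_mono) (use n in \<open>auto simp: unit_cost_def algebra_simps\<close>)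
qed

text \<open>States that the index recomputed by \<open>PREP\<close> is \<open>c\<close>. It speaks
  of all rotation distances \<open>d\<close> because the specification of \<open>LROT\<close> does
  not say which one is found; for an aperiodic label there is only one.\<close>

definition change_ok :: "nat \<Rightarrow> bool list \<Rightarrow> nat \<Rightarrow> bool" where
  "change_ok n \<alpha> c \<longleftrightarrow> (if necklace_of \<alpha> = root_label n then c = n
     else \<forall>d<n. rotate d \<alpha> = necklace_of \<alpha> \<longrightarrow> (d + par_pos n (necklace_of \<alpha>)) mod n + 1 = c)"

text \<open>Flipping bit \<open>k\<close> twice restores \<alpha>, and \<open>change_ok\<close>
  makes the recomputed index equal to the change index \<open>c\<close> of \<alpha>.\<close>

lemma move_leave:
  assumes n: "6 \<le> n" and A: "necklace_of \<alpha> \<in> asym_bracelets n" and len: "length \<alpha> = n"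
    and ch: "k \<in> set (child_indices n \<alpha>)" and c: "change_ok n \<alpha> c"
  shows "moves n (flip \<alpha> k) k k [Leave] (unit_cost * n) \<alpha> c (Suc k)"
  unfolding moves_def
proof (intro allI impI)
  fix \<sigma> assume I: "state_inv n (flip \<alpha> k) k k \<sigma>"
  have k: "1 \<le> k" "k \<le> n" "necklace_of (flip \<alpha> k) \<noteq> root_label n" using ch by (auto simp: set_child_indices)
  have P: "prepared \<sigma>" "fst \<sigma> 0 = n" "bits \<sigma> 0 = flip \<alpha> k" "fst \<sigma> 2 = k" "fst \<sigma> 1 = k" "bits \<sigma> 1 = root_label n" "fst \<sigma> 3 = 1"
    using I by (auto simp: state_inv_def)
  note D = preparedD[OF P(1), unfolded P(2,3)]
  define \<tau>1 where "\<tau>1 = run_straight (FLIP 1) \<sigma>"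
  have t1: "fst \<tau>1 = fst \<sigma>" "bits \<tau>1 0 = \<alpha>" "bits \<tau>1 1 = root_label n"
    using FLIP_straight[of \<sigma> 1] P k len flip_flip[of k \<alpha>] by (auto simp: \<tau>1_def)
  define \<tau> where "\<tau> = run_straight (Asg 2 (Add (Var 1) (Cst 1))) \<tau>1"
  have t: "fst \<tau> = (fst \<sigma>)(2 := Suc k)" "bits \<tau> 0 = \<alpha>" "bits \<tau> 1 = root_label n"
    using t1 P k n by (auto simp: \<tau>_def)
  have 1: "wp_events (PREP;; Asg 1 (Var 13)) [] (time_coeff PREP * n + 1 + 1) (state_inv n \<alpha> c (Suc k)) \<tau>"
  proof (rule wp_events_Seq_silent, rule wp_events_wp)
    show "wp PREP (wp_events (Asg 1 (Var 13)) [] 1 (state_inv n \<alpha> c (Suc k))) \<tau>"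
    proof (rule wp_PREP)
      fix \<sigma>' assume f: "frame PREP \<tau> \<sigma>'" and p: "prepared \<sigma>'"
      have f': "fst \<sigma>' 0 = n" "bits \<sigma>' 0 = \<alpha>" "bits \<sigma>' 1 = root_label n" "fst \<sigma>' 2 = Suc k" "fst \<sigma>' 3 = 1"
        using frame_all[OF f] t P by auto
      note D' = preparedD[OF p, unfolded f'(1,2)]
      have 13: "fst \<sigma>' 13 = c" using c D'(2,3,9) unfolding change_ok_def by (auto split: if_splits)
      have "c < 8 * n"
      proof (cases "necklace_of \<alpha> = root_label n")
        case False
        have "(fst \<sigma>' 4 + par_pos n (necklace_of \<alpha>)) mod n < n" using n by (intro mod_less_divisor) simp
        then have "fst \<sigma>' 13 \<le> n" using D'(9) False by simp
        then show ?thesis using 13 n by simp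
      qed (use c n in \<open>auto simp: change_ok_def\<close>)
      then have r: "fst (run_straight (Asg 1 (Var 13)) \<sigma>') = (fst \<sigma>')(1 := c)" "bits (run_straight (Asg 1 (Var 13)) \<sigma>') j = bits \<sigma>' j" for j
        using 13 f' by auto
      have "prepared (run_straight (Asg 1 (Var 13)) \<sigma>')" by (rule prepared_cong[OF p]) (simp_all only: r, simp_all)
      then have "state_inv n \<alpha> c (Suc k) (run_straight (Asg 1 (Var 13)) \<sigma>')" using f' r unfolding state_inv_def by simp
      with wp_events_straight[of "Asg 1 (Var 13)" "state_inv n \<alpha> c (Suc k)" \<sigma>'] show "wp_events (Asg 1 (Var 13)) [] 1 (state_inv n \<alpha> c (Suc k)) \<sigma>'" by simp
    qed (use t P A in auto)
  qed (use t P n in auto)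
  have 2: "wp_events (Asg 2 (Add (Var 1) (Cst 1));; PREP;; Asg 1 (Var 13)) [] (1 + (time_coeff PREP * n + 1 + 1) + 1) (state_inv n \<alpha> c (Suc k)) \<tau>1"
    by (rule wp_events_det[OF _ _ \<tau>_def 1]) (simp_all add: FLIP_def NEXT_def)
  have 3: "wp_events (FLIP 1;; Asg 2 (Add (Var 1) (Cst 1));; PREP;; Asg 1 (Var 13)) [] (1 + (1 + (time_coeff PREP * n + 1 + 1) + 1) + 1)
      (state_inv n \<alpha> c (Suc k)) \<sigma>"
    by (rule wp_events_det[OF _ _ \<tau>1_def 2]) (simp_all add: FLIP_def NEXT_def)
  have 4: "wp_events (Cond (Var 12) (Asg 3 (Cst 0)) (FLIP 1;; Asg 2 (Add (Var 1) (Cst 1));; PREP;; Asg 1 (Var 13))) []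
      (1 + (1 + (time_coeff PREP * n + 1 + 1) + 1) + 1 + 1) (state_inv n \<alpha> c (Suc k)) \<sigma>"
    by (rule wp_events_Cond2) (use 3 D(8) k in auto)
  have 5: "wp_events UP ([Leave] @ []) (1 + (1 + (1 + (time_coeff PREP * n + 1 + 1) + 1) + 1 + 1) + 1) (state_inv n \<alpha> c (Suc k)) \<sigma>"
    unfolding UP_def by (rule wp_events_Seq, rule wp_events_Lv, rule 4)
  have "wp_events BODY [Leave] (1 + (1 + (1 + (time_coeff PREP * n + 1 + 1) + 1) + 1 + 1) + 1 + 1) (state_inv n \<alpha> c (Suc k)) \<sigma>"
    unfolding BODY_def by (rule wp_events_Cond1) (use P 5 in auto)
  then show "wp_events BODY [Leave] (unit_cost * n) (state_inv n \<alpha> c (Suc k)) \<sigma>"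
    by (rule wp_events_mono) (use unit_cost_ge[OF n] in auto)
qed

subsection \<open>The traversal of a subtree\<close>

text \<open>The semantics only speaks of complete runs of the main loop. A partial run is therefore
  expressed by continuation: every complete run from the later state extends to one from the earlier
  state, with the events \<open>es\<close> in front and at most \<open>T\<close> more steps.\<close>

definition goes :: "nat \<Rightarrow> bool list \<Rightarrow> nat \<Rightarrow> nat \<Rightarrow> event list \<Rightarrow> nat \<Rightarrow> bool list \<Rightarrow> nat \<Rightarrow> nat \<Rightarrow> bool" where
  "goes n \<alpha> c k es T \<alpha>' c' k' \<longleftrightarrow> (\<forall>\<sigma>. state_inv n \<alpha> c k \<sigma> \<longrightarrow> (\<exists>\<sigma>'. state_inv n \<alpha>' c' k' \<sigma>' \<and>
     (\<forall>es2 t2 \<tau>. exec TRAVERSE \<sigma>' es2 t2 \<tau> \<longrightarrow> (\<exists>t\<le>T + t2. exec TRAVERSE \<sigma> (es @ es2) t \<tau>))))"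

lemma goes_refl: "goes n \<alpha> c k [] 0 \<alpha> c k"
  unfolding goes_def by fastforce

lemma goes_trans:
  assumes "goes n \<alpha> c k es T \<alpha>' c' k'" "goes n \<alpha>' c' k' es' T' \<alpha>'' c'' k''"
  shows "goes n \<alpha> c k (es @ es') (T + T') \<alpha>'' c'' k''"
  unfolding goes_def
proof (intro allI impI)
  fix \<sigma> assume "state_inv n \<alpha> c k \<sigma>"
  with assms(1) obtain \<sigma>1 where 1: "state_inv n \<alpha>' c' k' \<sigma>1"
    "\<And>es2 t2 \<tau>. exec TRAVERSE \<sigma>1 es2 t2 \<tau> \<Longrightarrow> \<exists>t\<le>T + t2. exec TRAVERSE \<sigma> (es @ es2) t \<tau>" unfolding goes_def by blast
  with assms(2) obtain \<sigma>2 where 2: "state_inv n \<alpha>'' c'' k'' \<sigma>2"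
    "\<And>es2 t2 \<tau>. exec TRAVERSE \<sigma>2 es2 t2 \<tau> \<Longrightarrow> \<exists>t\<le>T' + t2. exec TRAVERSE \<sigma>1 (es' @ es2) t \<tau>" unfolding goes_def by blast
  have "\<exists>t\<le>T + T' + t2. exec TRAVERSE \<sigma> ((es @ es') @ es2) t \<tau>" if b: "exec TRAVERSE \<sigma>2 es2 t2 \<tau>" for es2 t2 \<tau>
  proof -
    obtain t where t: "t \<le> T' + t2" "exec TRAVERSE \<sigma>1 (es' @ es2) t \<tau>" using 2(2)[OF b] by blast
    obtain t' where t': "t' \<le> T + t" "exec TRAVERSE \<sigma> (es @ es' @ es2) t' \<tau>" using 1(2)[OF t(2)] by blast
    then show ?thesis using t(1) by (intro exI[of _ t']) simp
  qed
  then show "\<exists>\<sigma>'. state_inv n \<alpha>'' c'' k'' \<sigma>' \<and> (\<forall>es2 t2 \<tau>. exec TRAVERSE \<sigma>' es2 t2 \<tau> \<longrightarrow>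
      (\<exists>t\<le>T + T' + t2. exec TRAVERSE \<sigma> ((es @ es') @ es2) t \<tau>))" using 2(1) by blast
qed

lemma goes_moves:
  assumes "moves n \<alpha> c k es T \<alpha>' c' k'"
  shows "goes n \<alpha> c k es (T + 1) \<alpha>' c' k'"
  unfolding goes_def
proof (intro allI impI)
  fix \<sigma> assume I: "state_inv n \<alpha> c k \<sigma>"
  with assms obtain t \<sigma>' where 1: "exec BODY \<sigma> es t \<sigma>'" "t \<le> T" "state_inv n \<alpha>' c' k' \<sigma>'"
    unfolding moves_def wp_events_def by blast
  have "eval_ex \<sigma> (Var 3) \<noteq> 0" using I by (simp add: state_inv_def)
  then have "\<exists>t'\<le>T + 1 + t2. exec TRAVERSE \<sigma> (es @ es2) t' \<tau>" if "exec TRAVERSE \<sigma>' es2 t2 \<tau>" for es2 t2 \<tau>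
    using exec_Loop1[OF _ 1(1) that[unfolded TRAVERSE_def]] 1(2) unfolding TRAVERSE_def
    by (intro exI[of _ "Suc (t + t2)"]) simp
  then show "\<exists>\<sigma>'. state_inv n \<alpha>' c' k' \<sigma>' \<and> (\<forall>es2 t2 \<tau>. exec TRAVERSE \<sigma>' es2 t2 \<tau> \<longrightarrow>
      (\<exists>t\<le>T + 1 + t2. exec TRAVERSE \<sigma> (es @ es2) t \<tau>))" using 1(3) by blast
qed

text \<open>A periodic node is a leaf whose output may be much shorter than \<open>n\<close>, so its time is charged to its
  parent; every other node pays for itself and, by the three spare units, for the moves to it and back.\<close>

definition time_ok :: "nat \<Rightarrow> bool list \<Rightarrow> ctree \<Rightarrow> nat \<Rightarrow> bool" where
  "time_ok n \<alpha> t T \<longleftrightarrow> (if periodic \<alpha> then T \<le> 3 * (unit_cost * n) else T + 3 * (unit_cost * n) \<le> 80 * (unit_cost * n) * weight t)"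

definition traversed :: "nat \<Rightarrow> bool list \<Rightarrow> nat \<Rightarrow> ctree \<Rightarrow> bool" where
  "traversed n \<alpha> c t \<longleftrightarrow> (\<exists>E T. rcl_walk t = Enter \<alpha> c # E @ [Leave] \<and> goes n \<alpha> c (Suc c) E T \<alpha> c c \<and> time_ok n \<alpha> t T)"

lemma unit_cost_n: "6 \<le> n \<Longrightarrow> 60 * n \<le> unit_cost * n"
  by (simp add: unit_cost_def)

text \<open>The moves to the child and back cost at most three units. A periodic child adds three
  units of its own; an aperiodic one has kept three units in reserve.\<close>

lemma go_child:
  assumes n: "6 \<le> n" and A: "necklace_of \<alpha> \<in> asym_bracelets n" and len: "length \<alpha> = n" and kc: "k \<noteq> c"
    and ch: "k \<in> set (child_indices n \<alpha>)" and c: "change_ok n \<alpha> c" and t: "traversed n (flip \<alpha> k) k t"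
  shows "\<exists>T. goes n \<alpha> c k (rcl_walk t) T \<alpha> c (Suc k) \<and>
    T \<le> (if periodic (flip \<alpha> k) then 6 * (unit_cost * n) else 0) + 80 * (unit_cost * n) * weight t"
proof -
  let ?U = "unit_cost * n"
  from t obtain E T where E: "rcl_walk t = Enter (flip \<alpha> k) k # E @ [Leave]"
    "goes n (flip \<alpha> k) k (Suc k) E T (flip \<alpha> k) k k" "time_ok n (flip \<alpha> k) t T" unfolding traversed_def by blast
  have "goes n \<alpha> c k ([Enter (flip \<alpha> k) k] @ E @ [Leave]) ((?U + 1) + (T + (?U + 1))) \<alpha> c (Suc k)"
    by (rule goes_trans[OF goes_moves[OF move_child[OF n A kc ch]] goes_trans[OF E(2) goes_moves[OF move_leave[OF n A len ch c]]]])
  moreover have "?U + 1 + (T + (?U + 1)) \<le> (if periodic (flip \<alpha> k) then 6 * ?U else 0) + 80 * ?U * weight t"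
  proof -
    have u: "2 \<le> ?U" using unit_cost_n[OF n] n by linarith
    show ?thesis using E(3) u unfolding time_ok_def by (cases "periodic (flip \<alpha> k)") auto
  qed
  ultimately show ?thesis using E(1) by auto
qed

text \<open>Each position is allowed nine steps, eight for a rejection by the filter and one for the
  loop test. A position in \<open>Bd\<close> is allowed six units more, for a failing test or for a
  periodic child.\<close>

lemma go_scan:
  assumes n: "6 \<le> n" and A: "necklace_of \<alpha> \<in> asym_bracelets n" and len: "length \<alpha> = n"
    and c: "set (child_indices n \<alpha>) \<noteq> {} \<Longrightarrow> change_ok n \<alpha> c"
    and skip: "\<And>k. 1 \<le> k \<Longrightarrow> k \<le> n \<Longrightarrow> k \<noteq> c \<Longrightarrow> k \<notin> set (child_indices n \<alpha>) \<Longrightarrow>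
      moves n \<alpha> c k [] (8 + (if k \<in> Bd then unit_cost * n else 0)) \<alpha> c (Suc k)"
    and aper: "\<And>k. k \<in> set (child_indices n \<alpha>) \<Longrightarrow> k \<notin> Bd \<Longrightarrow> \<not> periodic (flip \<alpha> k)"
    and k: "1 \<le> k1" "k1 \<le> k2" "k2 \<le> Suc n" "c \<notin> {k1..<k2}"
    and ts: "list_all2 (\<lambda>k t. traversed n (flip \<alpha> k) k t) (filter (\<lambda>k. k \<in> set (child_indices n \<alpha>)) [k1..<k2]) ts"
  shows "\<exists>T. goes n \<alpha> c k1 (concat (map rcl_walk ts)) T \<alpha> c k2 \<and>
    T \<le> 9 * (k2 - k1) + 6 * (unit_cost * n) * card (Bd \<inter> {k1..<k2}) + 80 * (unit_cost * n) * sum_list (map weight ts)"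
  using k(2,3,4) ts
proof (induction k2 arbitrary: ts rule: dec_induct)
  case base
  then show ?case using goes_refl by fastforce
next
  case (step k)
  let ?U = "unit_cost * n" and ?C = "set (child_indices n \<alpha>)"
  have kk: "1 \<le> k" "k \<le> n" "k \<noteq> c" using step k(1) by auto
  have cd: "card (Bd \<inter> {k1..<Suc k}) = card (Bd \<inter> {k1..<k}) + of_bool (k \<in> Bd)"
  proof -
    have "Bd \<inter> {k1..<Suc k} = (if k \<in> Bd then insert k (Bd \<inter> {k1..<k}) else Bd \<inter> {k1..<k})"
      using step.hyps(1) by (auto simp: less_Suc_eq)
    then show ?thesis by simp
  qed
  have up: "[k1..<Suc k] = [k1..<k] @ [k]" using step by simp
  show ?case
  proof (cases "k \<in> ?C")
    case False
    then have "list_all2 (\<lambda>k t. traversed n (flip \<alpha> k) k t) (filter (\<lambda>k. k \<in> ?C) [k1..<k]) ts"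
      using step.prems(3) unfolding up by simp
    with step.IH[of ts] step.prems obtain T where T: "goes n \<alpha> c k1 (concat (map rcl_walk ts)) T \<alpha> c k"
      "T \<le> 9 * (k - k1) + 6 * ?U * card (Bd \<inter> {k1..<k}) + 80 * ?U * sum_list (map weight ts)" by auto
    from goes_trans[OF T(1) goes_moves[OF skip[OF kk False]]]
    have "goes n \<alpha> c k1 (concat (map rcl_walk ts)) (T + (8 + (if k \<in> Bd then ?U else 0) + 1)) \<alpha> c (Suc k)" by simp
    moreover have "T + (8 + (if k \<in> Bd then ?U else 0) + 1) \<le>
        9 * (Suc k - k1) + 6 * ?U * card (Bd \<inter> {k1..<Suc k}) + 80 * ?U * sum_list (map weight ts)"
      using T(2) step.hyps unfolding cd by (auto simp: Suc_diff_le algebra_simps)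
    ultimately show ?thesis by blast
  next
    case True
    then have "list_all2 (\<lambda>k t. traversed n (flip \<alpha> k) k t) (filter (\<lambda>k. k \<in> ?C) [k1..<k] @ [k]) ts"
      using step.prems(3) unfolding up by simp
    then obtain us t where us: "ts = us @ [t]" "traversed n (flip \<alpha> k) k t"
      "list_all2 (\<lambda>k t. traversed n (flip \<alpha> k) k t) (filter (\<lambda>k. k \<in> ?C) [k1..<k]) us"
      by (auto simp: list_all2_append1 list_all2_Cons1)
    from step.IH[of us] step.prems us obtain T where T: "goes n \<alpha> c k1 (concat (map rcl_walk us)) T \<alpha> c k"
      "T \<le> 9 * (k - k1) + 6 * ?U * card (Bd \<inter> {k1..<k}) + 80 * ?U * sum_list (map weight us)" by auto
    have "?C \<noteq> {}" using True by (metis empty_iff)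
    then have "change_ok n \<alpha> c" by (rule c)
    from go_child[OF n A len kk(3) True this us(2)] obtain T' where
      T': "goes n \<alpha> c k (rcl_walk t) T' \<alpha> c (Suc k)"
      "T' \<le> (if periodic (flip \<alpha> k) then 6 * ?U else 0) + 80 * ?U * weight t" by blast
    have "(if periodic (flip \<alpha> k) then 6 * ?U else 0) \<le> 6 * ?U * of_bool (k \<in> Bd)"
      using aper[OF True] by auto
    then have "T + T' \<le> 9 * (Suc k - k1) + 6 * ?U * card (Bd \<inter> {k1..<Suc k}) + 80 * ?U * sum_list (map weight ts)"
      using T(2) T'(2) step.hyps unfolding cd us(1) by (simp add: Suc_diff_le algebra_simps)
    moreover have "goes n \<alpha> c k1 (concat (map rcl_walk ts)) (T + T') \<alpha> c (Suc k)"
      using goes_trans[OF T(1) T'(1)] us(1) by simp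
    ultimately show ?thesis by blast
  qed
qed

lemma weight_node:
  "weight (CNode \<alpha> c rs ls) = of_bool (\<not> periodic \<alpha>) + sum_list (map weight rs) + sum_list (map weight ls)"
proof -
  have "length (filter (\<lambda>\<alpha>. \<not> periodic \<alpha>) (concat (map rcl_order ts))) = sum_list (map weight ts)" for ts
    by (induction ts) (auto simp: weight_def)
  then show ?thesis by (simp add: weight_def)
qed

lemma child_indices_split:
  assumes "1 \<le> c" "c \<le> n"
  shows "filter (\<lambda>k. k > c) (child_indices n \<alpha>) = filter (\<lambda>k. k \<in> set (child_indices n \<alpha>)) [Suc c..<Suc n]"
    "filter (\<lambda>k. k < c) (child_indices n \<alpha>) = filter (\<lambda>k. k \<in> set (child_indices n \<alpha>)) [1..<c]"
proof -
  have e: "child_indices n \<alpha> = filter (\<lambda>k. k \<in> set (child_indices n \<alpha>)) [1..<Suc n]"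
    unfolding child_indices_def by (auto intro: filter_cong)
  have u: "[1..<Suc n] = [1..<c] @ [c] @ [Suc c..<Suc n]"
    using assms upt_add_eq_append[of 1 c "Suc n - c"] upt_conv_Cons[of c "Suc n"] by simp
  show "filter (\<lambda>k. k > c) (child_indices n \<alpha>) = filter (\<lambda>k. k \<in> set (child_indices n \<alpha>)) [Suc c..<Suc n]"
    by (subst e) (unfold u, auto simp: filter_empty_conv intro: filter_cong)
  show "filter (\<lambda>k. k < c) (child_indices n \<alpha>) = filter (\<lambda>k. k \<in> set (child_indices n \<alpha>)) [1..<c]"
    by (subst e) (unfold u, auto simp: filter_empty_conv intro: filter_cong)
qed

text \<open>An aperiodic node spends at most \<open>66\<close> units on its eleven or fewer special
  positions, one on its output, at most one on the scan, and keeps three in reserve for the moves to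
  and from it; \<open>80\<close> units suffice.\<close>

lemma traverse_subtree:
  assumes "subtree_at n \<alpha> c t" and n: "6 \<le> n" and "reach n D \<alpha>" "1 \<le> c" "c \<le> n" "\<not> periodic \<alpha> \<Longrightarrow> change_ok n \<alpha> c"
  shows "traversed n \<alpha> c t"
  using assms(1,3-6)
proof (induction arbitrary: D rule: subtree_at.induct)
  case (1 \<alpha> c rs ls)
  let ?U = "unit_cost * n" and ?C = "set (child_indices n \<alpha>)"
  have len: "length \<alpha> = n" and A: "necklace_of \<alpha> \<in> asym_bracelets n" using reach_asym[OF "1.prems"(1) n] by auto
  have n0: "0 < n" using n by simp
  \<comment> \<open>A node with a child is aperiodic, so its change index is determined by its
    label.\<close>
  have co: "change_ok n \<alpha> c" if "?C \<noteq> {}"     using that "1.prems"(4) by (auto simp: child_indices_def split: if_splits)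
  have ch: "traversed n (flip \<alpha> k) k t"
    if k: "k \<in> ?C" and IH: "\<And>D. reach n D (flip \<alpha> k) \<Longrightarrow> 1 \<le> k \<Longrightarrow> k \<le> n \<Longrightarrow>
      (\<not> periodic (flip \<alpha> k) \<Longrightarrow> change_ok n (flip \<alpha> k) k) \<Longrightarrow> traversed n (flip \<alpha> k) k t" for k t
  proof (rule IH)
    show "reach n (Suc D) (flip \<alpha> k)" using "1.prems"(1) k by (rule reach.intros)
    show "1 \<le> k" "k \<le> n" using k by (auto simp: set_child_indices)
    assume "\<not> periodic (flip \<alpha> k)"
    then show "change_ok n (flip \<alpha> k) k"
      using change_index_of_child[OF len n0 A k] k by (auto simp: change_ok_def set_child_indices)
  qed
  have rs: "list_all2 (\<lambda>k t. traversed n (flip \<alpha> k) k t) (filter (\<lambda>k. k \<in> ?C) [Suc c..<Suc n]) rs"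
    using "1.IH"(1) unfolding child_indices_split(1)[OF "1.prems"(2,3)]
    by (rule list.rel_mono_strong) (auto intro: ch)
  have ls: "list_all2 (\<lambda>k t. traversed n (flip \<alpha> k) k t) (filter (\<lambda>k. k \<in> ?C) [1..<c]) ls"
    using "1.IH"(2) unfolding child_indices_split(2)[OF "1.prems"(2,3)]
    by (rule list.rel_mono_strong) (auto intro: ch)
  \<comment> \<open>A periodic node runs no tests; for an aperiodic one \<open>Bd\<close> consists
    of the special positions, carried over from the necklace to the label.\<close>
  obtain Bd where Bd: "finite Bd" "card Bd \<le> (if periodic \<alpha> then 0 else 11)"
    and skip: "\<And>k. 1 \<le> k \<Longrightarrow> k \<le> n \<Longrightarrow> k \<noteq> c \<Longrightarrow> k \<notin> ?C \<Longrightarrow>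
      moves n \<alpha> c k [] (8 + (if k \<in> Bd then ?U else 0)) \<alpha> c (Suc k)"
    and aper: "\<And>k. k \<in> ?C \<Longrightarrow> k \<notin> Bd \<Longrightarrow> \<not> periodic (flip \<alpha> k)"
  proof (cases "periodic \<alpha>")
    case True
    show thesis
      by (rule that[of "{}"]) (use True move_skip_periodic[OF n _ _ _ True] in \<open>auto simp: set_child_indices\<close>)
  next
    case False
    obtain d where d: "d < n" "rotate d \<alpha> = necklace_of \<alpha>" using necklace_rotation[OF len n0] by blast
    obtain z M r s h a where sh: "shape (necklace_of \<alpha>) z M r s h a" using shape_ex[OF A n0] by blast
    let ?S = "special n z M r s h a"
    show thesis
    proof (rule that[of "special_labels n d ?S"])
      show "finite (special_labels n d ?S)" by (simp add: special_labels_def)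
      show "card (special_labels n d ?S) \<le> (if periodic \<alpha> then 0 else 11)"
        using card_special_labels[OF d(1) _ card_special[of n z M r s h a]] False by (simp add: special_def)
      fix k
      show "moves n \<alpha> c k [] (8 + (if k \<in> special_labels n d ?S then ?U else 0)) \<alpha> c (Suc k)"
        if "1 \<le> k" "k \<le> n" "k \<noteq> c" "k \<notin> ?C"
        using that by (intro move_skip[OF n _ _ _ _ A False d sh])
      show "\<not> periodic (flip \<alpha> k)" if "k \<in> ?C" "k \<notin> special_labels n d ?S"
      proof -
        have k: "1 \<le> k" "k \<le> n" using that(1) by (auto simp: set_child_indices)
        show ?thesis
          by (rule candidate_imp_child(2)[OF len refl A d(2,1) sh False k child_imp_candidate(1)[OF len refl A d(2,1) sh that(1)]])
            (use that(2) k in \<open>auto simp: special_labels_def\<close>)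
      qed
    qed
  qed
  obtain TR where R: "goes n \<alpha> c (Suc c) (concat (map rcl_walk rs)) TR \<alpha> c (Suc n)"
    "TR \<le> 9 * (Suc n - Suc c) + 6 * ?U * card (Bd \<inter> {Suc c..<Suc n}) + 80 * ?U * sum_list (map weight rs)"
    using go_scan[OF n A len co skip aper _ _ _ _ rs] "1.prems" by auto
  obtain TL where L: "goes n \<alpha> c 1 (concat (map rcl_walk ls)) TL \<alpha> c c"
    "TL \<le> 9 * (c - 1) + 6 * ?U * card (Bd \<inter> {1..<c}) + 80 * ?U * sum_list (map weight ls)"
    using go_scan[OF n A len co skip aper _ _ _ _ ls] "1.prems" by auto
  let ?E = "concat (map rcl_walk rs) @ map Emit (ap \<alpha>) @ concat (map rcl_walk ls)" and ?T = "TR + ((?U + 1) + TL)"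
  have "goes n \<alpha> c (Suc c) ?E ?T \<alpha> c c"
    by (rule goes_trans[OF R(1) goes_trans[OF goes_moves[OF move_emit[OF n "1.prems"(3)]] L(1)]])
  moreover have "time_ok n \<alpha> (CNode \<alpha> c rs ls) ?T"
  proof -
    have "card (Bd \<inter> {Suc c..<Suc n}) + card (Bd \<inter> {1..<c}) = card (Bd \<inter> {Suc c..<Suc n} \<union> Bd \<inter> {1..<c})"
      using Bd(1) by (intro card_Un_disjoint[symmetric]) auto
    also have "\<dots> \<le> card Bd" using Bd(1) by (intro card_mono) auto
    finally have cB: "card (Bd \<inter> {Suc c..<Suc n}) + card (Bd \<inter> {1..<c}) \<le> (if periodic \<alpha> then 0 else 11)"
      using Bd(2) by simp
    then have c6: "6 * ?U * card (Bd \<inter> {Suc c..<Suc n}) + 6 * ?U * card (Bd \<inter> {1..<c}) \<le> 6 * ?U * (if periodic \<alpha> then 0 else 11)"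
      by (metis distrib_left mult_le_mono2)
    have "9 * (Suc n - Suc c) + 9 * (c - 1) \<le> 9 * n" using "1.prems" by simp
    then have tot: "?T \<le> 9 * n + ?U + 1 + 6 * ?U * (if periodic \<alpha> then 0 else 11) +
       80 * ?U * (sum_list (map weight rs) + sum_list (map weight ls))"
      using R(2) L(2) c6 by (simp add: algebra_simps)
    show ?thesis
    proof (cases "periodic \<alpha>")
      case True
      then have "child_indices n \<alpha> = []" by (simp add: child_indices_def)
      then have "rs = []" "ls = []" using rs ls by auto
      then have "?T \<le> 9 * n + ?U + 1" using tot True by simp
      then have "?T \<le> 3 * ?U" using unit_cost_n[OF n] n by linarith
      then show ?thesis using True unfolding time_ok_def by simp
    next
      case False
      have "?T + 3 * ?U \<le> 80 * ?U * (1 + (sum_list (map weight rs) + sum_list (map weight ls)))"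
      proof -
        have "?T \<le> 9 * n + ?U + 1 + 66 * ?U + 80 * ?U * (sum_list (map weight rs) + sum_list (map weight ls))"
          using tot False by simp
        then show ?thesis using unit_cost_n[OF n] n unfolding distrib_left[of _ 1] mult_1_right by linarith
      qed
      then show ?thesis using False unfolding time_ok_def weight_node by (simp add: add.assoc)
    qed
  qed
  ultimately show ?case unfolding traversed_def by (intro exI[of _ ?E] exI[of _ ?T]) simp
qed

subsection \<open>The whole program\<close>

lemma root_label_update:
  assumes "6 \<le> n"
  shows "(replicate n False)[n - 4 := True, n - 2 := True, n - Suc 0 := True] = root_label n"
proof -
  define m where "m = n - 4"
  have n: "n = m + 4" using assms by (simp add: m_def)
  have "replicate n False = replicate m False @ [False, False, False, False]"
    unfolding n replicate_add by (simp add: eval_nat_numeral)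
  moreover have "n - 4 = m" "n - 2 = m + 2" "n - Suc 0 = m + 3" using n by auto
  ultimately show ?thesis by (simp add: root_label_def list_update_append eval_nat_numeral)
qed

lemma exec_final:
  assumes "6 \<le> n" "state_inv n (root_label n) n n \<sigma>"
  shows "\<exists>t \<tau>. exec TRAVERSE \<sigma> [Leave] t \<tau> \<and> t \<le> 10"
proof -
  have P: "prepared \<sigma>" "fst \<sigma> 0 = n" "bits \<sigma> 0 = root_label n" "fst \<sigma> 2 = n" "fst \<sigma> 1 = n" "fst \<sigma> 3 = 1"
    using assms(2) by (auto simp: state_inv_def)
  have 12: "fst \<sigma> 12 = 1" using preparedD(8)[OF P(1)] P necklace_of_root[OF assms(1)] by simp
  let ?\<tau> = "assign 3 (eval_ex \<sigma> (Cst 0)) \<sigma>"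
  have "exec UP \<sigma> ([Leave] @ []) (Suc (1 + Suc 1)) ?\<tau>"
    unfolding UP_def by (rule exec_Seq[OF exec_Lv exec_Cond1[OF _ exec_Asg]]) (use 12 in simp)
  then have "exec BODY \<sigma> [Leave] (Suc (Suc (1 + Suc 1))) ?\<tau>"
    unfolding BODY_def by (intro exec_Cond1) (use P in simp_all)
  moreover have "exec TRAVERSE ?\<tau> [] 1 ?\<tau>" unfolding TRAVERSE_def by (intro exec_Loop2) simp
  ultimately have "exec TRAVERSE \<sigma> ([Leave] @ []) (Suc (Suc (Suc (1 + Suc 1)) + 1)) ?\<tau>"
    unfolding TRAVERSE_def using P by (intro exec_Loop1[of _ _ _ _ _ ?\<tau>]) simp_all
  then show ?thesis by (intro exI[of _ "Suc (Suc (Suc (1 + Suc 1)) + 1)"] exI[of _ ?\<tau>]) simp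
qed

lemma root_aperiodic: assumes "6 \<le> n" shows "\<not> periodic (root_label n)"
  using zero_block_aperiodic[OF root_zero_block[OF assms]] by (simp add: root_label_def)

lemma exec_MAIN:
  assumes n: "6 \<le> n" and s: "fst \<sigma> 0 = n" "\<And>j i. \<not> snd \<sigma> j i"
  shows "\<exists>t \<tau>. exec MAIN \<sigma> (rcl_walk (conc_tree n)) t \<tau> \<and>
    t \<le> time_coeff INIT * n + time_coeff PREP * n + 80 * (unit_cost * n) * weight (conc_tree n) + 20"
proof -
  have A: "root_label n \<in> asym_bracelets n" by (rule root_asym[OF n])
  have nk: "necklace_of (root_label n) = root_label n" by (rule necklace_of_root[OF n])
  have b0: "bits \<sigma> 1 = replicate n False" using s by (intro nth_equalityI) (auto simp: bits_nth)
  have "wp INIT (\<lambda>\<sigma>'. fst \<sigma>' 0 = n \<and> bits \<sigma>' 0 = root_label n \<and> bits \<sigma>' 1 = root_label n \<and> fst \<sigma>' 1 = n \<and>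
      fst \<sigma>' 2 = Suc n \<and> fst \<sigma>' 3 = 1) \<sigma>"
    unfolding INIT_def
    apply (rule wp_Seq, rule wp_Put, rule wp_Seq, rule wp_Put, rule wp_Seq, rule wp_Put, rule wp_Seq, rule wp_COPY, simp)
    subgoal premises p for \<sigma>1
      using frame_all[OF p(1)] p(2) s n b0 root_label_update[OF n]
      by (intro wp_Seq wp_Asg) (simp add: bits_put_bit)
    done
  from wpD[OF this] n s obtain t1 \<sigma>1 where 1: "exec INIT \<sigma> [] t1 \<sigma>1" "t1 \<le> time_coeff INIT * n"
    "fst \<sigma>1 0 = n" "bits \<sigma>1 0 = root_label n" "bits \<sigma>1 1 = root_label n" "fst \<sigma>1 1 = n" "fst \<sigma>1 2 = Suc n" "fst \<sigma>1 3 = 1"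
    by auto
  have "wp PREP (state_inv n (root_label n) n (Suc n)) \<sigma>1"
  proof (rule wp_PREP)
    fix \<sigma>' assume "frame PREP \<sigma>1 \<sigma>'" "prepared \<sigma>'"
    then show "state_inv n (root_label n) n (Suc n) \<sigma>'" using frame_all[of PREP \<sigma>1 \<sigma>'] 1 by (simp add: state_inv_def)
  qed (use 1 A nk in auto)
  from wpD[OF this] n 1 obtain t2 \<sigma>2 where 2: "exec PREP \<sigma>1 [] t2 \<sigma>2" "t2 \<le> time_coeff PREP * n"
    "state_inv n (root_label n) n (Suc n) \<sigma>2" by auto
  have "traversed n (root_label n) n (conc_tree n)"
    by (rule traverse_subtree[OF conc_tree[OF n] n reach.intros(1)]) (use n nk in \<open>auto simp: change_ok_def\<close>)
  then obtain E T where E: "rcl_walk (conc_tree n) = Enter (root_label n) n # E @ [Leave]"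
    "goes n (root_label n) n (Suc n) E T (root_label n) n n" "time_ok n (root_label n) (conc_tree n) T"
    unfolding traversed_def by blast
  from E(2) 2(3) obtain \<sigma>3 where 3: "state_inv n (root_label n) n n \<sigma>3"
    "\<And>es2 t2 \<tau>. exec TRAVERSE \<sigma>3 es2 t2 \<tau> \<Longrightarrow> \<exists>t\<le>T + t2. exec TRAVERSE \<sigma>2 (E @ es2) t \<tau>" unfolding goes_def by blast
  obtain t4 \<tau> where 4: "exec TRAVERSE \<sigma>3 [Leave] t4 \<tau>" "t4 \<le> 10" using exec_final[OF n 3(1)] by blast
  obtain t5 where 5: "t5 \<le> T + t4" "exec TRAVERSE \<sigma>2 (E @ [Leave]) t5 \<tau>" using 3(2)[OF 4(1)] by blast
  have "exec (Ent (Var 1)) \<sigma>1 [Enter (root_label n) n] 1 \<sigma>1" using exec_Ent[of "Var 1" \<sigma>1] 1 by simp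
  from exec_Seq[OF 1(1) exec_Seq[OF this exec_Seq[OF 2(1) 5(2)]]]
  have m: "exec MAIN \<sigma> (rcl_walk (conc_tree n)) (Suc (t1 + Suc (1 + Suc (t2 + t5)))) \<tau>"
    unfolding MAIN_def E(1) by simp
  have "T \<le> 80 * (unit_cost * n) * weight (conc_tree n)"
    using E(3) root_aperiodic[OF n] by (simp add: time_ok_def)
  then have "Suc (t1 + Suc (1 + Suc (t2 + t5))) \<le> time_coeff INIT * n + time_coeff PREP * n + 80 * (unit_cost * n) * weight (conc_tree n) + 20"
    using 1(2) 2(2) 4(2) 5(1) by linarith
  then show ?thesis using m by blast
qed

text \<open>Both time bounds come from \<open>n\<close> times the weight of the tree, which is at
  most \<open>Lsum n\<close> and at most the length of the output; a single \<open>K\<close>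
  dominates all constants.\<close>

theorem theorem5:
  shows "\<exists>(P :: cmd list) (K :: nat). \<forall>n\<ge>6. \<exists>(T :: nat) (es :: event list).
           halts_within P n T es \<and>
           es = rcl_walk (conc_tree n) \<and>
           output_bits es = RCL (conc_tree n) \<and>
           T \<le> K * Lsum n \<and>
           T \<le> K * length (RCL (conc_tree n)) \<and>
           space_within P n (K * n ^ 2) \<and>
           words_below P n (n ^ K)"
proof -
  define c where "c = compile MAIN"
  have safe: "safe c" unfolding c_def by (rule safe_compile[OF wf_MAIN])
  define K where "K = time_coeff INIT + time_coeff PREP + 80 * unit_cost + 21 + height c + 60"
  have "\<exists>T es. halts_within [c] n T es \<and> es = rcl_walk (conc_tree n) \<and> output_bits es = RCL (conc_tree n) \<and>
      T \<le> K * Lsum n \<and> T \<le> K * length (RCL (conc_tree n)) \<and> space_within [c] n (K * n ^ 2) \<and> words_below [c] n (n ^ K)"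
    if n: "n \<ge> 6" for n
  proof -
    let ?m = "(\<lambda>_. 0)(0 := n) :: mem" and ?W = "weight (conc_tree n)"
    have "fst (abstract_state ?m) 0 = n" "\<And>j i. \<not> snd (abstract_state ?m) j i" by (auto simp: abstract_state_def)
    from exec_MAIN[OF n this] obtain t \<tau> where t: "exec MAIN (abstract_state ?m) (rcl_walk (conc_tree n)) t \<tau>"
      "t \<le> time_coeff INIT * n + time_coeff PREP * n + 80 * (unit_cost * n) * ?W + 20" by blast
    from exec_compile[OF t(1) refl wf_MAIN, of "[c]" "[]" "[]"] n obtain m' where
      m': "(step [c] ^^ t) ([c], ?m, []) = ([], m', rcl_walk (conc_tree n))" by (auto simp: c_def)
    \<comment> \<open>The extra step is the initial call.\<close>
    have "config_at [c] n (Suc t) = (step [c] ^^ t) ([c], ?m, [])"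
      unfolding config_at_def by (simp add: funpow_Suc_right del: funpow.simps)
    then have h: "halts_within [c] n (Suc t) (rcl_walk (conc_tree n))" unfolding halts_within_def using m' by auto
    \<comment> \<open>The root is aperiodic, and its \<open>n\<close> bits pay for the
      initialisation.\<close>
    have W: "1 \<le> ?W"
    proof -
      have "subtree_at n (root_label n) n (conc_tree n)" by (rule conc_tree[OF n])
      then obtain rs ls where "conc_tree n = CNode (root_label n) n rs ls" by cases
      moreover have "\<not> periodic (root_label n)" by (rule root_aperiodic[OF n])
      ultimately show ?thesis by (simp add: weight_node)
    qed
    have nW: "n \<le> n * ?W" using W by simp
    have "Suc t \<le> (time_coeff INIT + time_coeff PREP + 80 * unit_cost + 21) * (n * ?W)"
    proof -
      have "time_coeff INIT * n \<le> time_coeff INIT * (n * ?W)" "time_coeff PREP * n \<le> time_coeff PREP * (n * ?W)" using nW by (intro mult_le_mono2; simp)+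
      moreover have "21 \<le> 21 * (n * ?W)" using nW n by linarith
      moreover have "80 * (unit_cost * n) * ?W = 80 * unit_cost * (n * ?W)" by simp
      ultimately show ?thesis using t(2) unfolding distrib_right by linarith
    qed
    also have "\<dots> \<le> K * (n * ?W)" by (intro mult_le_mono1) (simp add: K_def)
    finally have T: "Suc t \<le> K * (n * ?W)" .
    have "length \<delta> = n" if "\<delta> \<in> set (rcl_order (conc_tree n))" for \<delta>
      using subtree_reach[OF conc_tree[OF n] reach.intros(1) that] reach_asym(2) n by blast
    then have "n * ?W \<le> length (RCL (conc_tree n))" using n by (intro weight_RCL) auto
    then have "Suc t \<le> K * length (RCL (conc_tree n))" using T by (meson le_trans mult_le_mono2)
    moreover have "Suc t \<le> K * Lsum n" using T weight_Lsum[OF n] by (meson le_trans mult_le_mono2)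
    moreover have "space_within [c] n (K * n ^ 2)" "words_below [c] n (n ^ K)"
      using space_words[OF safe n] by (auto simp: K_def)
    ultimately show ?thesis using h output_rcl_walk by blast
  qed
  then show ?thesis by blast
qed

end
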